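(* Let $H$ be the hyperbolic plane, $\mu$ its canonical volume measure, and let $P$ be the classical Riemannian perimeter functional in $H$, \[ P(E):=\sup\Big\{\int_H\mathbf 1_E\,\mathrm{div}_Hv\,d\mu\ :\ \|v\|_\infty\le1\Big\}, \] the supremum being taken over smooth vector fields $v$ with compact support on $H$, with $\|v\|_\infty:=\sup_{p\in H}|v_p|_p$, where $|\cdot|_p$ is the Riemannian norm of a vector in $T_pH$. Let $N\in\mathbb N\cup\{\infty\}$. Then for every $\mathbf m\in\mathbb R^N_+$ there exists a minimal generalized $N$-cluster $\mathbf E$ in $H$ with $\mathbf m^\infty(\mathbf E)=\mathbf m$.
   Context: $\mathrm{div}_H$ denotes the Riemannian divergence on $H$. $\mathbb R^N_+$ is the set of vectors (sequences if $N=\infty$) with nonnegative real components. An $N$-cluster in $H$, $N\in\mathbb N\cup\{\infty\}$, is $\mathbf E=(E_j)_{j=1}^N$ with each $E_j\subset H$ Borel (possibly empty) and $\mu(E_i\cap E_j)=0$ for $i\ne j$. One sets $\mathbf m(\mathbf E):=(\mu(E_j))_{j=1}^N$ and $P(\mathbf E):=\frac12\sum_{j\ge1}P(E_j)+\frac12P\big(\bigcup_{j\ge1}E_j\big)$. Let $H^\infty:=\mathbb Z\times H$ and $\phi_j\colon H\to H^\infty$, $\phi_j(x)=(j,x)$. A generalized $N$-cluster in $H$ is $\mathbf E=(E_i)_{i=1}^N$ with $E_i\subset H^\infty$ such that for each $j\in\mathbb Z$ the vector $\mathbf E^j$ with components $E_i^j:=\phi_j^{-1}(E_i)$, $i=1,\dots,N$,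 is an $N$-cluster in $H$. One sets $\mathbf m^\infty(\mathbf E):=\sum_{j\in\mathbb Z}\mathbf m(\mathbf E^j)$ and $P^\infty(\mathbf E):=\sum_{j\in\mathbb Z}P(\mathbf E^j)$. A generalized $N$-cluster $\mathbf E$ is minimal (isoperimetric) if $P^\infty(\mathbf E)=\inf\{P^\infty(\mathbf F):\mathbf F\text{ a generalized }N\text{-cluster in }H,\ \mathbf m^\infty(\mathbf F)=\mathbf m^\infty(\mathbf E)\}$. *)

theory Defs
  imports "HOL-Analysis.Analysis" "HOL-Library.Extended_Nat"
begin

section \<open>The hyperbolic plane\<close>

text \<open>The upper half-plane model.  The tangent space at every point is identified with
  \<^typ>\<open>complex\<close>, regarded as a real inner product space with orthonormal basis 1, i.\<close>

definition hyp_plane :: "complex set" where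
  "hyp_plane = {z. 0 < Im z}"

definition hyp_metric :: "complex \<Rightarrow> complex \<Rightarrow> complex \<Rightarrow> real" where
  "hyp_metric p u w = (u \<bullet> w) / (Im p)\<^sup>2"

definition hyp_norm :: "complex \<Rightarrow> complex \<Rightarrow> real" where
  "hyp_norm p u = sqrt (hyp_metric p u u)"

text \<open>The square root of the determinant of the Gram matrix of the metric in the coordinate
  frame 1, i; on the half-plane it equals 1 / (Im p)^2.\<close>

definition hyp_density :: "complex \<Rightarrow> real" where
  "hyp_density p = sqrt (hyp_metric p 1 1 * hyp_metric p \<i> \<i> - hyp_metric p 1 \<i> * hyp_metric p \<i> 1)"

text \<open>The measurable sets are exactly the Borel subsets of the hyperbolic plane.\<close>

definition hyp_measure :: "complex measure" where
  "hyp_measure = density (restrict_space lborel hyp_plane) (\<lambda>p. ennreal (hyp_density p))"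

text \<open>The Riemannian divergence in coordinates: with r the square root of det g, it is
  (1/r) times the sum over k of the partial derivatives d_k (r v^k).\<close>

definition hyp_div :: "(complex \<Rightarrow> complex) \<Rightarrow> complex \<Rightarrow> real" where
  "hyp_div v p =
     (\<Sum>b\<in>Basis. frechet_derivative (\<lambda>q. hyp_density q * (v q \<bullet> b)) (at p) b) / hyp_density p"


section \<open>Perimeter\<close>

text \<open>Continuous differentiability of order n; meant for open sets S.\<close>

primrec C_k_on :: "nat \<Rightarrow> ('a::real_normed_vector \<Rightarrow> 'b::real_normed_vector) \<Rightarrow> 'a set \<Rightarrow> bool" where
  "C_k_on 0 f S \<longleftrightarrow> continuous_on S f"
| "C_k_on (Suc n) f S \<longleftrightarrow>
     (\<forall>x\<in>S. f differentiable (at x)) \<and>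
     (\<forall>e. C_k_on n (\<lambda>x. frechet_derivative f (at x) e) S)"

definition smooth_on :: "('a::real_normed_vector \<Rightarrow> 'b::real_normed_vector) \<Rightarrow> 'a set \<Rightarrow> bool" where
  "smooth_on f S \<longleftrightarrow> (\<forall>n. C_k_on n f S)"

text \<open>The values of a vector field outside the half-plane play no role.  The inclusion of the
  closure in the half-plane makes the support compact in the half-plane itself.\<close>

definition test_fields :: "(complex \<Rightarrow> complex) set" where
  "test_fields = {v. smooth_on v hyp_plane \<and>
     compact (closure {p \<in> hyp_plane. v p \<noteq> 0}) \<and> closure {p \<in> hyp_plane. v p \<noteq> 0} \<subseteq> hyp_plane}"

definition hyp_supnorm :: "(complex \<Rightarrow> complex) \<Rightarrow> ennreal" where
  "hyp_supnorm v = (SUP p\<in>hyp_plane. ennreal (hyp_norm p (v p)))"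

text \<open>The map \<^const>\<open>ennreal\<close> sends negative numbers to 0; this does not change the supremum,
  since the zero field is admissible.\<close>

definition perimeter :: "complex set \<Rightarrow> ennreal" where
  "perimeter E =
     (SUP v\<in>{v \<in> test_fields. hyp_supnorm v \<le> 1}.
        ennreal (\<integral>p. indicator E p * hyp_div v p \<partial>hyp_measure))"


section \<open>Clusters\<close>

text \<open>An N-cluster is a function on the natural numbers of which only the values at the indices
  j with 1 \<le> j \<le> N are relevant; N may be infinite.\<close>

definition cluster_indices :: "enat \<Rightarrow> nat set" where
  "cluster_indices N = {j. 1 \<le> j \<and> enat j \<le> N}"

definition is_cluster :: "enat \<Rightarrow> (nat \<Rightarrow> complex set) \<Rightarrow> bool" where
  "is_cluster N E \<longleftrightarrow>
     (\<forall>j\<in>cluster_indices N. E j \<in> sets hyp_measure) \<and>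
     (\<forall>i\<in>cluster_indices N. \<forall>j\<in>cluster_indices N.
        i \<noteq> j \<longrightarrow> emeasure hyp_measure (E i \<inter> E j) = 0)"

definition cluster_mass :: "(nat \<Rightarrow> complex set) \<Rightarrow> nat \<Rightarrow> ennreal" where
  "cluster_mass E j = emeasure hyp_measure (E j)"

definition cluster_perimeter :: "enat \<Rightarrow> (nat \<Rightarrow> complex set) \<Rightarrow> ennreal" where
  "cluster_perimeter N E =
     (\<Sum>\<^sub>\<infinity>j\<in>cluster_indices N. perimeter (E j)) / 2 + perimeter (\<Union>j\<in>cluster_indices N. E j) / 2"


section \<open>Generalized clusters\<close>

definition hyp_plane_infty :: "(int \<times> complex) set" where
  "hyp_plane_infty = UNIV \<times> hyp_plane"

definition sheet :: "int \<Rightarrow> complex \<Rightarrow> int \<times> complex" where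
  "sheet j x = (j, x)"

definition slice :: "(nat \<Rightarrow> (int \<times> complex) set) \<Rightarrow> int \<Rightarrow> nat \<Rightarrow> complex set" where
  "slice E j i = sheet j -` E i \<inter> hyp_plane"

definition is_gen_cluster :: "enat \<Rightarrow> (nat \<Rightarrow> (int \<times> complex) set) \<Rightarrow> bool" where
  "is_gen_cluster N E \<longleftrightarrow>
     (\<forall>i\<in>cluster_indices N. E i \<subseteq> hyp_plane_infty) \<and> (\<forall>j. is_cluster N (slice E j))"

definition gen_mass :: "(nat \<Rightarrow> (int \<times> complex) set) \<Rightarrow> nat \<Rightarrow> ennreal" where
  "gen_mass E i = (\<Sum>\<^sub>\<infinity>j\<in>UNIV. cluster_mass (slice E j) i)"

definition gen_perimeter :: "enat \<Rightarrow> (nat \<Rightarrow> (int \<times> complex) set) \<Rightarrow> ennreal" where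
  "gen_perimeter N E = (\<Sum>\<^sub>\<infinity>j\<in>UNIV. cluster_perimeter N (slice E j))"

definition minimal_gen_cluster :: "enat \<Rightarrow> (nat \<Rightarrow> (int \<times> complex) set) \<Rightarrow> bool" where
  "minimal_gen_cluster N E \<longleftrightarrow> is_gen_cluster N E \<and>
     gen_perimeter N E =
       Inf {gen_perimeter N F | F. is_gen_cluster N F \<and>
              (\<forall>i\<in>cluster_indices N. gen_mass F i = gen_mass E i)}"

end

theory Submission
  imports Defs "HOL-Library.Diagonal_Subsequence" "HOL-Library.Nat_Bijection"
begin

text \<open>
  The theorem is proved by the direct method.  Take generalized clusters with the prescribed masses
  whose perimeters tend to the infimum.  A limit cluster has to be found that has lost no mass
  and whose perimeter is at most the limit of the perimeters.

  Everything rests on two explicit families of maps of the upper half-plane: the shears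
  \<open>x + iy \<mapsto> x + sy + iy\<close> and the dilations \<open>x + iy \<mapsto> x + icy\<close>.  They are the flows of the unit fields
  \<open>y \<partial>\<^sub>x\<close> and \<open>y \<partial>\<^sub>y\<close>, and differentiating along the flow turns a test function into the divergence
  of an admissible field.  Hence the symmetric difference of a set \<open>E\<close> and its preimage under the map
  has area at most \<open>s P(E)\<close>, respectively \<open>(c - 1) P(E)\<close> (\<open>shear_estimate\<close>, \<open>dilation_estimate\<close>).
  Three consequences are drawn from these estimates.
  \<^item> Dilating by 2 doubles the area, so \<open>\<mu>(E) \<le> P(E)\<close> if \<open>E\<close> has finite area
    (\<open>emeasure_le_perimeter\<close>).  When the infimum is finite, the sum of all prescribed masses is
    therefore finite; this gives uniform control of the union of infinitely many chambers.
  \<^item> Two points of a small square are joined by a short shear and a short dilation, so \<open>E\<close> fills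
    either little or almost all of most small squares (\<open>square_isoperimetric\<close>).  The half-plane is
    tiled by dyadic cells of hyperbolic size about \<open>2\<^sup>-\<^sup>k\<close>; on these cells \<open>E\<close> differs from
    a cellwise constant function by \<open>O(2\<^sup>-\<^sup>k P(E))\<close>, and sequences of sets of bounded
    perimeter are precompact in \<open>L\<^sup>1\<^sub>l\<^sub>o\<^sub>c\<close> (\<open>loc_conv_compact\<close>).
  \<^item> The cells that are at most half filled contain together only area \<open>O(2\<^sup>-\<^sup>k P(E))\<close>
    (\<open>light_cells\<close>), while the number of the other cells is bounded in terms of the mass
    (\<open>card_heavy\<close>).  So no mass vanishes: up to an error \<open>O(2\<^sup>-\<^sup>k)\<close> it stays near a bounded
    number of places.

  The affine maps \<open>z \<mapsto> 2\<^sup>e(z + a)\<close> with integers \<open>e\<close> and \<open>a\<close> are isometries, and each cell of level \<open>k\<close> is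
  the image of a cell in a fixed bounded region under one of them.  Each place where mass concentrates is recorded by such a frame and by the sheet it lies in.  After
  passing to a subsequence, every chamber converges locally as seen from every frame, and two frames
  either keep a constant relative position or move apart to infinite distance (locale \<open>frames\<close>).  The
  limit cluster has one sheet for each class of frames that stay together.  Frames of different
  classes see disjoint parts of the clusters; hence masses do not add up to too much, and test
  fields for the limits can be transported and added to one admissible field, which gives lower
  semicontinuity of the perimeter.  Because the mass is tight, nothing is lost
  (\<open>exists_limit_cluster\<close>).
\<close>

section \<open>Smooth compactly supported functions\<close>

text \<open>The functions \<open>exp (- 1 / t) / t ^ k\<close>, extended by 0.  Their span is closed under
  differentiation, so the smoothness of the first one needs no estimates of higher derivatives.\<close>

definition flat :: "nat \<Rightarrow> real \<Rightarrow> real" where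
  "flat k t = (if 0 < t then exp (- inverse t) * inverse t ^ k else 0)"

lemma flat_nonneg: "0 \<le> flat k t"
  by (auto simp: flat_def)

lemma flat_0_le_1: "flat 0 t \<le> 1"
  by (auto simp: flat_def)

lemma flat_tendsto_0: "(flat k \<longlongrightarrow> 0) (at 0)"
proof -
  have "((\<lambda>t. inverse t ^ k / exp (inverse t)) \<longlongrightarrow> 0) (at_right (0::real))"
    using filterlim_compose[OF tendsto_power_div_exp_0 filterlim_inverse_at_top_right] by simp
  then have "(flat k \<longlongrightarrow> 0) (at_right 0)"
    by (rule Lim_transform_eventually)
       (auto simp: eventually_at_right_less flat_def exp_minus field_simps
         intro!: eventually_mono[OF eventually_at_right_less[of "0::real"]])
  moreover have "(flat k \<longlongrightarrow> 0) (at_left 0)"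
    by (rule Lim_transform_eventually[of "\<lambda>_. 0"])
       (auto simp: flat_def eventually_at_left_field intro!: exI[of _ "-1"])
  ultimately show ?thesis
    by (simp add: filterlim_split_at)
qed

lemma flat_has_derivative:
  "(flat k has_real_derivative (flat (k + 2) t - real k * flat (k + 1) t)) (at t)"
proof -
  consider "t < 0" | "t = 0" | "t > 0" by linarith
  then show ?thesis
  proof cases
    case 1
    have "((\<lambda>_. 0) has_real_derivative (flat (k + 2) t - real k * flat (k + 1) t)) (at t)"
      using 1 by (simp add: flat_def)
    then show ?thesis
      by (rule has_field_derivative_transform_within_open[of _ _ _ "{..<0}"])
         (use 1 in \<open>auto simp: flat_def\<close>)
  next
    case 2
    have "((\<lambda>h. flat (k + 1) h) \<longlongrightarrow> 0) (at 0)"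
      by (rule flat_tendsto_0)
    then have "((\<lambda>h. (flat k h - flat k 0) / (h - 0)) \<longlongrightarrow> 0) (at 0)"
      by (rule Lim_transform_eventually) (auto simp: flat_def field_simps intro!: always_eventually)
    then show ?thesis
      unfolding has_field_derivative_iff using 2 by (simp add: flat_def)
  next
    case 3
    have "((\<lambda>t. exp (- inverse t) * inverse t ^ k) has_real_derivative
        (flat (k + 2) t - real k * flat (k + 1) t)) (at t)"
    proof -
      have "((\<lambda>t. inverse t ^ k) has_real_derivative (- real k * inverse t ^ (k + 1))) (at t)"
      proof (rule DERIV_cong[OF DERIV_power[OF DERIV_inverse]])
        show "real k * (- (inverse t ^ Suc (Suc 0)) * inverse t ^ (k - Suc 0)) = - real k * inverse t ^ (k + 1)"
          by (cases k) (simp_all add: algebra_simps)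
      qed (use 3 in simp)
      moreover have "((\<lambda>t. exp (- inverse t)) has_real_derivative exp (- inverse t) * inverse t ^ 2) (at t)"
        using 3 by (auto intro!: derivative_eq_intros simp: power2_eq_square)
      ultimately show ?thesis
        using 3 by (rule_tac DERIV_cong[OF DERIV_mult]) (auto simp: flat_def algebra_simps power2_eq_square)
    qed
    then show ?thesis
      by (rule has_field_derivative_transform_within_open[of _ _ _ "{0<..}"])
         (use 3 in \<open>auto simp: flat_def\<close>)
  qed
qed

lemma real_polynomial_function_derivative:
  assumes "real_polynomial_function q"
  shows "\<exists>q'. (\<forall>e. real_polynomial_function (q' e)) \<and>
    (\<forall>x. (q has_derivative (\<lambda>e. q' e x)) (at x))"
  using assms
proof induction
  case (linear f)
  then show ?case
    by (intro exI[of _ "\<lambda>e x. f e"]) (auto intro: bounded_linear_imp_has_derivative)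
next
  case (const c)
  then show ?case by (intro exI[of _ "\<lambda>e x. 0"]) auto
next
  case (add f g)
  then obtain f' g' where "\<forall>e. real_polynomial_function (f' e)" "\<forall>e. real_polynomial_function (g' e)"
    "\<forall>x. (f has_derivative (\<lambda>e. f' e x)) (at x)" "\<forall>x. (g has_derivative (\<lambda>e. g' e x)) (at x)"
    by blast
  then show ?case
    by (intro exI[of _ "\<lambda>e x. f' e x + g' e x"]) (auto intro!: has_derivative_add)
next
  case (mult f g)
  then obtain f' g' where "\<forall>e. real_polynomial_function (f' e)" "\<forall>e. real_polynomial_function (g' e)"
    "\<forall>x. (f has_derivative (\<lambda>e. f' e x)) (at x)" "\<forall>x. (g has_derivative (\<lambda>e. g' e x)) (at x)"
    by blast
  with mult.hyps show ?case
    by (intro exI[of _ "\<lambda>e x. f x * g' e x + f' e x * g x"] conjI allI has_derivative_mult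
         real_polynomial_function.intros(3,4)) auto
qed

text \<open>Sums of terms \<open>q \<cdot> (flat k \<circ> g) \<cdot> c\<close> with a polynomial \<open>q\<close>.  A directional derivative of such a term is
  a sum of three terms of the same form.\<close>

inductive_set flat_span :: "('a::real_normed_vector \<Rightarrow> real) \<Rightarrow> ('a \<Rightarrow> 'b::real_normed_vector) set"
  for g :: "'a \<Rightarrow> real" where
  single: "real_polynomial_function q \<Longrightarrow> (\<lambda>z. (q z * flat k (g z)) *\<^sub>R c) \<in> flat_span g"
| sum: "f \<in> flat_span g \<Longrightarrow> h \<in> flat_span g \<Longrightarrow> (\<lambda>z. f z + h z) \<in> flat_span g"

lemma flat_span_derivative:
  assumes "real_polynomial_function g" "f \<in> flat_span g"
  shows "\<exists>f'. (\<forall>e. f' e \<in> flat_span g) \<and> (\<forall>x. (f has_derivative (\<lambda>e. f' e x)) (at x))"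
  using assms(2)
proof induction
  case (single q k c)
  obtain q' where q': "\<And>e. real_polynomial_function (q' e)"
      "\<And>x. (q has_derivative (\<lambda>e. q' e x)) (at x)"
    using real_polynomial_function_derivative[OF single] by blast
  obtain g' where g': "\<And>e. real_polynomial_function (g' e)"
      "\<And>x. (g has_derivative (\<lambda>e. g' e x)) (at x)"
    using real_polynomial_function_derivative[OF assms(1)] by blast
  define f' where "f' e x = (q' e x * flat k (g x)) *\<^sub>R c +
      (((q x * g' e x) * flat (k + 2) (g x)) *\<^sub>R c + ((- real k * q x * g' e x) * flat (k + 1) (g x)) *\<^sub>R c)" for e x
  have "f' e \<in> flat_span g" for e
    unfolding f'_def
    by (intro flat_span.intros real_polynomial_function.intros single q' g')
  moreover have "((\<lambda>z. (q z * flat k (g z)) *\<^sub>R c) has_derivative (\<lambda>e. f' e x)) (at x)" for x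
  proof -
    have "((\<lambda>z. flat k (g z)) has_derivative
        (\<lambda>e. g' e x * (flat (k + 2) (g x) - real k * flat (k + 1) (g x)))) (at x)"
      by (rule DERIV_compose_FDERIV[OF flat_has_derivative g'(2)])
    from has_derivative_scaleR_left[OF has_derivative_mult[OF q'(2) this], of c]
    show ?thesis
      unfolding f'_def by (rule has_derivative_eq_rhs) (simp add: algebra_simps fun_eq_iff flip: scaleR_add_left)
  qed
  ultimately show ?case by blast
next
  case (sum f h)
  then obtain f' h' where "\<forall>e. f' e \<in> flat_span g" "\<forall>e. h' e \<in> flat_span g"
    "\<forall>x. (f has_derivative (\<lambda>e. f' e x)) (at x)" "\<forall>x. (h has_derivative (\<lambda>e. h' e x)) (at x)"
    by blast
  then show ?case
    by (intro exI[of _ "\<lambda>e x. f' e x + h' e x"]) (auto intro!: has_derivative_add flat_span.sum)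
qed

text \<open>Any set of differentiable functions that contains the directional derivatives of its elements
  consists of smooth functions.\<close>

lemma smooth_on_flat_span:
  assumes "real_polynomial_function g" "f \<in> flat_span g"
  shows "smooth_on f S"
proof -
  have "C_k_on n f S" if "f \<in> flat_span g" for n and f :: "'a \<Rightarrow> 'b"
    using that
  proof (induction n arbitrary: f)
    case 0
    obtain f' where "\<And>x. (f has_derivative (\<lambda>e. f' e x)) (at x)"
      using flat_span_derivative[OF assms(1) 0] by blast
    then have "isCont f x" for x
      by (rule has_derivative_continuous)
    then show ?case
      by (simp add: continuous_at_imp_continuous_on)
  next
    case (Suc n)
    obtain f' where f': "\<And>e. f' e \<in> flat_span g" "\<And>x. (f has_derivative (\<lambda>e. f' e x)) (at x)"
      using flat_span_derivative[OF assms(1) Suc.prems] by blast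
    have "frechet_derivative f (at x) = (\<lambda>e. f' e x)" for x
      by (rule frechet_derivative_at[OF f'(2), symmetric])
    then have "C_k_on n (\<lambda>x. frechet_derivative f (at x) e) S" for e
      using Suc.IH[OF f'(1), of e] by simp
    moreover have "f differentiable at x" for x
      using f'(2) by (auto simp: differentiable_def)
    ultimately show ?case
      by simp
  qed
  with assms(2) show ?thesis by (simp add: smooth_on_def)
qed

subsection \<open>Operations on smooth functions\<close>

lemma C_k_on_cong:
  assumes "open S" "\<And>x. x \<in> S \<Longrightarrow> f x = g x" "C_k_on n f S"
  shows "C_k_on n g S"
  using assms(2,3)
proof (induction n arbitrary: f g)
  case 0
  then show ?case using continuous_on_cong by fastforce
next
  case (Suc n)
  have d: "f differentiable at x" if "x \<in> S" for x
    using Suc.prems that by simp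
  have "g differentiable at x" if "x \<in> S" for x
    using has_derivative_transform_within_open[OF d[OF that, unfolded frechet_derivative_works] assms(1) that]
      Suc.prems(1) by (auto simp: differentiable_def)
  moreover have "C_k_on n (\<lambda>x. frechet_derivative g (at x) e) S" for e
  proof (rule Suc.IH)
    show "frechet_derivative f (at x) e = frechet_derivative g (at x) e" if "x \<in> S" for x
      using frechet_derivative_transform_within_open[OF d[OF that] assms(1) that] Suc.prems(1) by simp
    show "C_k_on n (\<lambda>x. frechet_derivative f (at x) e) S"
      using Suc.prems by simp
  qed
  ultimately show ?case by simp
qed

lemma C_k_on_add:
  assumes "open S" "C_k_on n f S" "C_k_on n g S"
  shows "C_k_on n (\<lambda>x. f x + g x) S"
  using assms(2,3)
proof (induction n arbitrary: f g)
  case 0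
  then show ?case by (auto intro: continuous_on_add)
next
  case (Suc n)
  have d: "f differentiable at x" "g differentiable at x" if "x \<in> S" for x
    using Suc.prems that by auto
  have "C_k_on n (\<lambda>x. frechet_derivative (\<lambda>x. f x + g x) (at x) e) S" for e
  proof (rule C_k_on_cong[OF assms(1)])
    show "C_k_on n (\<lambda>x. frechet_derivative f (at x) e + frechet_derivative g (at x) e) S"
      using Suc by simp
    show "frechet_derivative f (at x) e + frechet_derivative g (at x) e =
        frechet_derivative (\<lambda>x. f x + g x) (at x) e" if "x \<in> S" for x
      using frechet_derivative_at[OF has_derivative_add[OF
        d(1)[OF that, unfolded frechet_derivative_works] d(2)[OF that, unfolded frechet_derivative_works]]]
      by metis
  qed
  with d show ?case by (auto intro: differentiable_add)
qed

text \<open>The factor \<open>c\<close> is general because every differentiation produces another factor \<open>l\<close>.\<close>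

lemma C_k_on_affine:
  fixes f :: "'a::real_normed_vector \<Rightarrow> 'b::real_normed_vector"
  assumes "open S" "C_k_on n f S"
  shows "C_k_on n (\<lambda>x. c *\<^sub>R f (l *\<^sub>R x + b)) ((\<lambda>x. l *\<^sub>R x + b) -` S)"
  using assms(2)
proof (induction n arbitrary: f c)
  case 0
  then show ?case
    by (auto intro!: continuous_intros continuous_on_compose2[of S f])
next
  case (Suc n)
  let ?T = "(\<lambda>x. l *\<^sub>R x + b) -` S"
  have T: "open ?T"
    by (intro open_vimage assms continuous_intros)
  have d: "((\<lambda>x. c *\<^sub>R f (l *\<^sub>R x + b)) has_derivative
      (\<lambda>e. (c * l) *\<^sub>R frechet_derivative f (at (l *\<^sub>R x + b)) e)) (at x)" if "x \<in> ?T" for x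
  proof -
    have f: "f differentiable at (l *\<^sub>R x + b)"
      using Suc.prems that by simp
    then have "linear (frechet_derivative f (at (l *\<^sub>R x + b)))"
      by (rule linear_frechet_derivative)
    moreover have "((\<lambda>x. f (l *\<^sub>R x + b)) has_derivative
        (\<lambda>e. frechet_derivative f (at (l *\<^sub>R x + b)) (l *\<^sub>R e))) (at x)"
      by (rule has_derivative_compose[where g = f])
         (auto intro!: derivative_eq_intros f[unfolded frechet_derivative_works])
    ultimately show ?thesis
      by (auto intro!: derivative_eq_intros simp: linear_scale)
  qed
  have "C_k_on n (\<lambda>x. frechet_derivative (\<lambda>x. c *\<^sub>R f (l *\<^sub>R x + b)) (at x) e) ?T" for e
  proof (rule C_k_on_cong[OF T])
    show "C_k_on n (\<lambda>x. (c * l) *\<^sub>R (\<lambda>y. frechet_derivative f (at y) e) (l *\<^sub>R x + b)) ?T"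
      by (rule Suc.IH) (use Suc.prems in simp)
    show "(c * l) *\<^sub>R frechet_derivative f (at (l *\<^sub>R x + b)) e =
       frechet_derivative (\<lambda>x. c *\<^sub>R f (l *\<^sub>R x + b)) (at x) e" if "x \<in> ?T" for x
      using frechet_derivative_at[OF d[OF that]] by metis
  qed
  moreover have "(\<lambda>x. c *\<^sub>R f (l *\<^sub>R x + b)) differentiable at x" if "x \<in> ?T" for x
    using d[OF that] by (auto simp: differentiable_def)
  ultimately show ?case by simp
qed

section \<open>The hyperbolic area\<close>

text \<open>The hyperbolic area on the Borel sets of the whole complex plane, which spares the restricted
  sigma-algebra of \<^const>\<open>hyp_measure\<close>.\<close>

definition hypvol :: "complex measure" where
  "hypvol = density lborel (\<lambda>z. indicator hyp_plane z * ennreal (1 / (Im z)\<^sup>2))"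

lemma sets_hypvol [measurable_cong, simp]: "sets hypvol = sets borel"
  by (simp add: hypvol_def)

lemma space_hypvol [simp]: "space hypvol = UNIV"
  by (simp add: hypvol_def)

lemma open_hyp_plane: "open hyp_plane"
  unfolding hyp_plane_def by (intro open_Collect_less continuous_intros)

lemma borel_hyp_plane [measurable, simp]: "hyp_plane \<in> sets borel"
  using open_hyp_plane by (rule borel_open)

lemma hyp_density_eq: "p \<in> hyp_plane \<Longrightarrow> hyp_density p = 1 / (Im p)\<^sup>2"
  by (simp add: hyp_density_def hyp_metric_def hyp_plane_def real_sqrt_divide real_sqrt_unique)

lemma sets_hyp_measure: "A \<in> sets hyp_measure \<longleftrightarrow> A \<in> sets borel \<and> A \<subseteq> hyp_plane"
  by (auto simp: hyp_measure_def sets_restrict_space_iff)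

lemma hyp_density_measurable: "(\<lambda>p. ennreal (hyp_density p)) \<in> borel_measurable (restrict_space lborel hyp_plane)"
proof -
  have m: "(\<lambda>p. ennreal (1 / (Im p)\<^sup>2)) \<in> borel_measurable (restrict_space lborel hyp_plane)"
    by (intro measurable_restrict_space1) measurable
  show ?thesis
    by (rule measurable_cong[THEN iffD1, OF _ m]) (simp add: hyp_density_eq space_restrict_space)
qed

lemma nn_integral_hyp_measure:
  assumes [measurable]: "f \<in> borel_measurable borel"
  shows "(\<integral>\<^sup>+p. f p \<partial>hyp_measure) = (\<integral>\<^sup>+p. f p \<partial>hypvol)"
proof -
  have "(\<integral>\<^sup>+p. f p \<partial>hyp_measure) =
      (\<integral>\<^sup>+p. ennreal (hyp_density p) * f p \<partial>restrict_space lborel hyp_plane)"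
    unfolding hyp_measure_def
    by (intro nn_integral_density hyp_density_measurable measurable_restrict_space1) simp
  also have "\<dots> = (\<integral>\<^sup>+p. ennreal (hyp_density p) * f p * indicator hyp_plane p \<partial>lborel)"
    by (rule nn_integral_restrict_space) simp
  also have "\<dots> = (\<integral>\<^sup>+p. indicator hyp_plane p * ennreal (1 / (Im p)\<^sup>2) * f p \<partial>lborel)"
    by (intro nn_integral_cong) (auto simp: hyp_density_eq indicator_def)
  also have "\<dots> = (\<integral>\<^sup>+p. f p \<partial>hypvol)"
    unfolding hypvol_def by (rule nn_integral_density[symmetric]) measurable
  finally show ?thesis .
qed

lemma emeasure_hyp_measure:
  assumes "A \<in> sets hyp_measure"
  shows "emeasure hyp_measure A = emeasure hypvol A"
proof -
  have A: "A \<in> sets borel"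
    using assms by (simp add: sets_hyp_measure)
  then show ?thesis
    using nn_integral_hyp_measure[of "indicator A"] assms by (simp add: borel_measurable_indicator)
qed

lemma integral_hyp_measure:
  fixes f :: "complex \<Rightarrow> real"
  assumes [measurable]: "f \<in> borel_measurable borel"
  shows "(\<integral>p. f p \<partial>hyp_measure) = (\<integral>p. f p \<partial>hypvol)"
proof -
  have "distr hyp_measure borel (\<lambda>p. p) = hypvol"
  proof (rule measure_eqI)
    fix A assume "A \<in> sets (distr hyp_measure borel (\<lambda>p. p))"
    then have A: "A \<in> sets borel" by simp
    have m: "(\<lambda>p. p) \<in> measurable hyp_measure borel"
      by (auto simp: hyp_measure_def intro: measurable_restrict_space1)
    have "emeasure (distr hyp_measure borel (\<lambda>p. p)) A = (\<integral>\<^sup>+p. indicator A p \<partial>distr hyp_measure borel (\<lambda>p. p))"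
      using A by simp
    also have "\<dots> = (\<integral>\<^sup>+p. indicator A p \<partial>hypvol)"
      using A m nn_integral_hyp_measure[of "indicator A"]
      by (subst nn_integral_distr) (auto simp: borel_measurable_indicator simp del: nn_integral_indicator)
    finally show "emeasure (distr hyp_measure borel (\<lambda>p. p)) A = emeasure hypvol A"
      using A by simp
  qed simp
  moreover have "(\<integral>p. f p \<partial>distr hyp_measure borel (\<lambda>p. p)) = (\<integral>p. f p \<partial>hyp_measure)"
    by (rule integral_distr) (auto simp: hyp_measure_def intro: measurable_restrict_space1)
  ultimately show ?thesis by simp
qed

lemma lborel_complex: "(lborel :: complex measure) = distr (lborel \<Otimes>\<^sub>M lborel) borel (\<lambda>(x, y). Complex x y)"
proof (rule lborel_eqI)
  fix l u :: complex
  assume le: "\<And>b. b \<in> Basis \<Longrightarrow> l \<bullet> b \<le> u \<bullet> b"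
  have [measurable]: "(\<lambda>(x, y). Complex x y) \<in> borel \<Otimes>\<^sub>M borel \<rightarrow>\<^sub>M borel"
    unfolding Complex_eq by measurable
  have "emeasure (distr (lborel \<Otimes>\<^sub>M lborel) borel (\<lambda>(x, y). Complex x y)) (box l u) =
      emeasure (lborel \<Otimes>\<^sub>M lborel) ({Re l<..<Re u} \<times> {Im l<..<Im u})"
    by (subst emeasure_distr)
       (auto intro!: arg_cong2[where f = emeasure] simp: space_pair_measure in_box_complex_iff)
  also have "\<dots> = ennreal (Re u - Re l) * ennreal (Im u - Im l)"
    using le[of 1] le[of \<i>] by (simp add: lborel.emeasure_pair_measure_Times Basis_complex_def)
  also have "\<dots> = ennreal (\<Prod>b\<in>Basis. (u - l) \<bullet> b)"
    using le[of 1] le[of \<i>] by (simp add: Basis_complex_def ennreal_mult)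
  finally show "emeasure (distr (lborel \<Otimes>\<^sub>M lborel) borel (\<lambda>(x, y). Complex x y)) (box l u) =
      ennreal (\<Prod>b\<in>Basis. (u - l) \<bullet> b)" .
qed simp

lemma measurable_Complex [measurable]:
  assumes "f \<in> borel_measurable M" "g \<in> borel_measurable M"
  shows "(\<lambda>x. Complex (f x) (g x)) \<in> borel_measurable M"
  using assms unfolding Complex_eq by measurable

lemma nn_integral_lborel_complex:
  assumes [measurable]: "f \<in> borel_measurable borel"
  shows "(\<integral>\<^sup>+z. f z \<partial>lborel) = (\<integral>\<^sup>+y. (\<integral>\<^sup>+x. f (Complex x y) \<partial>lborel) \<partial>lborel)"
proof -
  have "(\<integral>\<^sup>+z. f z \<partial>lborel) = (\<integral>\<^sup>+p. f (case p of (x, y) \<Rightarrow> Complex x y) \<partial>(lborel \<Otimes>\<^sub>M lborel))"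
    by (subst lborel_complex, subst nn_integral_distr) (auto simp: measurable_split_conv)
  also have "\<dots> = (\<integral>\<^sup>+p. (\<lambda>(x, y). f (Complex x y)) p \<partial>(lborel \<Otimes>\<^sub>M lborel))"
    by (intro nn_integral_cong) auto
  also have "\<dots> = (\<integral>\<^sup>+y. (\<integral>\<^sup>+x. f (Complex x y) \<partial>lborel) \<partial>lborel)"
    by (subst lborel_pair.nn_integral_snd[symmetric]) auto
  finally show ?thesis .
qed

lemma nn_integral_hypvol:
  assumes [measurable]: "f \<in> borel_measurable borel"
  shows "(\<integral>\<^sup>+z. f z \<partial>hypvol) =
    (\<integral>\<^sup>+y. indicator {0<..} y * ennreal (1 / y\<^sup>2) * (\<integral>\<^sup>+x. f (Complex x y) \<partial>lborel) \<partial>lborel)"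
proof -
  have "(\<integral>\<^sup>+z. f z \<partial>hypvol) = (\<integral>\<^sup>+z. indicator hyp_plane z * ennreal (1 / (Im z)\<^sup>2) * f z \<partial>lborel)"
    unfolding hypvol_def by (rule nn_integral_density) measurable
  also have "\<dots> = (\<integral>\<^sup>+y. (\<integral>\<^sup>+x. indicator {0<..} y * ennreal (1 / y\<^sup>2) * f (Complex x y) \<partial>lborel) \<partial>lborel)"
    by (subst nn_integral_lborel_complex) (auto simp: hyp_plane_def indicator_def intro!: nn_integral_cong)
  also have "\<dots> = (\<integral>\<^sup>+y. indicator {0<..} y * ennreal (1 / y\<^sup>2) * (\<integral>\<^sup>+x. f (Complex x y) \<partial>lborel) \<partial>lborel)"
    by (intro nn_integral_cong nn_integral_cmult) measurable
  finally show ?thesis .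
qed

text \<open>This form covers the isometries \<open>z \<mapsto> lz + b\<close>, the shears \<open>z \<mapsto> z + s Im z\<close> and the vertical dilations.\<close>

definition plane_map :: "real \<Rightarrow> real \<Rightarrow> real \<Rightarrow> real \<Rightarrow> complex \<Rightarrow> complex" where
  "plane_map a s b c z = Complex (a * Re z + s * Im z + b) (c * Im z)"

lemma plane_map_sel [simp]:
  "Re (plane_map a s b c z) = a * Re z + s * Im z + b" "Im (plane_map a s b c z) = c * Im z"
  by (simp_all add: plane_map_def)

lemma continuous_on_plane_map [continuous_intros]: "continuous_on S (plane_map a s b c)"
  unfolding plane_map_def Complex_eq by (intro continuous_intros)

lemma measurable_plane_map [measurable]: "plane_map a s b c \<in> borel_measurable borel"
  by (intro borel_measurable_continuous_onI continuous_intros)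

text \<open>Substitution first in \<open>x\<close> and then in \<open>y\<close>: the Jacobian contributes \<open>1 / (a c)\<close> and the density \<open>c\<^sup>2\<close>.\<close>

lemma nn_integral_hypvol_plane_map:
  assumes [measurable]: "f \<in> borel_measurable borel" and "a > 0" "c > 0"
  shows "(\<integral>\<^sup>+z. f (plane_map a s b c z) \<partial>hypvol) = ennreal (c / a) * (\<integral>\<^sup>+z. f z \<partial>hypvol)"
proof -
  define F where "F y = (\<integral>\<^sup>+x. f (Complex x y) \<partial>lborel)" for y
  have [measurable]: "F \<in> borel_measurable borel"
    unfolding F_def by measurable
  have inner: "(\<integral>\<^sup>+x. f (plane_map a s b c (Complex x y)) \<partial>lborel) = ennreal (1 / a) * F (c * y)" for y
  proof -
    have FF: "F (c * y) = ennreal a * (\<integral>\<^sup>+x. f (Complex (s * y + b + a * x) (c * y)) \<partial>lborel)"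
      unfolding F_def using assms(2)
      by (subst nn_integral_real_affine[where c = a and t = "s * y + b"]) auto
    then have "ennreal (1 / a) * F (c * y) = (\<integral>\<^sup>+x. f (Complex (s * y + b + a * x) (c * y)) \<partial>lborel)"
    proof -
      have "ennreal (1 / a) * ennreal a = 1"
        using assms(2) by (subst ennreal_mult[symmetric]) auto
      then show ?thesis
        unfolding FF by (simp add: mult.assoc[symmetric])
    qed
    then show ?thesis
      by (simp add: plane_map_def algebra_simps)
  qed
  have "(\<integral>\<^sup>+z. f z \<partial>hypvol) = (\<integral>\<^sup>+y. indicator {0<..} y * ennreal (1 / y\<^sup>2) * F y \<partial>lborel)"
    by (simp add: nn_integral_hypvol F_def)
  also have "\<dots> = ennreal c * (\<integral>\<^sup>+y. indicator {0<..} (c * y) * ennreal (1 / (c * y)\<^sup>2) * F (c * y) \<partial>lborel)"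
    using assms(3) by (subst nn_integral_real_affine[where c = c and t = 0]) auto
  also have "ennreal (c / a) * \<dots> = ennreal (c\<^sup>2 / a) * (\<integral>\<^sup>+y. indicator {0<..} (c * y) * ennreal (1 / (c * y)\<^sup>2) * F (c * y) \<partial>lborel)"
  proof -
    have "ennreal (c\<^sup>2 / a) = ennreal (c / a) * ennreal c"
      using assms by (subst ennreal_mult[symmetric]) (auto simp: power2_eq_square)
    then show ?thesis by (simp add: mult.assoc)
  qed
  also have "\<dots> = (\<integral>\<^sup>+y. ennreal (c\<^sup>2 / a) * (indicator {0<..} (c * y) * ennreal (1 / (c * y)\<^sup>2) * F (c * y)) \<partial>lborel)"
    by (rule nn_integral_cmult[symmetric]) measurable
  also have "\<dots> = (\<integral>\<^sup>+y. indicator {0<..} y * ennreal (1 / y\<^sup>2) * (ennreal (1 / a) * F (c * y)) \<partial>lborel)"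
  proof (intro nn_integral_cong)
    fix y :: real
    have "ennreal (c\<^sup>2 / a) * ennreal (1 / (c * y)\<^sup>2) = ennreal (1 / y\<^sup>2) * ennreal (1 / a)"
      using assms by (subst (1 2) ennreal_mult[symmetric]) (auto simp: power_mult_distrib)
    moreover have "indicator {0<..} (c * y) = (indicator {0<..} y :: ennreal)"
      using assms by (simp add: indicator_def zero_less_mult_iff)
    moreover have "ennreal (c\<^sup>2 / a) * (indicator {0<..} (c * y) * ennreal (1 / (c * y)\<^sup>2) * F (c * y)) =
        indicator {0<..} (c * y) * (ennreal (c\<^sup>2 / a) * ennreal (1 / (c * y)\<^sup>2)) * F (c * y)"
      by (simp only: mult_ac)
    ultimately show "ennreal (c\<^sup>2 / a) * (indicator {0<..} (c * y) * ennreal (1 / (c * y)\<^sup>2) * F (c * y)) =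
        indicator {0<..} y * ennreal (1 / y\<^sup>2) * (ennreal (1 / a) * F (c * y))"
      by (simp only: mult_ac)
  qed
  also have "\<dots> = (\<integral>\<^sup>+z. f (plane_map a s b c z) \<partial>hypvol)"
    by (subst nn_integral_hypvol) (simp_all add: inner)
  finally show ?thesis by simp
qed

lemma distr_hypvol_plane_map:
  assumes "a > 0" "c > 0"
  shows "distr hypvol borel (plane_map a s b c) = density hypvol (\<lambda>_. ennreal (c / a))"
proof (rule measure_eqI)
  fix A assume "A \<in> sets (distr hypvol borel (plane_map a s b c))"
  then have [measurable]: "A \<in> sets borel" by simp
  have "emeasure (distr hypvol borel (plane_map a s b c)) A =
      (\<integral>\<^sup>+z. indicator A z \<partial>distr hypvol borel (plane_map a s b c))"
    by simp
  also have "\<dots> = ennreal (c / a) * (\<integral>\<^sup>+z. indicator A z \<partial>hypvol)"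
    by (subst nn_integral_distr) (simp_all add: nn_integral_hypvol_plane_map assms)
  also have "\<dots> = emeasure (density hypvol (\<lambda>_. ennreal (c / a))) A"
    by (simp add: emeasure_density nn_integral_cmult)
  finally show "emeasure (distr hypvol borel (plane_map a s b c)) A =
    emeasure (density hypvol (\<lambda>_. ennreal (c / a))) A" .
qed simp

lemma integral_hypvol_plane_map:
  fixes f :: "complex \<Rightarrow> real"
  assumes [measurable]: "f \<in> borel_measurable borel" and "a > 0" "c > 0"
  shows "(\<integral>z. f (plane_map a s b c z) \<partial>hypvol) = (c / a) * (\<integral>z. f z \<partial>hypvol)"
proof -
  have "(\<integral>z. f (plane_map a s b c z) \<partial>hypvol) = (\<integral>z. f z \<partial>density hypvol (\<lambda>_. ennreal (c / a)))"
    by (subst distr_hypvol_plane_map[symmetric]) (simp_all add: assms integral_distr)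
  also have "\<dots> = (c / a) * (\<integral>z. f z \<partial>hypvol)"
    using assms by (subst integral_density) auto
  finally show ?thesis .
qed

section \<open>Vector fields and perimeter\<close>

lemma test_fieldsI:
  assumes "smooth_on v hyp_plane" "compact K" "K \<subseteq> hyp_plane"
    and "\<And>p. p \<in> hyp_plane \<Longrightarrow> v p \<noteq> 0 \<Longrightarrow> p \<in> K"
  shows "v \<in> test_fields"
proof -
  have "closure {p \<in> hyp_plane. v p \<noteq> 0} \<subseteq> K"
    using assms by (intro closure_minimal compact_imp_closed) auto
  then show ?thesis
    using assms unfolding test_fields_def
    by (auto intro: compact_closure[THEN iffD2] bounded_subset[OF compact_imp_bounded[of K]] closure_subset[THEN subsetD])
qed

lemma test_field_support:
  assumes "v \<in> test_fields"
  obtains K where "compact K" "K \<subseteq> hyp_plane" "\<And>p. p \<in> hyp_plane \<Longrightarrow> v p \<noteq> 0 \<Longrightarrow> p \<in> K"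
  using assms closure_subset[of "{p \<in> hyp_plane. v p \<noteq> 0}"] unfolding test_fields_def by blast

lemma test_field_has_derivative:
  assumes "v \<in> test_fields" "p \<in> hyp_plane"
  shows "(v has_derivative frechet_derivative v (at p)) (at p)"
proof -
  have "C_k_on 1 v hyp_plane"
    using assms by (auto simp: test_fields_def smooth_on_def)
  then show ?thesis
    using assms(2) by (simp flip: frechet_derivative_works)
qed

text \<open>The last term comes from differentiating the density \<open>1 / y\<^sup>2\<close>.\<close>

lemma hyp_div_eq:
  assumes v: "(v has_derivative v') (at p)" and p: "p \<in> hyp_plane"
  shows "hyp_div v p = Re (v' 1) + Im (v' \<i>) - 2 * Im (v p) / Im p"
proof -
  have y: "Im p > 0" using p by (simp add: hyp_plane_def)
  have fd: "frechet_derivative (\<lambda>q. hyp_density q * (v q \<bullet> b)) (at p) e =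
      (v' e \<bullet> b) / (Im p)\<^sup>2 - 2 * Im e * (v p \<bullet> b) / (Im p)^3" for b e
  proof -
    have "((\<lambda>t. 1 / t\<^sup>2) has_real_derivative - 2 / (Im p)^3) (at (Im p))"
    proof -
      have "(\<lambda>t. 1 / t\<^sup>2) = (\<lambda>t::real. inverse t ^ 2)"
        by (simp add: fun_eq_iff inverse_eq_divide power_one_over)
      moreover have "((\<lambda>t. inverse t ^ 2) has_real_derivative - 2 / (Im p)^3) (at (Im p))"
        by (rule DERIV_cong[OF DERIV_power[OF DERIV_inverse]])
           (use y in \<open>simp_all add: inverse_eq_divide power2_eq_square power3_eq_cube\<close>)
      ultimately show ?thesis by simp
    qed
    then have "((\<lambda>q. 1 / (Im q)\<^sup>2) has_derivative (\<lambda>e. Im e * (- 2 / (Im p)^3))) (at p)"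
      by (rule DERIV_compose_FDERIV) (rule bounded_linear_imp_has_derivative[OF bounded_linear_Im])
    from has_derivative_mult[OF this has_derivative_inner_left[OF v, of b]]
    have "((\<lambda>q. (1 / (Im q)\<^sup>2) * (v q \<bullet> b)) has_derivative
        (\<lambda>e. (v' e \<bullet> b) / (Im p)\<^sup>2 - 2 * Im e * (v p \<bullet> b) / (Im p)^3)) (at p)"
      by (rule has_derivative_eq_rhs) (simp add: fun_eq_iff)
    then have "((\<lambda>q. hyp_density q * (v q \<bullet> b)) has_derivative
        (\<lambda>e. (v' e \<bullet> b) / (Im p)\<^sup>2 - 2 * Im e * (v p \<bullet> b) / (Im p)^3)) (at p)"
      by (rule has_derivative_transform_within_open[OF _ open_hyp_plane p]) (simp add: hyp_density_eq)
    from fun_cong[OF frechet_derivative_at[OF this], of e] show ?thesis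
      by (rule sym)
  qed
  then show ?thesis
    using y unfolding hyp_div_def hyp_density_eq[OF p] fd
    by (simp add: Basis_complex_def inner_complex_def field_simps power2_eq_square power3_eq_cube)
qed

lemma test_field_hyp_div:
  assumes "v \<in> test_fields" "p \<in> hyp_plane"
  shows "hyp_div v p = Re (frechet_derivative v (at p) 1) + Im (frechet_derivative v (at p) \<i>) - 2 * Im (v p) / Im p"
  by (rule hyp_div_eq[OF test_field_has_derivative[OF assms] assms(2)])

lemma hyp_div_zero:
  assumes "open U" "U \<subseteq> hyp_plane" "p \<in> U" "\<And>q. q \<in> U \<Longrightarrow> v q = 0"
  shows "hyp_div v p = 0"
proof -
  have "(v has_derivative (\<lambda>_. 0)) (at p)"
    by (rule has_derivative_transform_within_open[of "\<lambda>_. 0" _ _ UNIV U]) (use assms in auto)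
  from hyp_div_eq[OF this] assms show ?thesis by auto
qed

lemma continuous_on_hyp_div:
  assumes "v \<in> test_fields"
  shows "continuous_on hyp_plane (hyp_div v)"
proof -
  have "C_k_on 1 v hyp_plane"
    using assms by (auto simp: test_fields_def smooth_on_def)
  then have c: "continuous_on hyp_plane (\<lambda>p. frechet_derivative v (at p) e)" for e
    by simp
  have "C_k_on 0 v hyp_plane"
    using assms by (auto simp: test_fields_def smooth_on_def)
  then have "continuous_on hyp_plane (\<lambda>p. Re (frechet_derivative v (at p) 1) + Im (frechet_derivative v (at p) \<i>) - 2 * Im (v p) / Im p)"
    by (intro continuous_intros c) (auto simp: hyp_plane_def)
  then show ?thesis
    by (rule continuous_on_eq) (simp add: test_field_hyp_div[OF assms])
qed

lemma hyp_div_bounded_support: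
  assumes "v \<in> test_fields"
  obtains K M where "compact K" "K \<subseteq> hyp_plane" "\<And>p. p \<in> hyp_plane \<Longrightarrow> v p \<noteq> 0 \<Longrightarrow> p \<in> K" "M \<ge> 0"
    "\<And>p. p \<in> hyp_plane \<Longrightarrow> \<bar>hyp_div v p\<bar> \<le> M * indicator K p"
proof -
  obtain K where K: "compact K" "K \<subseteq> hyp_plane" "\<And>p. p \<in> hyp_plane \<Longrightarrow> v p \<noteq> 0 \<Longrightarrow> p \<in> K"
    using test_field_support[OF assms] by blast
  have "compact (hyp_div v ` K)"
    using K continuous_on_hyp_div[OF assms] by (intro compact_continuous_image) (auto elim: continuous_on_subset)
  then obtain M where M: "\<And>p. p \<in> K \<Longrightarrow> \<bar>hyp_div v p\<bar> \<le> M"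
    using compact_imp_bounded[of "hyp_div v ` K"] unfolding bounded_iff by auto
  have z: "hyp_div v p = 0" if "p \<in> hyp_plane - K" for p
    using that K by (intro hyp_div_zero[of "hyp_plane - K"]) (auto intro: open_Diff open_hyp_plane compact_imp_closed)
  show ?thesis
  proof (rule that[OF K, of "max M 0"])
    show "\<bar>hyp_div v p\<bar> \<le> max M 0 * indicator K p" if "p \<in> hyp_plane" for p
      using M[of p] z[of p] that by (auto simp: indicator_def)
  qed auto
qed

lemma emeasure_hypvol_le:
  assumes "A \<in> sets borel" "c > 0" "\<And>p. p \<in> A \<Longrightarrow> c \<le> Im p"
  shows "emeasure hypvol A \<le> ennreal (1 / c\<^sup>2) * emeasure lborel A"
proof -
  have "emeasure hypvol A = (\<integral>\<^sup>+z. indicator hyp_plane z * ennreal (1 / (Im z)\<^sup>2) * indicator A z \<partial>lborel)"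
    unfolding hypvol_def using assms by (subst emeasure_density) auto
  also have "\<dots> \<le> (\<integral>\<^sup>+z. ennreal (1 / c\<^sup>2) * indicator A z \<partial>lborel)"
  proof (rule nn_integral_mono)
    fix z
    show "indicator hyp_plane z * ennreal (1 / (Im z)\<^sup>2) * indicator A z \<le> ennreal (1 / c\<^sup>2) * indicator A z"
      using assms(2) assms(3)[of z]
      by (auto simp: indicator_def intro!: ennreal_leI divide_left_mono power_mono mult_pos_pos)
  qed
  also have "\<dots> = ennreal (1 / c\<^sup>2) * emeasure lborel A"
    using assms by (subst nn_integral_cmult_indicator) auto
  finally show ?thesis .
qed

lemma emeasure_hypvol_compact:
  assumes "compact K" "K \<subseteq> hyp_plane"
  shows "emeasure hypvol K < \<infinity>"
proof (cases "K = {}")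
  case False
  obtain p where p: "p \<in> K" "\<And>q. q \<in> K \<Longrightarrow> Im p \<le> Im q"
    using continuous_attains_inf[OF assms(1) False continuous_on_Im[OF continuous_on_id]] by auto
  have "emeasure hypvol K \<le> ennreal (1 / (Im p)\<^sup>2) * emeasure lborel K"
    using p assms by (intro emeasure_hypvol_le) (auto intro: borel_compact simp: hyp_plane_def)
  also have "\<dots> < \<infinity>"
    using emeasure_compact_finite[OF assms(1)] by (simp add: ennreal_mult_less_top)
  finally show ?thesis .
qed simp

text \<open>By \<open>perimeter_eq\<close> below, the perimeter is the supremum of this pairing over the unit fields.\<close>

definition flux :: "complex set \<Rightarrow> (complex \<Rightarrow> complex) \<Rightarrow> real" where
  "flux E v = (\<integral>p. indicator E p * hyp_div v p \<partial>hypvol)"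

definition unit_fields :: "(complex \<Rightarrow> complex) set" where
  "unit_fields = {v \<in> test_fields. \<forall>p\<in>hyp_plane. norm (v p) \<le> Im p}"

lemma unit_fields_eq: "{v \<in> test_fields. hyp_supnorm v \<le> 1} = unit_fields"
proof -
  have "hyp_norm p u = norm u / Im p" if "p \<in> hyp_plane" for p u
    using that by (simp add: hyp_norm_def hyp_metric_def hyp_plane_def real_sqrt_divide norm_eq_sqrt_inner)
  then have "hyp_supnorm v \<le> 1 \<longleftrightarrow> (\<forall>p\<in>hyp_plane. norm (v p) \<le> Im p)" for v
    unfolding hyp_supnorm_def SUP_le_iff by (auto simp: hyp_plane_def)
  then show ?thesis by (auto simp: unit_fields_def)
qed

lemma measurable_hyp_div:
  assumes "v \<in> test_fields" "E \<in> sets hyp_measure"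
  shows "(\<lambda>p. indicator E p * hyp_div v p) \<in> borel_measurable borel"
proof -
  have [measurable]: "E \<in> sets borel" and E: "E \<subseteq> hyp_plane"
    using assms by (auto simp: sets_hyp_measure)
  have [measurable]: "(\<lambda>p. indicator hyp_plane p *\<^sub>R hyp_div v p) \<in> borel_measurable borel"
    by (intro borel_measurable_continuous_on_indicator continuous_on_hyp_div assms) simp
  have "(\<lambda>p. indicator E p * hyp_div v p) = (\<lambda>p. indicator E p * (indicator hyp_plane p *\<^sub>R hyp_div v p))"
    using E by (intro ext) (auto simp: indicator_def)
  then show ?thesis
    by (simp only:) measurable
qed

lemma integrable_hyp_div:
  assumes "v \<in> test_fields" "E \<in> sets hyp_measure"
  shows "integrable hypvol (\<lambda>p. indicator E p * hyp_div v p)"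
proof -
  obtain K M where K: "compact K" "K \<subseteq> hyp_plane" "\<And>p. p \<in> hyp_plane \<Longrightarrow> \<bar>hyp_div v p\<bar> \<le> M * indicator K p"
    using hyp_div_bounded_support[OF assms(1)] by metis
  have "E \<subseteq> hyp_plane"
    using assms by (simp add: sets_hyp_measure)
  have "integrable hypvol (\<lambda>p. M * indicator K p)"
    using emeasure_hypvol_compact[OF K(1,2)] K(1)
    by (intro integrable_mult_right integrable_real_indicator) (auto intro: borel_compact)
  then show ?thesis
  proof (rule Bochner_Integration.integrable_bound)
    show "(\<lambda>p. indicator E p * hyp_div v p) \<in> borel_measurable hypvol"
      using measurable_hyp_div[OF assms] by simp
    show "AE p in hypvol. norm (indicator E p * hyp_div v p) \<le> norm (M * indicator K p)"
      using K(3) \<open>E \<subseteq> hyp_plane\<close> by (intro AE_I2) (fastforce simp: indicator_def)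
  qed
qed

lemma perimeter_eq:
  assumes "E \<in> sets hyp_measure"
  shows "perimeter E = (SUP v\<in>unit_fields. ennreal (flux E v))"
  unfolding perimeter_def unit_fields_eq flux_def
  using assms by (intro SUP_cong arg_cong[where f = ennreal] integral_hyp_measure measurable_hyp_div refl) (auto simp: unit_fields_def)

lemma flux_le_perimeter:
  "E \<in> sets hyp_measure \<Longrightarrow> v \<in> unit_fields \<Longrightarrow> ennreal (flux E v) \<le> perimeter E"
  by (subst perimeter_eq) (auto intro: SUP_upper)

lemma flux_le:
  assumes "E \<in> sets hyp_measure" "v \<in> unit_fields" "perimeter E \<le> ennreal C" "0 \<le> C"
  shows "flux E v \<le> C"
  using order_trans[OF flux_le_perimeter[OF assms(1,2)] assms(3)] assms(4)
  by (cases "flux E v \<ge> 0") auto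

subsection \<open>Operations on vector fields\<close>

lemma test_fields_add:
  assumes "v \<in> test_fields" "w \<in> test_fields"
  shows "(\<lambda>p. v p + w p) \<in> test_fields"
proof -
  obtain K L where "compact K" "K \<subseteq> hyp_plane" "\<And>p. p \<in> hyp_plane \<Longrightarrow> v p \<noteq> 0 \<Longrightarrow> p \<in> K"
    "compact L" "L \<subseteq> hyp_plane" "\<And>p. p \<in> hyp_plane \<Longrightarrow> w p \<noteq> 0 \<Longrightarrow> p \<in> L"
    using test_field_support assms by metis
  moreover have "smooth_on (\<lambda>p. v p + w p) hyp_plane"
    using assms by (simp add: test_fields_def smooth_on_def C_k_on_add[OF open_hyp_plane])
  ultimately show ?thesis
    by (intro test_fieldsI[of _ "K \<union> L"]) (auto intro: compact_Un, metis add.right_neutral)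
qed

lemma hyp_div_add:
  assumes "v \<in> test_fields" "w \<in> test_fields" "p \<in> hyp_plane"
  shows "hyp_div (\<lambda>p. v p + w p) p = hyp_div v p + hyp_div w p"
  using hyp_div_eq[OF has_derivative_add[OF test_field_has_derivative[OF assms(1,3)] test_field_has_derivative[OF assms(2,3)]] assms(3)]
  by (simp add: test_field_hyp_div assms add_divide_distrib distrib_left)

lemma flux_add:
  assumes "v \<in> test_fields" "w \<in> test_fields" "E \<in> sets hyp_measure"
  shows "flux E (\<lambda>p. v p + w p) = flux E v + flux E w"
proof -
  have "flux E (\<lambda>p. v p + w p) = (\<integral>p. indicator E p * hyp_div v p + indicator E p * hyp_div w p \<partial>hypvol)"
    unfolding flux_def using assms(3)
    by (intro Bochner_Integration.integral_cong) (auto simp: hyp_div_add assms sets_hyp_measure indicator_def subset_iff)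
  also have "\<dots> = flux E v + flux E w"
    unfolding flux_def by (intro Bochner_Integration.integral_add integrable_hyp_div assms)
  finally show ?thesis .
qed

lemma zero_test_field: "(\<lambda>_. 0) \<in> test_fields"
proof -
  have "C_k_on n (\<lambda>_. 0::complex) hyp_plane" for n
    by (induction n) auto
  then show ?thesis
    by (intro test_fieldsI[of _ "{}"]) (auto simp: smooth_on_def)
qed

lemma flux_zero: "E \<in> sets hyp_measure \<Longrightarrow> flux E (\<lambda>_. 0) = 0"
  using hyp_div_zero[OF open_hyp_plane subset_refl, of _ "\<lambda>_. 0"] unfolding flux_def
  by (intro integral_eq_zero_AE AE_I2) (auto simp: sets_hyp_measure indicator_def)

lemma sum_flux:
  assumes "finite R" "\<And>r. r \<in> R \<Longrightarrow> v r \<in> test_fields" "E \<in> sets hyp_measure"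
  shows "(\<lambda>p. \<Sum>r\<in>R. v r p) \<in> test_fields \<and> flux E (\<lambda>p. \<Sum>r\<in>R. v r p) = (\<Sum>r\<in>R. flux E (v r))"
  using assms(1,2)
proof (induction R)
  case empty
  then show ?case by (simp add: zero_test_field flux_zero assms)
next
  case (insert r R)
  then show ?case by (simp add: test_fields_add flux_add assms)
qed

text \<open>The sum of unit fields with disjoint supports is again a unit field.  Lower semicontinuity of the
  perimeter for limits seen in several distant places comes from here.\<close>

lemma sum_flux_le_perimeter:
  assumes "finite R" "\<And>r. r \<in> R \<Longrightarrow> v r \<in> unit_fields" "E \<in> sets hyp_measure"
    and "\<And>r p. r \<in> R \<Longrightarrow> p \<in> hyp_plane \<Longrightarrow> v r p \<noteq> 0 \<Longrightarrow> p \<in> K r" "disjoint_family_on K R"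
  shows "ennreal (\<Sum>r\<in>R. flux E (v r)) \<le> perimeter E"
proof -
  have t: "(\<lambda>p. \<Sum>r\<in>R. v r p) \<in> test_fields" "flux E (\<lambda>p. \<Sum>r\<in>R. v r p) = (\<Sum>r\<in>R. flux E (v r))"
    using sum_flux[of R v E] assms by (auto simp: unit_fields_def)
  have "norm (\<Sum>r\<in>R. v r p) \<le> Im p" if p: "p \<in> hyp_plane" for p
  proof (cases "\<exists>r\<in>R. v r p \<noteq> 0")
    case True
    then obtain r where r: "r \<in> R" "v r p \<noteq> 0" by blast
    have "v s p = 0" if "s \<in> R - {r}" for s
      using assms(4)[OF r(1) p r(2)] assms(4)[of s p] assms(5) that r(1) p
      by (auto simp: disjoint_family_on_def)
    then have "(\<Sum>r\<in>R. v r p) = v r p"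
      using assms(1) r(1) by (simp add: sum.remove[of R r])
    then show ?thesis
      using assms(2)[OF r(1)] p by (simp add: unit_fields_def)
  next
    case False
    then show ?thesis using p by (simp add: hyp_plane_def)
  qed
  then have "(\<lambda>p. \<Sum>r\<in>R. v r p) \<in> unit_fields"
    using t by (simp add: unit_fields_def)
  from flux_le_perimeter[OF assms(3) this] t show ?thesis by simp
qed

subsection \<open>Isometries\<close>

abbreviation hiso :: "real \<Rightarrow> real \<Rightarrow> complex \<Rightarrow> complex" where
  "hiso l b \<equiv> plane_map l 0 b l"

lemma hiso_eq: "hiso l b z = l *\<^sub>R z + of_real b"
  by (simp add: complex_eq_iff)

lemma hiso_inverse: "l > 0 \<Longrightarrow> hiso l b (hiso (1 / l) (- b / l) z) = z" "l > 0 \<Longrightarrow> hiso (1 / l) (- b / l) (hiso l b z) = z"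
  by (auto simp: complex_eq_iff field_simps)

lemma hiso_hyp_plane: "l > 0 \<Longrightarrow> hiso l b z \<in> hyp_plane \<longleftrightarrow> z \<in> hyp_plane"
  by (simp add: hyp_plane_def zero_less_mult_iff)

lemma hiso_vimage_sets:
  assumes "E \<in> sets hyp_measure" "l > 0"
  shows "hiso l b -` E \<in> sets hyp_measure"
proof -
  have "hiso l b -` E \<in> sets borel"
    using measurable_sets[OF measurable_plane_map, of E l 0 b l] assms by (simp add: sets_hyp_measure)
  then show ?thesis
    using assms hiso_hyp_plane by (auto simp: sets_hyp_measure)
qed

text \<open>The push-forward of a vector field by the isometry \<^term>\<open>hiso l b\<close>.\<close>

definition push :: "real \<Rightarrow> real \<Rightarrow> (complex \<Rightarrow> complex) \<Rightarrow> complex \<Rightarrow> complex" where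
  "push l b v z = l *\<^sub>R v (hiso (1 / l) (- b / l) z)"

lemma push_eq: "push l b v = (\<lambda>z. l *\<^sub>R v ((1 / l) *\<^sub>R z + of_real (- b / l)))"
  unfolding push_def[abs_def] hiso_eq ..

lemma push_test_field:
  assumes "v \<in> test_fields" "l > 0"
  shows "push l b v \<in> test_fields"
proof -
  obtain K where K: "compact K" "K \<subseteq> hyp_plane" "\<And>p. p \<in> hyp_plane \<Longrightarrow> v p \<noteq> 0 \<Longrightarrow> p \<in> K"
    using test_field_support assms by metis
  have il: "1 / l > 0" using assms by simp
  show ?thesis
  proof (rule test_fieldsI[of _ "hiso l b ` K"])
    have "C_k_on n (push l b v) ((\<lambda>x. (1 / l) *\<^sub>R x + of_real (- b / l)) -` hyp_plane)" for n
      unfolding push_eq using assms by (intro C_k_on_affine open_hyp_plane) (auto simp: test_fields_def smooth_on_def)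
    moreover have "(\<lambda>x. (1 / l) *\<^sub>R x + complex_of_real (- b / l)) -` hyp_plane = hyp_plane"
      using hiso_hyp_plane[OF il] unfolding hiso_eq by blast
    ultimately show "smooth_on (push l b v) hyp_plane"
      by (simp add: smooth_on_def)
    show "compact (hiso l b ` K)"
      by (intro compact_continuous_image continuous_intros K)
    show "hiso l b ` K \<subseteq> hyp_plane"
      using K hiso_hyp_plane assms by blast
    show "p \<in> hiso l b ` K" if "p \<in> hyp_plane" "push l b v p \<noteq> 0" for p
      using K(3)[of "hiso (1 / l) (- b / l) p"] that assms hiso_hyp_plane[OF il] hiso_inverse(1)
      by (auto simp: push_def intro!: image_eqI[of p "hiso l b" "hiso (1 / l) (- b / l) p"])
  qed
qed

lemma push_unit_field:
  assumes "v \<in> unit_fields" "l > 0"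
  shows "push l b v \<in> unit_fields"
proof -
  have "norm (push l b v p) \<le> Im p" if "p \<in> hyp_plane" for p
  proof -
    have "norm (v (hiso (1 / l) (- b / l) p)) \<le> Im (hiso (1 / l) (- b / l) p)"
    proof -
      have 1: "\<And>q. q \<in> hyp_plane \<Longrightarrow> norm (v q) \<le> Im q"
        using assms by (simp add: unit_fields_def)
      have 2: "hiso (1 / l) (- b / l) p \<in> hyp_plane"
        using assms that by (intro hiso_hyp_plane[THEN iffD2]) auto
      show ?thesis by (rule 1[OF 2])
    qed
    then have "norm (v (hiso (1 / l) (- b / l) p)) \<le> Im p / l"
      by simp
    then have "l * norm (v (hiso (1 / l) (- b / l) p)) \<le> l * (Im p / l)"
      using assms by (intro mult_left_mono) auto
    then show ?thesis
      using assms unfolding push_def by simp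
  qed
  then show ?thesis
    using assms push_test_field by (simp add: unit_fields_def)
qed

lemma hyp_div_push:
  assumes "v \<in> test_fields" "l > 0" "p \<in> hyp_plane"
  shows "hyp_div (push l b v) (hiso l b p) = hyp_div v p"
proof -
  define v' where "v' = frechet_derivative v (at p)"
  have v': "(v has_derivative v') (at p)"
    unfolding v'_def using test_field_has_derivative assms by blast
  then have lin: "linear v'"
    by (rule has_derivative_linear)
  have "((\<lambda>z. l *\<^sub>R v ((1 / l) *\<^sub>R z + of_real (- b / l))) has_derivative (\<lambda>e. l *\<^sub>R v' ((1 / l) *\<^sub>R e))) (at (hiso l b p))"
  proof (rule has_derivative_scaleR_right, rule has_derivative_compose[where g = v and g' = v'])
    show "((\<lambda>z. (1 / l) *\<^sub>R z + complex_of_real (- b / l)) has_derivative (\<lambda>e. (1 / l) *\<^sub>R e)) (at (hiso l b p))"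
      by (auto intro!: derivative_eq_intros)
    show "(v has_derivative v') (at ((1 / l) *\<^sub>R hiso l b p + complex_of_real (- b / l)))"
      using v' hiso_inverse(2)[OF assms(2), of b p] unfolding hiso_eq by simp
  qed
  then have "(push l b v has_derivative v') (at (hiso l b p))"
    using assms lin unfolding push_eq by (simp add: linear_scale)
  from hyp_div_eq[OF this] show ?thesis
    using assms hiso_hyp_plane[OF assms(2), of b p] hyp_div_eq[OF v'] hiso_inverse(2)[OF assms(2), of b p]
    by (simp add: push_def)
qed

lemma flux_push:
  assumes "v \<in> test_fields" "l > 0" "E \<in> sets hyp_measure"
  shows "flux E (push l b v) = flux (hiso l b -` E) v"
proof -
  have "flux E (push l b v) = (\<integral>p. indicator E (hiso l b p) * hyp_div (push l b v) (hiso l b p) \<partial>hypvol)"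
    unfolding flux_def
    using integral_hypvol_plane_map[OF measurable_hyp_div[OF push_test_field[OF assms(1,2)] assms(3)] assms(2,2), of 0 b]
      assms(2) by simp
  also have "\<dots> = flux (hiso l b -` E) v"
    unfolding flux_def using hiso_hyp_plane[OF assms(2)] assms(3) hyp_div_push[OF assms(1,2)]
    by (intro Bochner_Integration.integral_cong refl) (auto simp: indicator_def sets_hyp_measure)
  finally show ?thesis .
qed

lemma perimeter_iso_vimage_le:
  assumes "l > 0" "E \<in> sets hyp_measure"
  shows "perimeter (hiso l b -` E) \<le> perimeter E"
proof -
  have "ennreal (flux (hiso l b -` E) v) \<le> perimeter E" if "v \<in> unit_fields" for v
    using flux_le_perimeter[OF assms(2) push_unit_field[OF that assms(1)]] flux_push[OF _ assms] that
    by (simp add: unit_fields_def)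
  then show ?thesis
    by (simp add: perimeter_eq[OF hiso_vimage_sets[OF assms(2,1)]] SUP_le_iff)
qed

lemma emeasure_iso_vimage:
  assumes "A \<in> sets borel" "l > 0"
  shows "emeasure hypvol (hiso l b -` A) = emeasure hypvol A"
proof -
  have "emeasure hypvol (hiso l b -` A) = emeasure (distr hypvol borel (hiso l b)) A"
    using assms by (subst emeasure_distr) auto
  also have "\<dots> = emeasure hypvol A"
    using assms by (simp add: distr_hypvol_plane_map density_1)
  finally show ?thesis .
qed

section \<open>Translation estimates\<close>

text \<open>The polynomial is positive on a Euclidean disc (empty for \<open>n \<le> 2\<close>) whose closure lies in the
  half-plane, and it tends to infinity with \<open>n\<close> at every point of the half-plane.  So the
  functions \<open>flat 0 \<circ> disc n\<close> are smooth cutoff functions that tend to 1.\<close>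

definition disc :: "nat \<Rightarrow> complex \<Rightarrow> real" where
  "disc n z = real n * Im z - (Re z)\<^sup>2 - (Im z)\<^sup>2 - 1"

lemma real_polynomial_function_Re_Im:
  "real_polynomial_function Re" "real_polynomial_function Im"
  by (auto intro: real_polynomial_function.intros bounded_linear_Re bounded_linear_Im)

lemma real_polynomial_function_disc: "real_polynomial_function (disc n)"
proof -
  have "disc n = (\<lambda>z. real n * Im z + ((- 1) * (Re z * Re z) + ((- 1) * (Im z * Im z) + (- 1))))"
    by (simp add: disc_def fun_eq_iff power2_eq_square)
  then show ?thesis
    by (simp only:) (intro real_polynomial_function.intros(2-4) real_polynomial_function_Re_Im)
qed

lemma real_polynomial_function_plane_map:
  assumes "real_polynomial_function q"
  shows "real_polynomial_function (\<lambda>z. q (plane_map a s b c z))"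
proof -
  have 1: "(\<lambda>z. plane_map a s b c z \<bullet> i) = (\<lambda>z. (a * Re z + (s * Im z + b)) * Re i + (c * Im z) * Im i)" for i
    by (simp add: fun_eq_iff inner_complex_def)
  have "polynomial_function (plane_map a s b c)"
    unfolding polynomial_function_iff_Basis_inner 1
    by (intro ballI real_polynomial_function.intros(2-4) real_polynomial_function_Re_Im)
  from real_polynomial_function_compose[OF this assms] show ?thesis
    by (simp add: o_def)
qed

definition disc_set :: "nat \<Rightarrow> complex set" where
  "disc_set n = {z. 0 \<le> disc n z}"

lemma disc_set: "compact (disc_set n)" "disc_set n \<subseteq> hyp_plane"
proof -
  have "closed (disc_set n)"
    unfolding disc_set_def disc_def by (intro closed_Collect_le continuous_intros)
  moreover have "norm z \<le> real n" if "z \<in> disc_set n" for z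
  proof -
    have "norm z * norm z \<le> real n * norm z"
    proof -
      have "norm z * norm z = (Re z)\<^sup>2 + (Im z)\<^sup>2"
        by (simp add: cmod_power2 flip: power2_eq_square)
      also have "\<dots> \<le> real n * Im z"
        using that by (simp add: disc_set_def disc_def)
      also have "\<dots> \<le> real n * norm z"
        using abs_Im_le_cmod[of z] by (intro mult_left_mono) auto
      finally show ?thesis .
    qed
    then show ?thesis
      by (cases "norm z = 0") auto
  qed
  then have "bounded (disc_set n)"
    unfolding bounded_iff by blast
  ultimately show "compact (disc_set n)"
    by (simp add: compact_eq_bounded_closed)
  show "disc_set n \<subseteq> hyp_plane"
  proof
    fix z assume "z \<in> disc_set n"
    then have "0 \<le> real n * Im z - (Re z)\<^sup>2 - (Im z)\<^sup>2 - 1"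
      by (simp add: disc_set_def disc_def)
    then have "0 < real n * Im z"
      using zero_le_power2[of "Re z"] zero_le_power2[of "Im z"] by linarith
    then show "z \<in> hyp_plane"
      by (simp add: hyp_plane_def zero_less_mult_iff)
  qed
qed

lemma flat_disc_tendsto_1:
  assumes "z \<in> hyp_plane"
  shows "(\<lambda>n. flat 0 (disc n z)) \<longlonglongrightarrow> 1"
proof -
  have y: "Im z > 0" using assms by (simp add: hyp_plane_def)
  have lim: "filterlim (\<lambda>n. disc n z) at_top sequentially"
  proof -
    have "filterlim (\<lambda>n. real n * Im z) at_top sequentially"
      by (rule filterlim_at_top_mult_tendsto_pos[OF tendsto_const y filterlim_real_sequentially])
    then have "filterlim (\<lambda>n. (- ((Re z)\<^sup>2 + (Im z)\<^sup>2 + 1)) + real n * Im z) at_top sequentially"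
      by (intro filterlim_tendsto_add_at_top[OF tendsto_const])
    then show ?thesis
      by (simp add: disc_def algebra_simps)
  qed
  have "((\<lambda>t. exp (- inverse t)) \<longlongrightarrow> exp (- 0)) (at_top :: real filter)"
    by (intro tendsto_intros tendsto_inverse_0_at_top filterlim_ident)
  from filterlim_compose[OF this lim] have "(\<lambda>n. exp (- inverse (disc n z))) \<longlonglongrightarrow> 1"
    by simp
  moreover have "eventually (\<lambda>n. exp (- inverse (disc n z)) = flat 0 (disc n z)) sequentially"
    using filterlim_at_top_dense[THEN iffD1, rule_format, OF lim, of 0]
    by eventually_elim (simp add: flat_def)
  ultimately show ?thesis
    by (rule Lim_transform_eventually)
qed

lemma flat_span_support:
  assumes "f \<in> flat_span g" "g z \<le> 0"
  shows "f z = 0"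
  using assms(1) by induction (use assms(2) in \<open>auto simp: flat_def\<close>)

lemma flat_span_continuous:
  assumes "real_polynomial_function g" "f \<in> flat_span g"
  shows "continuous_on S f"
proof -
  obtain f' where "\<And>x. (f has_derivative (\<lambda>e. f' e x)) (at x)"
    using flat_span_derivative[OF assms] by blast
  then have "isCont f x" for x
    by (rule has_derivative_continuous)
  then show ?thesis
    by (simp add: continuous_at_imp_continuous_on)
qed

lemma flat_span_bounded:
  assumes "real_polynomial_function g" "f \<in> flat_span g" "compact K" "\<And>z. 0 < g z \<Longrightarrow> z \<in> K"
  obtains M where "0 \<le> M" "\<And>z. norm (f z) \<le> M"
proof -
  have "bounded (f ` K)"
    by (intro compact_imp_bounded compact_continuous_image flat_span_continuous[OF assms(1,2)] assms(3))
  then obtain M where M: "\<And>z. z \<in> K \<Longrightarrow> norm (f z) \<le> M"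
    unfolding bounded_iff by auto
  show ?thesis
  proof (rule that[of "max M 0"])
    show "norm (f z) \<le> max M 0" for z
    proof (cases "0 < g z")
      case True
      with M[OF assms(4)] show ?thesis by (simp add: le_max_iff_disj)
    next
      case False
      with flat_span_support[OF assms(2), of z] show ?thesis by simp
    qed
  qed simp
qed

text \<open>The integral of \<open>\<psi> t\<close> over \<open>E\<close> has the derivative \<^term>\<open>flux E (v t)\<close>, by dominated convergence,
  and the flux is at most the perimeter; the mean value theorem gives the bound.\<close>

lemma integral_flow_le:
  fixes \<psi> :: "real \<Rightarrow> complex \<Rightarrow> real"
  assumes E: "E \<in> sets hyp_measure" "perimeter E \<le> ennreal C" "0 \<le> C"
    and ab: "a0 < a" "a \<le> b" "b < b0"
    and v: "\<And>t. t \<in> {a0<..<b0} \<Longrightarrow> v t \<in> unit_fields"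
    and d: "\<And>t z. t \<in> {a0<..<b0} \<Longrightarrow> z \<in> hyp_plane \<Longrightarrow> ((\<lambda>t. \<psi> t z) has_real_derivative hyp_div (v t) z) (at t)"
    and K: "compact K" "K \<subseteq> hyp_plane"
    and M: "\<And>t z. t \<in> {a0<..<b0} \<Longrightarrow> z \<in> hyp_plane \<Longrightarrow> \<bar>hyp_div (v t) z\<bar> \<le> M * indicator K z"
    and int: "\<And>t. t \<in> {a0<..<b0} \<Longrightarrow> integrable hypvol (\<lambda>z. indicator E z * \<psi> t z)"
  shows "(\<integral>z. indicator E z * \<psi> b z \<partial>hypvol) - (\<integral>z. indicator E z * \<psi> a z \<partial>hypvol) \<le> (b - a) * C"
proof -
  define F where "F t = (\<integral>z. indicator E z * \<psi> t z \<partial>hypvol)" for t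
  have EH: "E \<subseteq> hyp_plane"
    using E by (simp add: sets_hyp_measure)
  have F: "(F has_real_derivative flux E (v t)) (at t)" if t: "t \<in> {a0<..<b0}" for t
    unfolding has_field_derivative_iff
  proof (subst tendsto_at_iff_sequentially, intro allI impI)
    fix X :: "nat \<Rightarrow> real"
    assume X: "\<forall>i. X i \<in> UNIV - {t}" "X \<longlonglongrightarrow> t"
    have "eventually (\<lambda>i. X i \<in> {a0<..<b0}) sequentially"
      using X(2) t by (intro topological_tendstoD) auto
    then obtain i0 where i0: "\<And>i. i \<ge> i0 \<Longrightarrow> X i \<in> {a0<..<b0}"
      by (auto simp: eventually_sequentially)
    define Q where "Q i z = indicator E z * ((\<psi> (X (i + i0)) z - \<psi> t z) / (X (i + i0) - t))" for i z
    have Xi: "X (i + i0) \<in> {a0<..<b0}" "X (i + i0) \<noteq> t" for i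
      using i0[of "i + i0"] X(1) by auto
    have "(\<lambda>i. \<integral>z. Q i z \<partial>hypvol) \<longlonglongrightarrow> (\<integral>z. indicator E z * hyp_div (v t) z \<partial>hypvol)"
    proof (rule integral_dominated_convergence[where w = "\<lambda>z. M * indicator K z"])
      show "(\<lambda>z. indicator E z * hyp_div (v t) z) \<in> borel_measurable hypvol"
        using measurable_hyp_div[OF _ E(1)] v[OF t] by (simp add: unit_fields_def)
      have "Q i = (\<lambda>z. (indicator E z * \<psi> (X (i + i0)) z - indicator E z * \<psi> t z) / (X (i + i0) - t))" for i
        by (auto simp: Q_def fun_eq_iff indicator_def)
      then show "Q i \<in> borel_measurable hypvol" for i
        using int[OF Xi(1)[of i]] int[OF t] by (simp add: borel_measurable_integrable)
      show "integrable hypvol (\<lambda>z. M * indicator K z)"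
        using emeasure_hypvol_compact[OF K] K(1)
        by (intro integrable_mult_right integrable_real_indicator) (auto intro: borel_compact)
      show "AE z in hypvol. (\<lambda>i. Q i z) \<longlonglongrightarrow> indicator E z * hyp_div (v t) z"
      proof (rule AE_I2)
        fix z
        show "(\<lambda>i. Q i z) \<longlonglongrightarrow> indicator E z * hyp_div (v t) z"
        proof (cases "z \<in> E")
          case True
          then have "((\<lambda>s. (\<psi> s z - \<psi> t z) / (s - t)) \<longlongrightarrow> hyp_div (v t) z) (at t)"
            using d[OF t, of z] EH by (auto simp: has_field_derivative_iff)
          then have "((\<lambda>s. (\<psi> s z - \<psi> t z) / (s - t)) \<circ> (\<lambda>i. X (i + i0))) \<longlonglongrightarrow> hyp_div (v t) z"
            using X(1) LIMSEQ_ignore_initial_segment[OF X(2), of i0]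
            unfolding tendsto_at_iff_sequentially by auto
          then show ?thesis
            using True by (simp add: Q_def o_def)
        qed (simp add: Q_def)
      qed
      show "AE z in hypvol. norm (Q i z) \<le> M * indicator K z" for i
      proof (rule AE_I2)
        fix z
        have pos: "0 \<le> M * indicator K z" if "z \<in> hyp_plane"
          using M[OF t that] by linarith
        show "norm (Q i z) \<le> M * indicator K z"
        proof (cases "z \<in> E")
          case True
          then have z: "z \<in> hyp_plane" using EH by auto
          have "\<bar>\<psi> (X (i + i0)) z - \<psi> t z\<bar> \<le> (M * indicator K z) * \<bar>X (i + i0) - t\<bar>"
          proof -
            have "norm (\<psi> (X (i + i0)) z - \<psi> t z) \<le> (M * indicator K z) * norm (X (i + i0) - t)"
            proof (rule field_differentiable_bound[of "{a0<..<b0}"])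
              show "((\<lambda>t. \<psi> t z) has_field_derivative hyp_div (v s) z) (at s within {a0<..<b0})"
                if "s \<in> {a0<..<b0}" for s
                using d[OF that z] by (rule has_field_derivative_at_within)
              show "norm (hyp_div (v s) z) \<le> M * indicator K z" if "s \<in> {a0<..<b0}" for s
                using M[OF that z] by simp
            qed (use Xi t in auto)
            then show ?thesis by simp
          qed
          then show ?thesis
            using True Xi(2)[of i] by (simp add: Q_def field_simps)
        next
          case False
          show ?thesis
          proof (cases "z \<in> K")
            case True
            with K pos show ?thesis by (auto simp: Q_def False)
          qed (simp add: Q_def False)
        qed
      qed
    qed
    also have "(\<integral>z. indicator E z * hyp_div (v t) z \<partial>hypvol) = flux E (v t)"
      by (simp add: flux_def)
    also have "(\<lambda>i. \<integral>z. Q i z \<partial>hypvol) = (\<lambda>i. ((\<lambda>y. (F y - F t) / (y - t)) \<circ> X) (i + i0))"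
    proof (rule ext)
      fix i
      have "(\<integral>z. Q i z \<partial>hypvol) =
          (\<integral>z. (indicator E z * \<psi> (X (i + i0)) z - indicator E z * \<psi> t z) / (X (i + i0) - t) \<partial>hypvol)"
        by (rule Bochner_Integration.integral_cong) (auto simp: Q_def indicator_def)
      also have "\<dots> = (F (X (i + i0)) - F t) / (X (i + i0) - t)"
        unfolding F_def using int[OF Xi(1)[of i]] int[OF t] by simp
      finally show "(\<integral>z. Q i z \<partial>hypvol) = ((\<lambda>y. (F y - F t) / (y - t)) \<circ> X) (i + i0)"
        by simp
    qed
    finally show "((\<lambda>y. (F y - F t) / (y - t)) \<circ> X) \<longlonglongrightarrow> flux E (v t)"
      by (rule LIMSEQ_offset)
  qed
  show ?thesis
  proof (cases "a = b")
    case False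
    with ab have "a < b" by simp
    from MVT2[OF this, of F "\<lambda>t. flux E (v t)"] F ab
    obtain t where t: "a < t" "t < b" "F b - F a = (b - a) * flux E (v t)" by auto
    have "flux E (v t) \<le> C"
      using flux_le[OF E(1) v[of t] E(2,3)] t ab by auto
    then show ?thesis
      using t \<open>a < b\<close> by (simp add: F_def[symmetric] mult_left_mono)
  qed simp
qed

lemma hyp_div_horizontal:
  assumes "(f has_derivative f') (at p)" "p \<in> hyp_plane"
  shows "hyp_div (\<lambda>z. (Im z * f z) *\<^sub>R 1) p = Im p * f' 1"
proof -
  have "((\<lambda>z. (Im z * f z) *\<^sub>R (1::complex)) has_derivative (\<lambda>e. (Im p * f' e + Im e * f p) *\<^sub>R 1)) (at p)"
    by (intro has_derivative_scaleR_left has_derivative_mult bounded_linear_imp_has_derivative bounded_linear_Im assms)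
  from hyp_div_eq[OF this assms(2)] show ?thesis
    by simp
qed

lemma hyp_div_vertical:
  assumes "(f has_derivative f') (at p)" "p \<in> hyp_plane"
  shows "hyp_div (\<lambda>z. (Im z * f z) *\<^sub>R \<i>) p = Im p * f' \<i> - f p"
proof -
  have "((\<lambda>z. (Im z * f z) *\<^sub>R \<i>) has_derivative (\<lambda>e. (Im p * f' e + Im e * f p) *\<^sub>R \<i>)) (at p)"
    by (intro has_derivative_scaleR_left has_derivative_mult bounded_linear_imp_has_derivative bounded_linear_Im assms)
  from hyp_div_eq[OF this assms(2)] show ?thesis
    using assms(2) by (simp add: hyp_plane_def)
qed

text \<open>The fields \<open>y \<phi>(Lz) \<partial>\<^sub>x\<close> and \<open>y \<phi>(Lz) \<partial>\<^sub>y\<close> have length at most 1 since \<open>y \<partial>\<^sub>x\<close> and \<open>y \<partial>\<^sub>y\<close>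
  are unit vectors.\<close>

lemma flow_field:
  fixes q g :: "complex \<Rightarrow> real" and c0 :: complex
  assumes q: "real_polynomial_function q" and g: "real_polynomial_function g"
    and K: "compact K" "K \<subseteq> hyp_plane" "\<And>z. 0 < g z \<Longrightarrow> z \<in> K"
    and bd: "\<And>z. z \<in> hyp_plane \<Longrightarrow> \<bar>q z * flat 0 (g z)\<bar> \<le> 1"
    and c: "c > 0" and c0: "norm c0 = 1"
  shows "(\<lambda>z. (Im z * (- (q (plane_map 1 s 0 c z) * flat 0 (g (plane_map 1 s 0 c z))))) *\<^sub>R c0) \<in> unit_fields" (is "?v \<in> _")
proof -
  let ?L = "plane_map 1 s 0 c" and ?I = "plane_map 1 (- s / c) 0 (1 / c)"
  have IL: "?I (?L z) = z" for z
    using c by (simp add: complex_eq_iff)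
  have LH: "?L z \<in> hyp_plane \<longleftrightarrow> z \<in> hyp_plane" "?I z \<in> hyp_plane \<longleftrightarrow> z \<in> hyp_plane" for z
    using c by (auto simp: hyp_plane_def zero_less_mult_iff zero_less_divide_iff)
  have "?v = (\<lambda>z. ((Im z * ((- 1) * q (?L z))) * flat 0 (g (?L z))) *\<^sub>R c0)"
    by (simp add: fun_eq_iff)
  also have "\<dots> \<in> flat_span (\<lambda>z. g (?L z))"
    by (intro flat_span.single real_polynomial_function.intros(2-4) real_polynomial_function_Re_Im
        real_polynomial_function_plane_map q)
  finally have sp: "?v \<in> flat_span (\<lambda>z. g (?L z))" .
  have "?v \<in> test_fields"
  proof (rule test_fieldsI[of _ "?I ` K"])
    show "smooth_on ?v hyp_plane"
      by (rule smooth_on_flat_span[OF real_polynomial_function_plane_map[OF g] sp])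
    show "compact (?I ` K)"
      by (intro compact_continuous_image continuous_intros K)
    show "?I ` K \<subseteq> hyp_plane"
      using K LH by blast
    show "z \<in> ?I ` K" if "z \<in> hyp_plane" "?v z \<noteq> 0" for z
    proof (rule image_eqI)
      show "z = ?I (?L z)" by (rule IL[symmetric])
      show "?L z \<in> K"
        using flat_span_support[OF sp, of z] that(2) K(3)[of "?L z"] by force
    qed
  qed
  moreover have "norm (?v z) \<le> Im z" if "z \<in> hyp_plane" for z
  proof -
    have "Im z * \<bar>q (?L z) * flat 0 (g (?L z))\<bar> \<le> Im z * 1"
      using that LH(1)[of z] by (intro mult_left_mono bd) (auto simp: hyp_plane_def)
    then show ?thesis
      using that c0 by (simp add: hyp_plane_def abs_mult)
  qed
  ultimately show ?thesis
    by (simp add: unit_fields_def)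
qed

text \<open>One bound serves for the test function and its partial derivatives, as all of them lie in
  \<^term>\<open>flat_span g\<close> and vanish outside \<open>K\<close>.\<close>

lemma flow_setup:
  fixes q g :: "complex \<Rightarrow> real"
  assumes q: "real_polynomial_function q" and g: "real_polynomial_function g"
    and K: "compact K" "K \<subseteq> hyp_plane" "\<And>z. 0 < g z \<Longrightarrow> z \<in> K"
  defines "\<phi> \<equiv> \<lambda>z. q z * flat 0 (g z)"
  obtains D B where "\<And>z. (\<phi> has_derivative (\<lambda>e. D e z)) (at z)"
    "\<And>e z. g z \<le> 0 \<Longrightarrow> D e z = 0" "\<And>z. g z \<le> 0 \<Longrightarrow> \<phi> z = 0" "continuous_on UNIV \<phi>"
    "0 \<le> B" "\<And>z. \<bar>\<phi> z\<bar> \<le> B" "\<And>z. \<bar>D 1 z\<bar> \<le> B" "\<And>z. \<bar>D \<i> z\<bar> \<le> B"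
proof -
  have "(\<lambda>z. (q z * flat 0 (g z)) *\<^sub>R (1::real)) \<in> flat_span g"
    by (intro flat_span.single q)
  then have sp: "\<phi> \<in> flat_span g"
    by (simp add: \<phi>_def)
  obtain D where D: "\<And>e. D e \<in> flat_span g" "\<And>z. (\<phi> has_derivative (\<lambda>e. D e z)) (at z)"
    using flat_span_derivative[OF g sp] by blast
  obtain B1 where "0 \<le> B1" "\<And>z. norm (\<phi> z) \<le> B1"
    using flat_span_bounded[OF g sp K(1,3)] by blast
  moreover obtain B2 where "0 \<le> B2" "\<And>z. norm (D 1 z) \<le> B2"
    using flat_span_bounded[OF g D(1) K(1,3)] by blast
  moreover obtain B3 where "0 \<le> B3" "\<And>z. norm (D \<i> z) \<le> B3"
    using flat_span_bounded[OF g D(1) K(1,3)] by blast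
  ultimately show ?thesis
    using flat_span_support[OF D(1)] flat_span_support[OF sp] flat_span_continuous[OF g sp]
    by (intro that[OF D(2), of "max B1 (max B2 B3)"]) (auto simp: le_max_iff_disj)
qed

text \<open>Along a flow of bounded duration, a test function keeps its support in one compact set; this
  provides the dominating function.\<close>

lemma compact_flow_box:
  assumes "compact K" "K \<subseteq> hyp_plane" "0 < c1"
  obtains K' where "compact K'" "K' \<subseteq> hyp_plane"
    "\<And>s c z. \<bar>s\<bar> \<le> s1 \<Longrightarrow> c1 \<le> c \<Longrightarrow> c \<le> c2 \<Longrightarrow> plane_map 1 s 0 c z \<in> K \<Longrightarrow> z \<in> K'"
proof -
  define f where "f = (\<lambda>(s, c, w). Complex (Re w - s * Im w / c) (Im w / c))"
  define K' where "K' = f ` ({- s1..s1} \<times> {c1..c2} \<times> K)"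
  have "compact K'"
    unfolding K'_def
  proof (intro compact_continuous_image compact_Times assms(1))
    show "continuous_on ({- s1..s1} \<times> {c1..c2} \<times> K) f"
      unfolding f_def Complex_eq case_prod_unfold using assms(3) by (intro continuous_intros) auto
  qed auto
  moreover have "K' \<subseteq> hyp_plane"
    using assms unfolding K'_def f_def by (auto simp: hyp_plane_def subset_iff intro!: divide_pos_pos)
  moreover have "z \<in> K'" if "\<bar>s\<bar> \<le> s1" "c1 \<le> c" "c \<le> c2" "plane_map 1 s 0 c z \<in> K" for s c z
    unfolding K'_def
  proof (rule image_eqI)
    show "z = f (s, c, plane_map 1 s 0 c z)"
      using assms(3) that by (simp add: f_def complex_eq_iff)
    show "(s, c, plane_map 1 s 0 c z) \<in> {- s1..s1} \<times> {c1..c2} \<times> K"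
      using that by auto
  qed
  ultimately show ?thesis using that by blast
qed

lemma integrable_flow:
  fixes f :: "complex \<Rightarrow> real"
  assumes "E \<in> sets hyp_measure" "compact K" "K \<subseteq> hyp_plane" "continuous_on UNIV f"
    and "\<And>z. \<bar>f z\<bar> \<le> B * indicator K z"
  shows "integrable hypvol (\<lambda>z. indicator E z * f z)"
proof -
  have [measurable]: "E \<in> sets borel" "f \<in> borel_measurable borel"
    using assms by (auto simp: sets_hyp_measure intro: borel_measurable_continuous_onI)
  have "integrable hypvol (\<lambda>p. B * indicator K p)"
    using emeasure_hypvol_compact[OF assms(2,3)] assms(2)
    by (intro integrable_mult_right integrable_real_indicator) (auto intro: borel_compact)
  then show ?thesis
  proof (rule Bochner_Integration.integrable_bound)
    show "AE z in hypvol. norm (indicator E z * f z) \<le> norm (B * indicator K z)"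
    proof (rule AE_I2)
      fix z show "norm (indicator E z * f z) \<le> norm (B * indicator K z)"
        using assms(5)[of z] by (auto simp: indicator_def)
    qed
  qed measurable
qed

text \<open>With \<open>\<psi> t = \<phi>(x - ty, y)\<close> one has \<open>d\<psi>/dt = - y \<phi>\<^sub>x = div (- y \<psi> \<partial>\<^sub>x)\<close>, and the shears preserve area.\<close>

lemma integral_shear_le:
  fixes q g :: "complex \<Rightarrow> real"
  assumes E: "E \<in> sets hyp_measure" "perimeter E \<le> ennreal C" "0 \<le> C"
    and q: "real_polynomial_function q" and g: "real_polynomial_function g"
    and K: "compact K" "K \<subseteq> hyp_plane" "\<And>z. 0 < g z \<Longrightarrow> z \<in> K"
    and bd: "\<And>z. z \<in> hyp_plane \<Longrightarrow> \<bar>q z * flat 0 (g z)\<bar> \<le> 1"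
    and s: "0 \<le> s"
  shows "(\<integral>z. (indicator E (plane_map 1 s 0 1 z) - indicator E z) * (q z * flat 0 (g z)) \<partial>hypvol) \<le> s * C"
proof -
  define \<phi> where "\<phi> = (\<lambda>z. q z * flat 0 (g z))"
  obtain D B where D: "\<And>z. (\<phi> has_derivative (\<lambda>e. D e z)) (at z)"
    "\<And>e z. g z \<le> 0 \<Longrightarrow> D e z = 0" "\<And>z. g z \<le> 0 \<Longrightarrow> \<phi> z = 0" "continuous_on UNIV \<phi>"
    "0 \<le> B" "\<And>z. \<bar>\<phi> z\<bar> \<le> B" "\<And>z. \<bar>D 1 z\<bar> \<le> B" "\<And>z. \<bar>D \<i> z\<bar> \<le> B"
    unfolding \<phi>_def using flow_setup[OF q g K] by blast
  let ?L = "\<lambda>t. plane_map 1 (- t) 0 1"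
  define \<psi> where "\<psi> t z = \<phi> (?L t z)" for t z
  define v where "v t = (\<lambda>z. (Im z * (- \<phi> (?L t z))) *\<^sub>R (1::complex))" for t
  obtain K' where K': "compact K'" "K' \<subseteq> hyp_plane"
    "\<And>t z. \<bar>t\<bar> \<le> s + 1 \<Longrightarrow> ?L t z \<in> K \<Longrightarrow> z \<in> K'"
  proof (rule compact_flow_box[OF K(1,2), of 1 "s + 1" 1])
    fix K' assume *: "compact K'" "K' \<subseteq> hyp_plane"
      "\<And>s' c z. \<bar>s'\<bar> \<le> s + 1 \<Longrightarrow> 1 \<le> c \<Longrightarrow> c \<le> 1 \<Longrightarrow> plane_map 1 s' 0 c z \<in> K \<Longrightarrow> z \<in> K'"
    show thesis
      by (rule that[of K']) (use * in \<open>auto intro: *(3)[of "- _" 1]\<close>)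
  qed simp
  have "bounded (Im ` K')"
    by (intro compact_imp_bounded compact_continuous_image continuous_on_Im continuous_on_id K')
  then obtain Y where Y: "\<And>z. z \<in> K' \<Longrightarrow> Im z \<le> Y"
    unfolding bounded_iff by (auto simp: abs_le_iff)
  have dv: "hyp_div (v t) z = - Im z * D 1 (?L t z)" if "z \<in> hyp_plane" for t z
  proof -
    have "((\<lambda>z. - \<phi> (?L t z)) has_derivative (\<lambda>e. - D (plane_map 1 (- t) 0 1 e) (?L t z))) (at z)"
    proof (rule has_derivative_minus, rule has_derivative_compose[where g = \<phi>])
      show "(\<phi> has_derivative (\<lambda>e. D e (?L t z))) (at (?L t z))"
        by (rule D(1))
      show "(?L t has_derivative plane_map 1 (- t) 0 1) (at z)"
        unfolding plane_map_def Complex_eq by (auto intro!: derivative_eq_intros simp: fun_eq_iff)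
    qed
    from hyp_div_horizontal[OF this that] show ?thesis
      unfolding v_def by (simp add: plane_map_def one_complex.code)
  qed
  have off: "\<phi> (?L t z) = 0 \<and> D e (?L t z) = 0" if "\<bar>t\<bar> \<le> s + 1" "z \<notin> K'" for t z e
    using that K'(3)[of t z] K(3)[of "?L t z"] D(2,3)[of "?L t z"] by (cases "0 < g (?L t z)") auto
  have main: "(\<integral>z. indicator E z * \<psi> s z \<partial>hypvol) - (\<integral>z. indicator E z * \<psi> 0 z \<partial>hypvol) \<le> (s - 0) * C"
  proof (rule integral_flow_le[OF E, of "- 1" _ _ "s + 1" v])
    fix t assume t: "t \<in> {- 1<..<s + 1}"
    then have t': "\<bar>t\<bar> \<le> s + 1" using s by auto
    show "v t \<in> unit_fields"
      unfolding v_def \<phi>_def by (rule flow_field[OF q g K bd]) auto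
    show "integrable hypvol (\<lambda>z. indicator E z * \<psi> t z)"
    proof (rule integrable_flow[OF E(1) K'(1,2)])
      show "continuous_on UNIV (\<psi> t)"
        unfolding \<psi>_def by (intro continuous_on_compose2[OF D(4)] continuous_intros) auto
      show "\<bar>\<psi> t z\<bar> \<le> B * indicator K' z" for z
        using off[OF t'] D(6) by (auto simp: \<psi>_def indicator_def)
    qed
    fix z assume z: "z \<in> hyp_plane"
    show "\<bar>hyp_div (v t) z\<bar> \<le> (Y * B) * indicator K' z"
    proof (cases "z \<in> K'")
      case True
      then have "Im z * \<bar>D 1 (?L t z)\<bar> \<le> Y * B"
        using z Y D(5,7) by (intro mult_mono) (auto simp: hyp_plane_def intro: order_trans[OF less_imp_le])
      then show ?thesis
        using True z by (simp add: dv abs_mult hyp_plane_def)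
    next
      case False
      with off[OF t'] show ?thesis by (simp add: dv z)
    qed
    show "((\<lambda>t. \<psi> t z) has_real_derivative hyp_div (v t) z) (at t)"
    proof -
      have lin: "linear (\<lambda>e. D e (?L t z))"
        using D(1) by (rule has_derivative_linear)
      have "((\<lambda>t. ?L t z) has_derivative (\<lambda>h. (- (h * Im z)) *\<^sub>R 1)) (at t)"
        unfolding plane_map_def Complex_eq
        by (auto intro!: derivative_eq_intros simp: fun_eq_iff scaleR_conv_of_real)
      from has_derivative_compose[OF this D(1)]
      have "((\<lambda>t. \<psi> t z) has_derivative (\<lambda>h. D ((- (h * Im z)) *\<^sub>R 1) (?L t z))) (at t)"
        by (simp add: \<psi>_def)
      then show ?thesis
        unfolding has_field_derivative_def linear_scale[OF lin] dv[OF z]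
        by (rule has_derivative_eq_rhs) (simp add: fun_eq_iff)
    qed
  qed (use s K' in auto)
  have [measurable]: "E \<in> sets borel" "\<phi> \<in> borel_measurable borel"
    using E(1) D(4) by (auto simp: sets_hyp_measure intro: borel_measurable_continuous_onI)
  have "(\<integral>z. indicator E z * \<psi> s z \<partial>hypvol) = (\<integral>z. indicator E (plane_map 1 s 0 1 z) * \<psi> s (plane_map 1 s 0 1 z) \<partial>hypvol)"
    unfolding \<psi>_def by (subst integral_hypvol_plane_map) simp_all
  also have "\<dots> = (\<integral>z. indicator E (plane_map 1 s 0 1 z) * \<phi> z \<partial>hypvol)"
  proof (rule Bochner_Integration.integral_cong)
    fix z show "indicator E (plane_map 1 s 0 1 z) * \<psi> s (plane_map 1 s 0 1 z) = indicator E (plane_map 1 s 0 1 z) * \<phi> z"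
      by (simp add: \<psi>_def plane_map_def)
  qed simp
  finally have 1: "(\<integral>z. indicator E z * \<psi> s z \<partial>hypvol) = (\<integral>z. indicator E (plane_map 1 s 0 1 z) * \<phi> z \<partial>hypvol)" .
  have 2: "\<psi> 0 z = \<phi> z" for z
    by (simp add: \<psi>_def plane_map_def)
  have bdphi: "\<bar>\<phi> z\<bar> \<le> B * indicator K z" for z
    using D(3)[of z] D(6)[of z] K(3)[of z] by (cases "0 < g z") (auto simp: indicator_def)
  have "plane_map 1 s 0 1 -` E \<in> sets hyp_measure"
    using measurable_sets[OF measurable_plane_map, of E 1 s 0 1] E(1) by (auto simp: sets_hyp_measure hyp_plane_def subset_iff)
  from integrable_flow[OF this K(1,2) D(4) bdphi]
  have "integrable hypvol (\<lambda>z. indicator E (plane_map 1 s 0 1 z) * \<phi> z)"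
    by (simp add: indicator_def)
  moreover have "integrable hypvol (\<lambda>z. indicator E z * \<phi> z)"
    by (rule integrable_flow[OF E(1) K(1,2) D(4) bdphi])
  ultimately have "(\<integral>z. (indicator E (plane_map 1 s 0 1 z) - indicator E z) * \<phi> z \<partial>hypvol) \<le> s * C"
    using main unfolding 1 2 by (simp add: left_diff_distrib)
  then show ?thesis
    by (simp add: \<phi>_def)
qed

text \<open>The factor \<open>t\<close> in \<open>\<psi> t = t \<phi>(x, y/t)\<close> compensates for the change of area under the dilation, and it also
  makes \<open>d\<psi>/dt = \<phi> - (y/t) \<phi>\<^sub>y\<close> equal to the divergence of \<open>- y \<phi>(x, y/t) \<partial>\<^sub>y\<close>.\<close>

lemma integral_dilation_le:
  fixes q g :: "complex \<Rightarrow> real"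
  assumes E: "E \<in> sets hyp_measure" "perimeter E \<le> ennreal C" "0 \<le> C"
    and q: "real_polynomial_function q" and g: "real_polynomial_function g"
    and K: "compact K" "K \<subseteq> hyp_plane" "\<And>z. 0 < g z \<Longrightarrow> z \<in> K"
    and bd: "\<And>z. z \<in> hyp_plane \<Longrightarrow> \<bar>q z * flat 0 (g z)\<bar> \<le> 1"
    and s: "1 \<le> s"
  shows "(\<integral>z. (indicator E (plane_map 1 0 0 s z) - indicator E z) * (q z * flat 0 (g z)) \<partial>hypvol) \<le> (s - 1) * C"
proof -
  define \<phi> where "\<phi> = (\<lambda>z. q z * flat 0 (g z))"
  obtain D B where D: "\<And>z. (\<phi> has_derivative (\<lambda>e. D e z)) (at z)"
    "\<And>e z. g z \<le> 0 \<Longrightarrow> D e z = 0" "\<And>z. g z \<le> 0 \<Longrightarrow> \<phi> z = 0" "continuous_on UNIV \<phi>"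
    "0 \<le> B" "\<And>z. \<bar>\<phi> z\<bar> \<le> B" "\<And>z. \<bar>D 1 z\<bar> \<le> B" "\<And>z. \<bar>D \<i> z\<bar> \<le> B"
    unfolding \<phi>_def using flow_setup[OF q g K] by blast
  let ?L = "\<lambda>t. plane_map 1 0 0 (1 / t)"
  define \<psi> where "\<psi> t z = t * \<phi> (?L t z)" for t z
  define v where "v t = (\<lambda>z. (Im z * (- \<phi> (?L t z))) *\<^sub>R \<i>)" for t
  obtain K' where K': "compact K'" "K' \<subseteq> hyp_plane"
    "\<And>t z. 1 / 2 \<le> t \<Longrightarrow> t \<le> s + 1 \<Longrightarrow> ?L t z \<in> K \<Longrightarrow> z \<in> K'"
  proof (rule compact_flow_box[OF K(1,2), of "1 / (s + 1)" 0 2])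
    fix K' assume *: "compact K'" "K' \<subseteq> hyp_plane"
      "\<And>s' c z. \<bar>s'\<bar> \<le> 0 \<Longrightarrow> 1 / (s + 1) \<le> c \<Longrightarrow> c \<le> 2 \<Longrightarrow> plane_map 1 s' 0 c z \<in> K \<Longrightarrow> z \<in> K'"
    show thesis
    proof (rule that[OF *(1,2)])
      fix t z assume t: "1 / 2 \<le> t" "t \<le> s + 1" "?L t z \<in> K"
      then have "1 / (s + 1) \<le> 1 / t" "1 / t \<le> 2"
        by (auto simp: field_simps)
      with *(3)[of 0 "1 / t" z] t show "z \<in> K'" by simp
    qed
  qed (use s in simp)
  have "bounded (Im ` K')"
    by (intro compact_imp_bounded compact_continuous_image continuous_on_Im continuous_on_id K')
  then obtain Y where Y: "\<And>z. z \<in> K' \<Longrightarrow> Im z \<le> Y"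
    unfolding bounded_iff by (auto simp: abs_le_iff)
  have dv: "hyp_div (v t) z = \<phi> (?L t z) - (Im z / t) * D \<i> (?L t z)" if "z \<in> hyp_plane" "t > 0" for t z
  proof -
    have lin: "linear (\<lambda>e. D e (?L t z))"
      using D(1) by (rule has_derivative_linear)
    have i: "plane_map 1 0 0 (1 / t) \<i> = (1 / t) *\<^sub>R \<i>"
      by (simp add: complex_eq_iff)
    have "((\<lambda>z. - \<phi> (?L t z)) has_derivative (\<lambda>e. - D (plane_map 1 0 0 (1 / t) e) (?L t z))) (at z)"
    proof (rule has_derivative_minus, rule has_derivative_compose[where g = \<phi>])
      show "(\<phi> has_derivative (\<lambda>e. D e (?L t z))) (at (?L t z))"
        by (rule D(1))
      show "(?L t has_derivative plane_map 1 0 0 (1 / t)) (at z)"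
        unfolding plane_map_def Complex_eq using that by (auto intro!: derivative_eq_intros simp: fun_eq_iff)
    qed
    from hyp_div_vertical[OF this that(1)] show ?thesis
      unfolding v_def i linear_scale[OF lin] by simp
  qed
  have off: "\<phi> (?L t z) = 0 \<and> D e (?L t z) = 0" if "1 / 2 \<le> t" "t \<le> s + 1" "z \<notin> K'" for t z e
    using that K'(3)[of t z] K(3)[of "?L t z"] D(2,3)[of "?L t z"] by (cases "0 < g (?L t z)") auto
  have main: "(\<integral>z. indicator E z * \<psi> s z \<partial>hypvol) - (\<integral>z. indicator E z * \<psi> 1 z \<partial>hypvol) \<le> (s - 1) * C"
  proof (rule integral_flow_le[OF E, of "1 / 2" _ _ "s + 1" v])
    fix t assume t: "t \<in> {1 / 2<..<s + 1}"
    then have t': "1 / 2 \<le> t" "t \<le> s + 1" "t > 0" by auto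
    show "v t \<in> unit_fields"
      unfolding v_def \<phi>_def by (rule flow_field[OF q g K bd]) (use t' in auto)
    show "integrable hypvol (\<lambda>z. indicator E z * \<psi> t z)"
    proof (rule integrable_flow[OF E(1) K'(1,2)])
      show "continuous_on UNIV (\<psi> t)"
        unfolding \<psi>_def by (intro continuous_on_mult continuous_on_const continuous_on_compose2[OF D(4)] continuous_on_plane_map) auto
      show "\<bar>\<psi> t z\<bar> \<le> (t * B) * indicator K' z" for z
        using off[OF t'(1,2)] D(6) t' by (auto simp: \<psi>_def indicator_def abs_mult)
    qed
    fix z assume z: "z \<in> hyp_plane"
    show "\<bar>hyp_div (v t) z\<bar> \<le> (B + 2 * Y * B) * indicator K' z"
    proof (cases "z \<in> K'")
      case True
      have "0 < Im z" using z by (simp add: hyp_plane_def)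
      have "(Im z / t) * \<bar>D \<i> (?L t z)\<bar> \<le> (2 * Y) * B"
      proof (rule mult_mono)
        have "Im z \<le> Y * (2 * t)"
          using mult_mono[OF Y[OF True], of 1 "2 * t"] Y[OF True] \<open>0 < Im z\<close> t' by simp
        then show "Im z / t \<le> 2 * Y"
          using t' by (simp add: field_simps)
      qed (use D \<open>0 < Im z\<close> Y[OF True] in auto)
      moreover have "\<bar>\<phi> (?L t z) - (Im z / t) * D \<i> (?L t z)\<bar> \<le> \<bar>\<phi> (?L t z)\<bar> + (Im z / t) * \<bar>D \<i> (?L t z)\<bar>"
        using abs_triangle_ineq4[of "\<phi> (?L t z)" "(Im z / t) * D \<i> (?L t z)"] t' \<open>0 < Im z\<close>
        by (simp add: abs_mult)
      ultimately show ?thesis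
        using True D(6)[of "?L t z"] by (simp add: dv[OF z t'(3)])
    next
      case False
      with off[OF t'(1,2)] show ?thesis by (simp add: dv[OF z t'(3)])
    qed
    show "((\<lambda>t. \<psi> t z) has_real_derivative hyp_div (v t) z) (at t)"
    proof -
      have lin: "linear (\<lambda>e. D e (?L t z))"
        using D(1) by (rule has_derivative_linear)
      have "((\<lambda>t. 1 / t * Im z) has_real_derivative (- (Im z / t\<^sup>2))) (at t)"
        using t' by (auto intro!: derivative_eq_intros simp: power2_eq_square)
      then have "((\<lambda>t. 1 / t * Im z) has_derivative (\<lambda>h. - (Im z / t\<^sup>2) * h)) (at t)"
        unfolding has_field_derivative_def .
      then have "((\<lambda>t. of_real (Re z) + of_real (1 / t * Im z) * \<i>) has_derivative
          (\<lambda>h. 0 + of_real (- (Im z / t\<^sup>2) * h) * \<i>)) (at t)"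
        by (intro has_derivative_add has_derivative_const has_derivative_mult_left has_derivative_of_real)
      then have "((\<lambda>t. ?L t z) has_derivative (\<lambda>h. (h * (- (Im z / t\<^sup>2))) *\<^sub>R \<i>)) (at t)"
        by (simp add: plane_map_def Complex_eq scaleR_conv_of_real mult.commute)
      from has_derivative_compose[OF this D(1)]
      have "((\<lambda>t. \<phi> (?L t z)) has_derivative (\<lambda>h. (h * (- (Im z / t\<^sup>2))) *\<^sub>R D \<i> (?L t z))) (at t)"
        unfolding linear_scale[OF lin] .
      from has_derivative_mult[OF has_derivative_ident this]
      show ?thesis
        unfolding has_field_derivative_def \<psi>_def dv[OF z t'(3)]
        by (rule has_derivative_eq_rhs) (use t' in \<open>simp add: fun_eq_iff field_simps power2_eq_square\<close>)
    qed
  qed (use s K' in auto)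
  have [measurable]: "E \<in> sets borel" "\<phi> \<in> borel_measurable borel"
    using E(1) D(4) by (auto simp: sets_hyp_measure intro: borel_measurable_continuous_onI)
  have "s * (\<integral>z. indicator E z * \<phi> (?L s z) \<partial>hypvol) = (\<integral>z. indicator E (plane_map 1 0 0 s z) * \<phi> (?L s (plane_map 1 0 0 s z)) \<partial>hypvol)"
    using s by (subst integral_hypvol_plane_map) simp_all
  also have "\<dots> = (\<integral>z. indicator E (plane_map 1 0 0 s z) * \<phi> z \<partial>hypvol)"
  proof (rule Bochner_Integration.integral_cong)
    fix z show "indicator E (plane_map 1 0 0 s z) * \<phi> (?L s (plane_map 1 0 0 s z)) = indicator E (plane_map 1 0 0 s z) * \<phi> z"
      using s by (simp add: plane_map_def)
  qed simp
  finally have 1: "(\<integral>z. indicator E z * \<psi> s z \<partial>hypvol) = (\<integral>z. indicator E (plane_map 1 0 0 s z) * \<phi> z \<partial>hypvol)"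
    by (simp add: \<psi>_def mult.left_commute)
  have 2: "\<psi> 1 z = \<phi> z" for z
    by (simp add: \<psi>_def plane_map_def)
  have bdphi: "\<bar>\<phi> z\<bar> \<le> B * indicator K z" for z
    using D(3)[of z] D(6)[of z] K(3)[of z] by (cases "0 < g z") (auto simp: indicator_def)
  have "plane_map 1 0 0 s -` E \<in> sets hyp_measure"
    using measurable_sets[OF measurable_plane_map, of E 1 0 0 s] E(1) s
    by (auto simp: sets_hyp_measure hyp_plane_def subset_iff zero_less_mult_iff)
  from integrable_flow[OF this K(1,2) D(4) bdphi]
  have "integrable hypvol (\<lambda>z. indicator E (plane_map 1 0 0 s z) * \<phi> z)"
    by (simp add: indicator_def)
  moreover have "integrable hypvol (\<lambda>z. indicator E z * \<phi> z)"
    by (rule integrable_flow[OF E(1) K(1,2) D(4) bdphi])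
  ultimately have "(\<integral>z. (indicator E (plane_map 1 0 0 s z) - indicator E z) * \<phi> z \<partial>hypvol) \<le> (s - 1) * C"
    using main unfolding 1 2 by (simp add: left_diff_distrib)
  then show ?thesis
    by (simp add: \<phi>_def)
qed

lemma AE_hypvol_negligible:
  assumes "negligible N"
  shows "AE z in hypvol. z \<notin> N \<and> z \<in> hyp_plane"
proof -
  have "AE z in lebesgue. z \<notin> N"
    using assms by (simp add: negligible_iff_null_sets AE_not_in)
  then have "AE z in lborel. z \<notin> N"
    by (simp add: AE_completion_iff)
  then show ?thesis
    unfolding hypvol_def by (subst AE_density) (auto simp: indicator_def)
qed

text \<open>The sign of \<open>w\<close> is almost everywhere a limit of continuous functions.  On the compact support of a
  cutoff function these are approximated by polynomials (Stone--Weierstrass), which after a slight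
  contraction are admissible tests.\<close>

lemma nn_integral_abs_le_of_tests:
  fixes w :: "complex \<Rightarrow> real"
  assumes [measurable]: "w \<in> borel_measurable borel" and w1: "\<And>z. \<bar>w z\<bar> \<le> 1"
    and test: "\<And>n p. real_polynomial_function p \<Longrightarrow> (\<And>z. z \<in> hyp_plane \<Longrightarrow> \<bar>p z * flat 0 (disc n z)\<bar> \<le> 1) \<Longrightarrow>
      (\<integral>z. w z * (p z * flat 0 (disc n z)) \<partial>hypvol) \<le> C"
  shows "(\<integral>\<^sup>+z. ennreal \<bar>w z\<bar> \<partial>hypvol) \<le> ennreal C"
proof -
  have flat_m [measurable]: "flat 0 \<in> borel_measurable borel"
    unfolding flat_def[abs_def] by measurable
  have disc_m [measurable]: "disc n \<in> borel_measurable borel" for n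
    unfolding disc_def[abs_def] by measurable
  define cut where "cut n z = flat 0 (disc n z)" for n z
  have [measurable]: "cut n \<in> borel_measurable borel" for n
    unfolding cut_def by measurable
  have cut: "0 \<le> cut n z" "cut n z \<le> indicator (disc_set n) z" for n z
    using flat_0_le_1[of "disc n z"] by (auto simp: cut_def flat_nonneg disc_set_def flat_def indicator_def)
  have int_disc: "integrable hypvol (indicator (disc_set n) :: complex \<Rightarrow> real)" for n
    using emeasure_hypvol_compact[OF disc_set] disc_set(1)
    by (intro integrable_real_indicator) (auto intro: borel_compact)
  have "(\<lambda>z. sgn (w z)) \<in> borel_measurable lebesgue"
    by (rule borel_measurable_if_I[of _ UNIV, simplified] measurable_completion) measurable
  then have "(\<lambda>z. sgn (w z)) measurable_on UNIV"
    by (simp add: lebesgue_measurable_imp_measurable_on)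
  then obtain N g where N: "negligible N" and g: "\<And>j. continuous_on UNIV (g j)"
      and lim: "\<And>z. z \<notin> N \<Longrightarrow> (\<lambda>j. g j z) \<longlonglongrightarrow> sgn (w z)"
    unfolding measurable_on_def by auto
  have le: "(\<integral>\<^sup>+z. ennreal (\<bar>w z\<bar> * cut n z) \<partial>hypvol) \<le> ennreal C" for n
  proof -
    define f where "f j z = max (- 1) (min 1 (g j z))" for j z
    have f_cont: "continuous_on (disc_set n) (f j)" for j
      unfolding f_def by (intro continuous_intros continuous_on_subset[OF g]) auto
    have "\<exists>p. real_polynomial_function p \<and> (\<forall>z\<in>disc_set n. \<bar>f j z - p z\<bar> < inverse (real (Suc j)))" for j
      by (rule Stone_Weierstrass_real_polynomial_function[OF disc_set(1)[of n] f_cont[of j], of "inverse (real (Suc j))"]) auto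
    then obtain p where p: "\<And>j. real_polynomial_function (p j)"
        "\<And>j z. z \<in> disc_set n \<Longrightarrow> \<bar>f j z - p j z\<bar> < inverse (real (Suc j))"
      by metis
    define P where "P j z = p j z * inverse (1 + inverse (real (Suc j)))" for j z
    have P: "real_polynomial_function (P j)" for j
      unfolding P_def by (intro real_polynomial_function.intros(2,4) p)
    have [measurable]: "P j \<in> borel_measurable borel" for j
      by (intro borel_measurable_continuous_onI continuous_on_polymonial_function)
         (simp add: P flip: real_polynomial_function_eq)
    have P1: "\<bar>P j z\<bar> \<le> 1" if "z \<in> disc_set n" for j z
    proof -
      have "\<bar>f j z\<bar> \<le> 1" by (auto simp: f_def)
      with p(2)[OF that, of j] have "\<bar>p j z\<bar> \<le> 1 + inverse (real (Suc j))" by linarith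
      moreover define c where "c = 1 + inverse (real (Suc j))"
      moreover have "0 < c"
        unfolding c_def by (intro add_pos_pos) auto
      ultimately show ?thesis
        by (simp add: P_def abs_mult divide_le_eq flip: divide_inverse c_def)
    qed
    have Pchi: "\<bar>P j z * cut n z\<bar> \<le> indicator (disc_set n) z" for j z
    proof (cases "z \<in> disc_set n")
      case True
      then show ?thesis
        using mult_mono[OF P1[OF True, of j] cut(2)[of n z]] cut(1)[of n z] by (simp add: abs_mult)
    next
      case False
      then show ?thesis
        using cut[of n z] by (simp add: indicator_def)
    qed
    have Plim: "(\<lambda>j. P j z) \<longlonglongrightarrow> sgn (w z)" if "z \<in> disc_set n" "z \<notin> N" for z
    proof -
      have "(\<lambda>j. f j z) \<longlonglongrightarrow> max (- 1) (min 1 (sgn (w z)))"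
        unfolding f_def by (intro tendsto_intros lim that)
      then have "(\<lambda>j. f j z) \<longlonglongrightarrow> sgn (w z)"
        by (simp add: sgn_real_def)
      moreover have "(\<lambda>j. f j z - p j z) \<longlonglongrightarrow> 0"
        by (rule Lim_null_comparison[OF _ LIMSEQ_inverse_real_of_nat])
           (use p(2)[OF that(1)] in \<open>auto intro!: always_eventually less_imp_le\<close>)
      ultimately have "(\<lambda>j. f j z - (f j z - p j z)) \<longlonglongrightarrow> sgn (w z) - 0"
        by (rule tendsto_diff)
      then have "(\<lambda>j. p j z) \<longlonglongrightarrow> sgn (w z)" by simp
      then have "(\<lambda>j. P j z) \<longlonglongrightarrow> sgn (w z) * inverse (1 + 0)"
        unfolding P_def by (intro tendsto_intros LIMSEQ_inverse_real_of_nat) auto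
      then show ?thesis by simp
    qed
    have "(\<lambda>j. \<integral>z. w z * (P j z * cut n z) \<partial>hypvol) \<longlonglongrightarrow> (\<integral>z. \<bar>w z\<bar> * cut n z \<partial>hypvol)"
    proof (rule integral_dominated_convergence[OF _ _ int_disc[of n]])
      show "AE z in hypvol. (\<lambda>j. w z * (P j z * cut n z)) \<longlonglongrightarrow> \<bar>w z\<bar> * cut n z"
        using AE_hypvol_negligible[OF N]
      proof eventually_elim
        case (elim z)
        show ?case
        proof (cases "z \<in> disc_set n")
          case True
          have "(\<lambda>j. w z * (P j z * cut n z)) \<longlonglongrightarrow> w z * (sgn (w z) * cut n z)"
            by (intro tendsto_intros Plim True) (use elim in auto)
          then show ?thesis
            by (simp add: abs_sgn mult.assoc)
        next
          case False
          then have "cut n z = 0"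
            using cut[of n z] by simp
          then show ?thesis by simp
        qed
      qed
      show "AE z in hypvol. norm (w z * (P j z * cut n z)) \<le> indicator (disc_set n) z" for j
      proof (rule AE_I2)
        fix z
        show "norm (w z * (P j z * cut n z)) \<le> indicator (disc_set n) z"
          using mult_mono[OF w1[of z] Pchi[of j z]] by (simp add: abs_mult)
      qed
    qed measurable
    moreover have "(\<integral>z. w z * (P j z * cut n z) \<partial>hypvol) \<le> C" for j
      unfolding cut_def
    proof (rule test[OF P])
      show "\<bar>P j z * flat 0 (disc n z)\<bar> \<le> 1" for z
        using order_trans[OF Pchi[of j z], of 1] by (simp add: cut_def indicator_def split: if_splits)
    qed
    ultimately have "(\<integral>z. \<bar>w z\<bar> * cut n z \<partial>hypvol) \<le> C"
      by (intro LIMSEQ_le_const2) auto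
    moreover have "integrable hypvol (\<lambda>z. \<bar>w z\<bar> * cut n z)"
    proof (rule Bochner_Integration.integrable_bound[OF int_disc[of n]])
      show "AE z in hypvol. norm (\<bar>w z\<bar> * cut n z) \<le> norm (indicator (disc_set n) z :: real)"
      proof (rule AE_I2)
        fix z
        show "norm (\<bar>w z\<bar> * cut n z) \<le> norm (indicator (disc_set n) z :: real)"
          using mult_mono[OF w1[of z] cut(2)[of n z]] cut(1)[of n z] by (simp add: abs_mult)
      qed
    qed measurable
    ultimately show ?thesis
      using cut(1) by (subst nn_integral_eq_integral) (auto intro: ennreal_leI)
  qed
  have "(\<integral>\<^sup>+z. ennreal \<bar>w z\<bar> \<partial>hypvol) \<le> (\<integral>\<^sup>+z. liminf (\<lambda>n. ennreal (\<bar>w z\<bar> * cut n z)) \<partial>hypvol)"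
  proof (rule nn_integral_mono_AE)
    show "AE z in hypvol. ennreal \<bar>w z\<bar> \<le> liminf (\<lambda>n. ennreal (\<bar>w z\<bar> * cut n z))"
      using AE_hypvol_negligible[OF N]
    proof eventually_elim
      case (elim z)
      have "(\<lambda>n. \<bar>w z\<bar> * cut n z) \<longlonglongrightarrow> \<bar>w z\<bar> * 1"
        unfolding cut_def by (intro tendsto_intros flat_disc_tendsto_1) (use elim in auto)
      then have "(\<lambda>n. ennreal (\<bar>w z\<bar> * cut n z)) \<longlonglongrightarrow> ennreal \<bar>w z\<bar>"
        by simp
      then show ?case
        by (simp add: lim_imp_Liminf)
    qed
  qed
  also have "\<dots> \<le> liminf (\<lambda>n. \<integral>\<^sup>+z. ennreal (\<bar>w z\<bar> * cut n z) \<partial>hypvol)"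
    by (rule nn_integral_liminf) measurable
  also have "\<dots> \<le> ennreal C"
    by (rule Liminf_le) (simp_all add: le)
  finally show ?thesis .
qed

definition jump :: "complex set \<Rightarrow> complex \<Rightarrow> complex \<Rightarrow> ennreal" where
  "jump E z w = ennreal \<bar>indicator E z - indicator E w\<bar>"

lemma measurable_jump [measurable]:
  assumes [measurable]: "E \<in> sets borel" "f \<in> borel_measurable M" "g \<in> borel_measurable M"
  shows "(\<lambda>x. jump E (f x) (g x)) \<in> borel_measurable M"
  unfolding jump_def by measurable

lemma shear_estimate:
  assumes E: "E \<in> sets hyp_measure" "perimeter E \<le> ennreal C" "0 \<le> C" and s: "0 \<le> s"
  shows "(\<integral>\<^sup>+z. jump E (plane_map 1 s 0 1 z) z \<partial>hypvol) \<le> ennreal (s * C)"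
  unfolding jump_def
proof (rule nn_integral_abs_le_of_tests)
  have [measurable]: "E \<in> sets borel"
    using E by (simp add: sets_hyp_measure)
  show "(\<lambda>z. indicator E (plane_map 1 s 0 1 z) - indicator E z :: real) \<in> borel_measurable borel"
    by measurable
  show "(\<integral>z. (indicator E (plane_map 1 s 0 1 z) - indicator E z) * (p z * flat 0 (disc n z)) \<partial>hypvol) \<le> s * C"
    if "real_polynomial_function p" "\<And>z. z \<in> hyp_plane \<Longrightarrow> \<bar>p z * flat 0 (disc n z)\<bar> \<le> 1" for n p
    by (rule integral_shear_le[OF E that(1) real_polynomial_function_disc disc_set[of n] _ that(2) s])
       (auto simp: disc_set_def)
qed (auto simp: indicator_def)

lemma dilation_estimate:
  assumes E: "E \<in> sets hyp_measure" "perimeter E \<le> ennreal C" "0 \<le> C" and s: "1 \<le> s"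
  shows "(\<integral>\<^sup>+z. jump E (plane_map 1 0 0 s z) z \<partial>hypvol) \<le> ennreal ((s - 1) * C)"
  unfolding jump_def
proof (rule nn_integral_abs_le_of_tests)
  have [measurable]: "E \<in> sets borel"
    using E by (simp add: sets_hyp_measure)
  show "(\<lambda>z. indicator E (plane_map 1 0 0 s z) - indicator E z :: real) \<in> borel_measurable borel"
    by measurable
  show "(\<integral>z. (indicator E (plane_map 1 0 0 s z) - indicator E z) * (p z * flat 0 (disc n z)) \<partial>hypvol) \<le> (s - 1) * C"
    if "real_polynomial_function p" "\<And>z. z \<in> hyp_plane \<Longrightarrow> \<bar>p z * flat 0 (disc n z)\<bar> \<le> 1" for n p
    by (rule integral_dilation_le[OF E that(1) real_polynomial_function_disc disc_set[of n] _ that(2) s])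
       (auto simp: disc_set_def)
qed (auto simp: indicator_def)

text \<open>A vertical dilation by the factor 2 doubles the area, but changes \<open>E\<close> by at most its perimeter.\<close>

lemma emeasure_le_perimeter:
  assumes E: "E \<in> sets hyp_measure" and fin: "emeasure hypvol E < \<infinity>"
  shows "emeasure hypvol E \<le> perimeter E"
proof (cases "perimeter E")
  case (real C)
  have [measurable]: "E \<in> sets borel"
    using E by (simp add: sets_hyp_measure)
  obtain a where a: "emeasure hypvol E = ennreal a" "0 \<le> a"
    using fin by (cases "emeasure hypvol E") auto
  have "ennreal 2 * emeasure hypvol E = (\<integral>\<^sup>+z. indicator E (plane_map 1 0 0 2 z) \<partial>hypvol)"
    by (subst nn_integral_hypvol_plane_map) auto
  also have "\<dots> \<le> (\<integral>\<^sup>+z. indicator E z + jump E (plane_map 1 0 0 2 z) z \<partial>hypvol)"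
    by (intro nn_integral_mono) (auto simp: jump_def indicator_def)
  also have "\<dots> = emeasure hypvol E + (\<integral>\<^sup>+z. jump E (plane_map 1 0 0 2 z) z \<partial>hypvol)"
    by (subst nn_integral_add) auto
  also have "\<dots> \<le> emeasure hypvol E + ennreal ((2 - 1) * C)"
    using real by (intro add_left_mono dilation_estimate E) auto
  finally have "ennreal (2 * a) \<le> ennreal (a + C)"
    using a real by (simp add: ennreal_mult)
  then have "2 * a \<le> a + C"
    using a real by (subst (asm) ennreal_le_iff) auto
  then show ?thesis
    using a real by (simp add: ennreal_leI)
qed simp

section \<open>A Poincare inequality on small squares\<close>

text \<open>Lebesgue measure on a segment, as a finite measure on the line, so that iterated integrals over a
  square can be exchanged.\<close>

definition seg_measure :: "real \<Rightarrow> real \<Rightarrow> real measure" where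
  "seg_measure a h = density lborel (indicator {a..<a + h})"

lemma sets_seg_measure [simp, measurable_cong]: "sets (seg_measure a h) = sets borel"
  and space_seg_measure [simp]: "space (seg_measure a h) = UNIV"
  by (simp_all add: seg_measure_def)

lemma nn_integral_seg_measure:
  "f \<in> borel_measurable borel \<Longrightarrow> (\<integral>\<^sup>+x. f x \<partial>seg_measure a h) = (\<integral>\<^sup>+x. f x * indicator {a..<a + h} x \<partial>lborel)"
  unfolding seg_measure_def by (subst nn_integral_density) (auto simp: mult.commute)

lemma emeasure_seg_measure: "0 \<le> h \<Longrightarrow> emeasure (seg_measure a h) UNIV = ennreal h"
  unfolding seg_measure_def by (subst emeasure_density) auto

lemma finite_seg_measure: "0 \<le> h \<Longrightarrow> finite_measure (seg_measure a h)"
  by (rule finite_measureI) (simp add: emeasure_seg_measure)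

lemma AE_seg_measure: "AE x in seg_measure a h. x \<in> {a..<a + h}"
  unfolding seg_measure_def by (subst AE_density) (auto simp: indicator_def)

lemma nn_integral_seg_swap:
  assumes "case_prod f \<in> borel_measurable (borel \<Otimes>\<^sub>M borel)" "0 \<le> h" "0 \<le> k"
  shows "(\<integral>\<^sup>+x. \<integral>\<^sup>+y. f x y \<partial>seg_measure b k \<partial>seg_measure a h) = (\<integral>\<^sup>+y. \<integral>\<^sup>+x. f x y \<partial>seg_measure a h \<partial>seg_measure b k)"
proof -
  interpret A: finite_measure "seg_measure a h" by (rule finite_seg_measure[OF assms(2)])
  interpret B: finite_measure "seg_measure b k" by (rule finite_seg_measure[OF assms(3)])
  interpret pair_sigma_finite "seg_measure a h" "seg_measure b k" ..
  have "case_prod f \<in> borel_measurable (seg_measure a h \<Otimes>\<^sub>M seg_measure b k)"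
    using assms(1) by (simp cong: measurable_cong_sets sets_pair_measure_cong)
  from Fubini'[OF this] show ?thesis by simp
qed

text \<open>By symmetry only pairs with \<open>x \<le> y\<close> count, and these have the form \<open>y = x + s r(x)\<close> with
  \<open>0 \<le> s \<le> d\<close>.  For shears the speed \<open>r\<close> is the constant height, for dilations it is the
  coordinate itself.\<close>

lemma nn_integral_seg_pairs_le:
  fixes w :: "real \<Rightarrow> real \<Rightarrow> ennreal"
  assumes w [measurable]: "case_prod w \<in> borel_measurable (borel \<Otimes>\<^sub>M borel)" and sym: "\<And>x y. w x y = w y x"
    and r [measurable]: "r \<in> borel_measurable borel" and rpos: "\<And>x. x \<in> {a..<a + h} \<Longrightarrow> 0 < r x \<and> h \<le> d * r x"
    and h: "0 \<le> h"
  shows "(\<integral>\<^sup>+x. \<integral>\<^sup>+y. w x y \<partial>seg_measure a h \<partial>seg_measure a h) \<le>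
    2 * (\<integral>\<^sup>+x. ennreal (r x) * (\<integral>\<^sup>+s. w x (x + s * r x) * indicator {0..d} s \<partial>lborel) \<partial>seg_measure a h)"
proof -
  define u where "u x y = (if x \<le> y then w x y else 0)" for x y
  have [measurable]: "case_prod u \<in> borel_measurable (borel \<Otimes>\<^sub>M borel)"
    unfolding u_def case_prod_unfold using w unfolding case_prod_unfold by measurable
  interpret A: finite_measure "seg_measure a h" by (rule finite_seg_measure[OF h])
  have "(\<integral>\<^sup>+x. \<integral>\<^sup>+y. w x y \<partial>seg_measure a h \<partial>seg_measure a h) \<le>
      (\<integral>\<^sup>+x. \<integral>\<^sup>+y. u x y + u y x \<partial>seg_measure a h \<partial>seg_measure a h)"
    using sym by (intro nn_integral_mono) (auto simp: u_def)
  also have "\<dots> = (\<integral>\<^sup>+x. \<integral>\<^sup>+y. u x y \<partial>seg_measure a h \<partial>seg_measure a h) + (\<integral>\<^sup>+x. \<integral>\<^sup>+y. u y x \<partial>seg_measure a h \<partial>seg_measure a h)"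
    by (subst nn_integral_add[symmetric]; measurable?) (intro nn_integral_cong nn_integral_add; measurable)
  also have "(\<integral>\<^sup>+x. \<integral>\<^sup>+y. u y x \<partial>seg_measure a h \<partial>seg_measure a h) = (\<integral>\<^sup>+x. \<integral>\<^sup>+y. u x y \<partial>seg_measure a h \<partial>seg_measure a h)"
    by (rule nn_integral_seg_swap[OF _ h h]) measurable
  also have "(\<integral>\<^sup>+x. \<integral>\<^sup>+y. u x y \<partial>seg_measure a h \<partial>seg_measure a h) + (\<integral>\<^sup>+x. \<integral>\<^sup>+y. u x y \<partial>seg_measure a h \<partial>seg_measure a h)
      = 2 * (\<integral>\<^sup>+x. \<integral>\<^sup>+y. u x y \<partial>seg_measure a h \<partial>seg_measure a h)"
    by (simp add: mult_2)
  also have "(\<integral>\<^sup>+x. \<integral>\<^sup>+y. u x y \<partial>seg_measure a h \<partial>seg_measure a h) \<le>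
     (\<integral>\<^sup>+x. ennreal (r x) * (\<integral>\<^sup>+s. w x (x + s * r x) * indicator {0..d} s \<partial>lborel) \<partial>seg_measure a h)"
  proof (rule nn_integral_mono_AE)
    show "AE x in seg_measure a h. (\<integral>\<^sup>+y. u x y \<partial>seg_measure a h) \<le>
      ennreal (r x) * (\<integral>\<^sup>+s. w x (x + s * r x) * indicator {0..d} s \<partial>lborel)"
      using AE_seg_measure
    proof eventually_elim
      case (elim x)
      have rx: "0 < r x" "h \<le> d * r x" using rpos[OF elim] by auto
      have "(\<integral>\<^sup>+y. u x y \<partial>seg_measure a h) = (\<integral>\<^sup>+y. u x y * indicator {a..<a + h} y \<partial>lborel)"
        by (rule nn_integral_seg_measure) measurable
      also have "\<dots> = ennreal (r x) * (\<integral>\<^sup>+s. u x (x + r x * s) * indicator {a..<a + h} (x + r x * s) \<partial>lborel)"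
        using rx by (subst nn_integral_real_affine[where c = "r x" and t = x]) auto
      also have "\<dots> \<le> ennreal (r x) * (\<integral>\<^sup>+s. w x (x + s * r x) * indicator {0..d} s \<partial>lborel)"
      proof (intro mult_left_mono nn_integral_mono)
        fix s
        show "u x (x + r x * s) * indicator {a..<a + h} (x + r x * s) \<le> w x (x + s * r x) * indicator {0..d} s"
        proof (cases "x \<le> x + r x * s \<and> x + r x * s \<in> {a..<a + h}")
          case True
          then have "0 \<le> r x * s" by simp
          then have "0 \<le> s" using rx by (simp add: zero_le_mult_iff)
          have "r x * s \<le> r x * d"
            using True elim rx(2) unfolding atLeastLessThan_iff mult.commute[of d] by linarith
          then have "s \<le> d" using rx(1) by (rule mult_left_le_imp_le)
          with \<open>0 \<le> s\<close> show ?thesis by (simp add: u_def mult.commute indicator_def)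
        qed (auto simp: u_def indicator_def)
      qed simp
      finally show ?case .
    qed
  qed
  finally show ?thesis by (simp add: mult_left_mono)
qed

definition square :: "real \<Rightarrow> real \<Rightarrow> real \<Rightarrow> complex set" where
  "square x y h = {z. Re z \<in> {x..<x + h} \<and> Im z \<in> {y..<y + h}}"

lemma square_borel [measurable, simp]: "square x y h \<in> sets borel"
proof -
  have "square x y h = {z \<in> space borel. Re z \<in> {x..<x + h} \<and> Im z \<in> {y..<y + h}}"
    by (simp add: square_def)
  also have "\<dots> \<in> sets borel" by measurable
  finally show ?thesis .
qed

lemma nn_integral_square:
  assumes [measurable]: "f \<in> borel_measurable borel"
  shows "(\<integral>\<^sup>+z. f z * indicator (square x0 y0 h) z \<partial>lborel) =
    (\<integral>\<^sup>+y. \<integral>\<^sup>+x. f (Complex x y) \<partial>seg_measure x0 h \<partial>seg_measure y0 h)"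
proof -
  have "(\<integral>\<^sup>+z. f z * indicator (square x0 y0 h) z \<partial>lborel) =
      (\<integral>\<^sup>+y. \<integral>\<^sup>+x. f (Complex x y) * indicator {x0..<x0 + h} x * indicator {y0..<y0 + h} y \<partial>lborel \<partial>lborel)"
    by (subst nn_integral_lborel_complex) (auto simp: square_def indicator_def intro!: nn_integral_cong)
  also have "\<dots> = (\<integral>\<^sup>+y. \<integral>\<^sup>+x. f (Complex x y) \<partial>seg_measure x0 h \<partial>seg_measure y0 h)"
    by (subst nn_integral_seg_measure, measurable)+
       (auto intro!: nn_integral_cong nn_integral_multc simp: nn_integral_seg_measure)
  finally show ?thesis .
qed

lemma emeasure_square: "0 \<le> h \<Longrightarrow> emeasure lborel (square x y h) = ennreal (h * h)"
  using nn_integral_square[of "\<lambda>_. 1" x y h]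
  by (simp add: emeasure_seg_measure ennreal_mult)

text \<open>The two translation estimates bound its integral by a multiple of \<open>d\<^sup>2 P(E)\<close>, and it controls how far
  \<open>E\<close> is from being empty or full in squares of hyperbolic side at most \<open>d\<close>.\<close>

definition osc :: "complex set \<Rightarrow> real \<Rightarrow> complex \<Rightarrow> ennreal" where
  "osc E d z = (\<integral>\<^sup>+s. (jump E (plane_map 1 s 0 1 z) z + jump E (plane_map 1 0 0 (1 + s) z) z) * indicator {0..d} s \<partial>lborel)"

lemma measurable_plane_map' [measurable]:
  assumes [measurable]: "a \<in> borel_measurable M" "s \<in> borel_measurable M" "b \<in> borel_measurable M"
    "c \<in> borel_measurable M" "z \<in> borel_measurable M"
  shows "(\<lambda>x. plane_map (a x) (s x) (b x) (c x) (z x)) \<in> borel_measurable M"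
  unfolding plane_map_def by measurable

lemma measurable_osc [measurable]:
  assumes [measurable]: "E \<in> sets borel"
  shows "osc E d \<in> borel_measurable borel"
  unfolding osc_def by measurable

lemma sigma_finite_hypvol: "sigma_finite_measure hypvol"
  unfolding hypvol_def
proof (subst sigma_finite_measure.sigma_finite_iff_density_finite[OF sigma_finite_lborel])
  show "AE x in lborel. indicator hyp_plane x * ennreal (1 / (Im x)\<^sup>2) \<noteq> \<infinity>"
    by (auto simp: indicator_def)
qed measurable

lemma nn_integral_osc_le:
  assumes E: "E \<in> sets hyp_measure" "perimeter E \<le> ennreal C" "0 \<le> C" and d: "0 \<le> d"
  shows "(\<integral>\<^sup>+z. osc E d z \<partial>hypvol) \<le> ennreal (2 * d * d * C)"
proof -
  have [measurable]: "E \<in> sets borel"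
    using E by (simp add: sets_hyp_measure)
  interpret sigma_finite_measure hypvol by (rule sigma_finite_hypvol)
  interpret pair_sigma_finite lborel hypvol ..
  have "(\<integral>\<^sup>+z. osc E d z \<partial>hypvol) = (\<integral>\<^sup>+s. \<integral>\<^sup>+z. (jump E (plane_map 1 s 0 1 z) z + jump E (plane_map 1 0 0 (1 + s) z) z) * indicator {0..d} s \<partial>hypvol \<partial>lborel)"
    unfolding osc_def by (rule Fubini') (simp add: case_prod_unfold, measurable)
  also have "\<dots> \<le> (\<integral>\<^sup>+s. ennreal (2 * d * C) * indicator {0..d} s \<partial>lborel)"
  proof (rule nn_integral_mono)
    fix s
    show "(\<integral>\<^sup>+z. (jump E (plane_map 1 s 0 1 z) z + jump E (plane_map 1 0 0 (1 + s) z) z) * indicator {0..d} s \<partial>hypvol)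
        \<le> ennreal (2 * d * C) * indicator {0..d} s"
    proof (cases "s \<in> {0..d}")
      case True
      have "(\<integral>\<^sup>+z. (jump E (plane_map 1 s 0 1 z) z + jump E (plane_map 1 0 0 (1 + s) z) z) \<partial>hypvol) =
        (\<integral>\<^sup>+z. jump E (plane_map 1 s 0 1 z) z \<partial>hypvol) + (\<integral>\<^sup>+z. jump E (plane_map 1 0 0 (1 + s) z) z \<partial>hypvol)"
        by (rule nn_integral_add) measurable
      also have "\<dots> \<le> ennreal (s * C) + ennreal ((1 + s - 1) * C)"
        using True by (intro add_mono shear_estimate dilation_estimate E) auto
      also have "\<dots> = ennreal (2 * s * C)"
        using True E(3) by (simp flip: ennreal_plus)
      also have "\<dots> \<le> ennreal (2 * d * C)"
        using True E(3) by (intro ennreal_leI mult_right_mono) auto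
      finally show ?thesis using True by simp
    qed simp
  qed
  also have "\<dots> = ennreal (2 * d * C) * ennreal d"
    using d by (subst nn_integral_cmult_indicator) auto
  also have "\<dots> = ennreal (2 * d * d * C)"
    using d E(3) by (simp add: ac_simps flip: ennreal_mult)
  finally show ?thesis .
qed

lemma jump_commute: "jump E z w = jump E w z"
  by (simp add: jump_def abs_minus_commute)

text \<open>Walk from a point of \<open>E\<close> in the square to a point outside \<open>E\<close>, first horizontally and then
  vertically: \<open>E\<close> is left in one of the two moves.  These moves or their reverses are a shear and a
  dilation of duration at most \<open>d\<close>, because the side of the square is at most \<open>d\<close> times its height above the real line.\<close>

lemma square_isoperimetric:
  assumes [measurable]: "E \<in> sets borel" and h: "0 < h" "h \<le> d * y0" "d \<le> 1" "0 < y0"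
  shows "emeasure lborel (E \<inter> square x0 y0 h) * emeasure lborel (square x0 y0 h - E) \<le>
    ennreal (16 * h * y0^3) * (\<integral>\<^sup>+z. osc E d z * indicator (square x0 y0 h) z \<partial>hypvol)"
proof -
  let ?I = "seg_measure x0 h" and ?J = "seg_measure y0 h"
  interpret I: finite_measure ?I by (rule finite_seg_measure) (use h in simp)
  interpret J: finite_measure ?J by (rule finite_seg_measure) (use h in simp)
  have h0: "0 \<le> h" using h by simp
  have em: "emeasure lborel (A \<inter> square x0 y0 h) = (\<integral>\<^sup>+y. \<integral>\<^sup>+x. indicator A (Complex x y) \<partial>?I \<partial>?J)"
    if [measurable]: "A \<in> sets borel" for A
  proof -
    have "emeasure lborel (A \<inter> square x0 y0 h) = (\<integral>\<^sup>+z. indicator A z * indicator (square x0 y0 h) z \<partial>lborel)"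
      by (simp flip: nn_integral_indicator add: indicator_inter_arith)
    then show ?thesis by (simp add: nn_integral_square)
  qed
  define G where "G = (\<integral>\<^sup>+y. \<integral>\<^sup>+x. indicator (- E) (Complex x y) \<partial>?I \<partial>?J)"
  have "emeasure lborel (E \<inter> square x0 y0 h) * emeasure lborel (square x0 y0 h - E) =
      (\<integral>\<^sup>+y. \<integral>\<^sup>+x. indicator E (Complex x y) \<partial>?I \<partial>?J) * G"
    using em[of E] em[of "- E"] by (simp add: G_def Diff_eq Int_commute)
  also have "\<dots> = (\<integral>\<^sup>+y. \<integral>\<^sup>+x. indicator E (Complex x y) * G \<partial>?I \<partial>?J)"
    by (subst nn_integral_multc[symmetric], measurable, intro nn_integral_cong nn_integral_multc[symmetric], measurable)
  also have "\<dots> = (\<integral>\<^sup>+y. \<integral>\<^sup>+x. \<integral>\<^sup>+y'. \<integral>\<^sup>+x'. indicator E (Complex x y) * indicator (- E) (Complex x' y') \<partial>?I \<partial>?J \<partial>?I \<partial>?J)"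
    unfolding G_def
    by (intro nn_integral_cong, subst nn_integral_cmult[symmetric], measurable,
        intro nn_integral_cong nn_integral_cmult[symmetric], measurable)
  also have "\<dots> \<le> (\<integral>\<^sup>+y. \<integral>\<^sup>+x. \<integral>\<^sup>+y'. \<integral>\<^sup>+x'. jump E (Complex x y) (Complex x' y) + jump E (Complex x' y) (Complex x' y') \<partial>?I \<partial>?J \<partial>?I \<partial>?J)"
    by (intro nn_integral_mono) (auto simp: jump_def indicator_def)
  also have "\<dots> = (\<integral>\<^sup>+y. \<integral>\<^sup>+x. \<integral>\<^sup>+y'. \<integral>\<^sup>+x'. jump E (Complex x y) (Complex x' y) \<partial>?I \<partial>?J \<partial>?I \<partial>?J) +
      (\<integral>\<^sup>+y. \<integral>\<^sup>+x. \<integral>\<^sup>+y'. \<integral>\<^sup>+x'. jump E (Complex x' y) (Complex x' y') \<partial>?I \<partial>?J \<partial>?I \<partial>?J)"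
    by (simp add: nn_integral_add)
  also have "(\<integral>\<^sup>+y. \<integral>\<^sup>+x. \<integral>\<^sup>+y'. \<integral>\<^sup>+x'. jump E (Complex x y) (Complex x' y) \<partial>?I \<partial>?J \<partial>?I \<partial>?J) =
      ennreal h * (\<integral>\<^sup>+y. \<integral>\<^sup>+x. \<integral>\<^sup>+x'. jump E (Complex x y) (Complex x' y) \<partial>?I \<partial>?I \<partial>?J)"
    by (simp add: emeasure_seg_measure[OF h0] nn_integral_cmult mult.commute[of _ "ennreal h"])
  also have "(\<integral>\<^sup>+y. \<integral>\<^sup>+x. \<integral>\<^sup>+y'. \<integral>\<^sup>+x'. jump E (Complex x' y) (Complex x' y') \<partial>?I \<partial>?J \<partial>?I \<partial>?J) =
      ennreal h * (\<integral>\<^sup>+y. \<integral>\<^sup>+y'. \<integral>\<^sup>+x'. jump E (Complex x' y) (Complex x' y') \<partial>?I \<partial>?J \<partial>?J)"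
    by (simp add: emeasure_seg_measure[OF h0] nn_integral_cmult mult.commute[of _ "ennreal h"])
  also have "(\<integral>\<^sup>+y. \<integral>\<^sup>+y'. \<integral>\<^sup>+x'. jump E (Complex x' y) (Complex x' y') \<partial>?I \<partial>?J \<partial>?J) =
      (\<integral>\<^sup>+x. \<integral>\<^sup>+y. \<integral>\<^sup>+y'. jump E (Complex x y) (Complex x y') \<partial>?J \<partial>?J \<partial>?I)"
  proof -
    have "(\<integral>\<^sup>+y. \<integral>\<^sup>+y'. \<integral>\<^sup>+x'. jump E (Complex x' y) (Complex x' y') \<partial>?I \<partial>?J \<partial>?J) =
        (\<integral>\<^sup>+y. \<integral>\<^sup>+x'. \<integral>\<^sup>+y'. jump E (Complex x' y) (Complex x' y') \<partial>?J \<partial>?I \<partial>?J)"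
      by (intro nn_integral_cong nn_integral_seg_swap h0) (simp add: case_prod_unfold, measurable)
    also have "\<dots> = (\<integral>\<^sup>+x. \<integral>\<^sup>+y. \<integral>\<^sup>+y'. jump E (Complex x y) (Complex x y') \<partial>?J \<partial>?J \<partial>?I)"
      by (intro nn_integral_seg_swap h0) (simp add: case_prod_unfold, measurable)
    finally show ?thesis .
  qed
  also have "ennreal h * (\<integral>\<^sup>+y. \<integral>\<^sup>+x. \<integral>\<^sup>+x'. jump E (Complex x y) (Complex x' y) \<partial>?I \<partial>?I \<partial>?J) +
      ennreal h * (\<integral>\<^sup>+x. \<integral>\<^sup>+y. \<integral>\<^sup>+y'. jump E (Complex x y) (Complex x y') \<partial>?J \<partial>?J \<partial>?I) \<le>
      ennreal h * (\<integral>\<^sup>+y. 2 * (\<integral>\<^sup>+x. ennreal y * (\<integral>\<^sup>+s. jump E (Complex x y) (Complex (x + s * y) y) * indicator {0..d} s \<partial>lborel) \<partial>?I) \<partial>?J) +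
      ennreal h * (\<integral>\<^sup>+x. 2 * (\<integral>\<^sup>+y. ennreal y * (\<integral>\<^sup>+s. jump E (Complex x y) (Complex x (y + s * y)) * indicator {0..d} s \<partial>lborel) \<partial>?J) \<partial>?I)"
  proof (intro add_mono mult_left_mono)
    show "(\<integral>\<^sup>+y. \<integral>\<^sup>+x. \<integral>\<^sup>+x'. jump E (Complex x y) (Complex x' y) \<partial>?I \<partial>?I \<partial>?J) \<le>
      (\<integral>\<^sup>+y. 2 * (\<integral>\<^sup>+x. ennreal y * (\<integral>\<^sup>+s. jump E (Complex x y) (Complex (x + s * y) y) * indicator {0..d} s \<partial>lborel) \<partial>?I) \<partial>?J)"
    proof (rule nn_integral_mono_AE)
      show "AE y in ?J. (\<integral>\<^sup>+x. \<integral>\<^sup>+x'. jump E (Complex x y) (Complex x' y) \<partial>?I \<partial>?I) \<le>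
        2 * (\<integral>\<^sup>+x. ennreal y * (\<integral>\<^sup>+s. jump E (Complex x y) (Complex (x + s * y) y) * indicator {0..d} s \<partial>lborel) \<partial>?I)"
        using AE_seg_measure
      proof eventually_elim
        case (elim y)
        have "0 < d" using order.strict_trans2[OF h(1,2)] h(4) by (simp add: zero_less_mult_iff)
        then have "d * y0 \<le> d * y" using elim by simp
        then have "0 < y \<and> h \<le> d * y" using h elim by auto
        then show ?case
          using h0 by (intro nn_integral_seg_pairs_le) (auto simp: jump_commute case_prod_unfold)
      qed
    qed
    show "(\<integral>\<^sup>+x. \<integral>\<^sup>+y. \<integral>\<^sup>+y'. jump E (Complex x y) (Complex x y') \<partial>?J \<partial>?J \<partial>?I) \<le>
      (\<integral>\<^sup>+x. 2 * (\<integral>\<^sup>+y. ennreal y * (\<integral>\<^sup>+s. jump E (Complex x y) (Complex x (y + s * y)) * indicator {0..d} s \<partial>lborel) \<partial>?J) \<partial>?I)"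
    proof (rule nn_integral_mono)
      fix x
      have "0 < y \<and> h \<le> d * y" if "y \<in> {y0..<y0 + h}" for y
      proof -
        have "0 < d" using order.strict_trans2[OF h(1,2)] h(4) by (simp add: zero_less_mult_iff)
        then have "d * y0 \<le> d * y" using that by simp
        then show ?thesis using h that by auto
      qed
      then show "(\<integral>\<^sup>+y. \<integral>\<^sup>+y'. jump E (Complex x y) (Complex x y') \<partial>?J \<partial>?J) \<le>
        2 * (\<integral>\<^sup>+y. ennreal y * (\<integral>\<^sup>+s. jump E (Complex x y) (Complex x (y + s * y)) * indicator {0..d} s \<partial>lborel) \<partial>?J)"
        using h0 by (intro nn_integral_seg_pairs_le) (auto simp: jump_commute case_prod_unfold)
    qed
  qed simp_all
  also have "(\<integral>\<^sup>+x. 2 * (\<integral>\<^sup>+y. ennreal y * (\<integral>\<^sup>+s. jump E (Complex x y) (Complex x (y + s * y)) * indicator {0..d} s \<partial>lborel) \<partial>?J) \<partial>?I) =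
      2 * (\<integral>\<^sup>+y. \<integral>\<^sup>+x. ennreal y * (\<integral>\<^sup>+s. jump E (Complex x y) (Complex x (y + s * y)) * indicator {0..d} s \<partial>lborel) \<partial>?I \<partial>?J)"
    by (subst nn_integral_cmult, measurable)
       (rule arg_cong[where f = "\<lambda>x. 2 * x"], intro nn_integral_seg_swap h0, simp add: case_prod_unfold, measurable)
  also have "(\<integral>\<^sup>+y. 2 * (\<integral>\<^sup>+x. ennreal y * (\<integral>\<^sup>+s. jump E (Complex x y) (Complex (x + s * y) y) * indicator {0..d} s \<partial>lborel) \<partial>?I) \<partial>?J) =
      2 * (\<integral>\<^sup>+y. \<integral>\<^sup>+x. ennreal y * (\<integral>\<^sup>+s. jump E (Complex x y) (Complex (x + s * y) y) * indicator {0..d} s \<partial>lborel) \<partial>?I \<partial>?J)"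
    by (rule nn_integral_cmult) measurable
  also have "ennreal h * (2 * (\<integral>\<^sup>+y. \<integral>\<^sup>+x. ennreal y * (\<integral>\<^sup>+s. jump E (Complex x y) (Complex (x + s * y) y) * indicator {0..d} s \<partial>lborel) \<partial>?I \<partial>?J)) +
      ennreal h * (2 * (\<integral>\<^sup>+y. \<integral>\<^sup>+x. ennreal y * (\<integral>\<^sup>+s. jump E (Complex x y) (Complex x (y + s * y)) * indicator {0..d} s \<partial>lborel) \<partial>?I \<partial>?J)) =
      ennreal h * (2 * (\<integral>\<^sup>+y. \<integral>\<^sup>+x. ennreal y * osc E d (Complex x y) \<partial>?I \<partial>?J))"
  proof -
    have "osc E d (Complex x y) = (\<integral>\<^sup>+s. jump E (Complex x y) (Complex (x + s * y) y) * indicator {0..d} s \<partial>lborel) +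
        (\<integral>\<^sup>+s. jump E (Complex x y) (Complex x (y + s * y)) * indicator {0..d} s \<partial>lborel)" for x y
      unfolding osc_def
      by (subst nn_integral_add[symmetric]; measurable?)
         (auto intro!: nn_integral_cong simp: plane_map_def jump_commute algebra_simps)
    then show ?thesis
      by (simp add: distrib_left nn_integral_add)
  qed
  \<comment> \<open>On the square \<open>y \<le> 2 y0\<close>, which allows passing to the density \<open>1 / y\<^sup>2\<close> of the hyperbolic area.\<close>
  also have "(\<integral>\<^sup>+y. \<integral>\<^sup>+x. ennreal y * osc E d (Complex x y) \<partial>?I \<partial>?J) \<le>
      (\<integral>\<^sup>+y. \<integral>\<^sup>+x. ennreal (8 * y0^3) * (ennreal (1 / y\<^sup>2) * osc E d (Complex x y)) \<partial>?I \<partial>?J)"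
  proof (rule nn_integral_mono_AE)
    show "AE y in ?J. (\<integral>\<^sup>+x. ennreal y * osc E d (Complex x y) \<partial>?I) \<le> (\<integral>\<^sup>+x. ennreal (8 * y0^3) * (ennreal (1 / y\<^sup>2) * osc E d (Complex x y)) \<partial>?I)"
      using AE_seg_measure
    proof eventually_elim
      case (elim y)
      have "d * y0 \<le> 1 * y0"
        using h by (intro mult_right_mono) auto
      then have y: "0 < y" "y \<le> 2 * y0"
        using elim h unfolding atLeastLessThan_iff by linarith+
      then have "y * y\<^sup>2 \<le> 8 * y0^3"
        using power_mono[of y "2 * y0" 3] by (simp add: power3_eq_cube power2_eq_square)
      then have "y \<le> 8 * y0^3 * (1 / y\<^sup>2)"
        using y by (simp add: field_simps)
      then have "ennreal y \<le> ennreal (8 * y0^3) * ennreal (1 / y\<^sup>2)"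
        using h by (subst ennreal_mult[symmetric]) (auto intro: ennreal_leI)
      then show ?case
        by (intro nn_integral_mono) (simp add: mult.assoc[symmetric] mult_right_mono)
    qed
  qed
  also have "\<dots> = ennreal (8 * y0^3) * (\<integral>\<^sup>+y. \<integral>\<^sup>+x. ennreal (1 / y\<^sup>2) * osc E d (Complex x y) \<partial>?I \<partial>?J)"
    by (simp add: nn_integral_cmult)
  also have "(\<integral>\<^sup>+y. \<integral>\<^sup>+x. ennreal (1 / y\<^sup>2) * osc E d (Complex x y) \<partial>?I \<partial>?J) =
      (\<integral>\<^sup>+z. ennreal (1 / (Im z)\<^sup>2) * osc E d z * indicator (square x0 y0 h) z \<partial>lborel)"
    by (subst nn_integral_square) auto
  also have "\<dots> = (\<integral>\<^sup>+z. osc E d z * indicator (square x0 y0 h) z \<partial>hypvol)"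
  proof -
    have "(\<integral>\<^sup>+z. osc E d z * indicator (square x0 y0 h) z \<partial>hypvol) =
        (\<integral>\<^sup>+z. indicator hyp_plane z * ennreal (1 / (Im z)\<^sup>2) * (osc E d z * indicator (square x0 y0 h) z) \<partial>lborel)"
      unfolding hypvol_def by (rule nn_integral_density) measurable
    also have "\<dots> = (\<integral>\<^sup>+z. ennreal (1 / (Im z)\<^sup>2) * osc E d z * indicator (square x0 y0 h) z \<partial>lborel)"
      using h by (intro nn_integral_cong) (auto simp: indicator_def square_def hyp_plane_def)
    finally show ?thesis by simp
  qed
  finally have "emeasure lborel (E \<inter> square x0 y0 h) * emeasure lborel (square x0 y0 h - E) \<le>
     ennreal h * (2 * (ennreal (8 * y0^3) * (\<integral>\<^sup>+z. osc E d z * indicator (square x0 y0 h) z \<partial>hypvol)))"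
    by (simp add: mult_left_mono)
  also have "\<dots> = (ennreal h * 2 * ennreal (8 * y0^3)) * (\<integral>\<^sup>+z. osc E d z * indicator (square x0 y0 h) z \<partial>hypvol)"
    by (simp only: mult.assoc)
  also have "ennreal h * 2 * ennreal (8 * y0^3) = ennreal (16 * h * y0^3)"
    using h by (simp add: ac_simps flip: ennreal_mult ennreal_numeral)
  finally show ?thesis .
qed

section \<open>Dyadic cells\<close>

text \<open>For each \<open>k\<close> the cells with \<open>2 ^ k \<le> b < 2 ^ (k + 1)\<close> tile the half-plane.  Their
  hyperbolic diameter is of order \<open>2\<^sup>-\<^sup>k\<close>, and the isometry \<open>z \<mapsto> 2\<^sup>e(z + a)\<close> carries the cell with indices
  \<open>(0, 0, b)\<close> to the one with indices \<open>(e, a, b)\<close>.\<close>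

definition cell :: "int \<Rightarrow> int \<Rightarrow> nat \<Rightarrow> complex set" where
  "cell e a b = square (2 powr e * a) (2 powr e * b) (2 powr e)"

definition level :: "nat \<Rightarrow> (int \<times> int \<times> nat) set" where
  "level k = {(e, a, b). 2 ^ k \<le> b \<and> b < 2 ^ Suc k}"

abbreviation cell' :: "int \<times> int \<times> nat \<Rightarrow> complex set" where
  "cell' q \<equiv> cell (fst q) (fst (snd q)) (snd (snd q))"

lemma cell_borel [measurable, simp]: "cell e a b \<in> sets borel"
  by (simp add: cell_def)

lemma mem_cell_floor: "z \<in> cell e a b \<longleftrightarrow> a = \<lfloor>Re z / 2 powr e\<rfloor> \<and> int b = \<lfloor>Im z / 2 powr e\<rfloor>"
proof -
  have "x \<in> {2 powr e * c..<2 powr e * c + 2 powr e} \<longleftrightarrow> of_int c = \<lfloor>x / 2 powr e\<rfloor>" for x and c :: int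
    by (subst eq_commute, subst floor_eq_iff) (auto simp: field_simps)
  from this[of _ a] this[of _ "int b"] show ?thesis
    by (simp add: cell_def square_def)
qed

lemma mem_cell_iff:
  assumes "z \<in> hyp_plane" "(e, a, b) \<in> level k"
  shows "z \<in> cell e a b \<longleftrightarrow> e = \<lfloor>log 2 (Im z)\<rfloor> - int k \<and> a = \<lfloor>Re z / 2 powr e\<rfloor> \<and> int b = \<lfloor>Im z / 2 powr e\<rfloor>"
proof -
  have "e = \<lfloor>log 2 (Im z)\<rfloor> - int k" if b: "int b = \<lfloor>Im z / 2 powr e\<rfloor>"
  proof -
    have y: "0 < Im z" using assms by (simp add: hyp_plane_def)
    have "real b * 2 powr e \<le> Im z" "Im z < (real b + 1) * 2 powr e"
      using b[symmetric] unfolding floor_eq_iff by (auto simp: field_simps)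
    moreover have "real (2 ^ k) * 2 powr e \<le> real b * 2 powr e" "(real b + 1) * 2 powr e \<le> real (2 ^ Suc k) * 2 powr e"
    proof -
      have "2 ^ k \<le> b" "b + 1 \<le> 2 ^ Suc k" using assms(2) by (auto simp: level_def)
      then have "real (2 ^ k) \<le> real b" "real (b + 1) \<le> real (2 ^ Suc k)"
        by (simp_all only: of_nat_le_iff)
      then show "real (2 ^ k) * 2 powr e \<le> real b * 2 powr e" "(real b + 1) * 2 powr e \<le> real (2 ^ Suc k) * 2 powr e"
        by (intro mult_right_mono; simp)+
    qed
    moreover have "real (2 ^ k) * 2 powr e = 2 powr (e + int k)" "real (2 ^ Suc k) * 2 powr e = 2 powr (e + int k + 1)"
      by (simp_all add: powr_add powr_realpow)
    ultimately have "2 powr (e + int k) \<le> Im z" "Im z < 2 powr (e + int k + 1)"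
      by linarith+
    then have "\<lfloor>log 2 (Im z)\<rfloor> = e + int k"
      using y by (subst floor_log_eq_powr_iff) auto
    then show ?thesis by simp
  qed
  then show ?thesis
    by (auto simp: mem_cell_floor)
qed

lemma disjoint_cells: "disjoint_family_on (\<lambda>q. cell' q) (level k)"
proof (unfold disjoint_family_on_def, intro ballI impI)
  fix q q' assume q: "q \<in> level k" "q' \<in> level k" "q \<noteq> q'"
  have pos: "z \<in> hyp_plane" if "z \<in> cell' q" for z
  proof -
    have "0 < b" if "2 ^ k \<le> (b::nat)" for b
      using that by (rule order.strict_trans2[rotated]) simp
    then have "0 < snd (snd q)"
      using q(1) by (auto simp: level_def)
    then have "0 < 2 powr (fst q) * real (snd (snd q))" by simp
    then show ?thesis
      using that by (auto simp: cell_def square_def hyp_plane_def)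
  qed
  show "cell' q \<inter> cell' q' = {}"
  proof (rule ccontr)
    assume "cell' q \<inter> cell' q' \<noteq> {}"
    then obtain z where z: "z \<in> cell' q" "z \<in> cell' q'" by blast
    have "z \<in> hyp_plane" using pos z by blast
    with z q(1,2) have "fst q = fst q'" "fst (snd q) = fst (snd q')" "int (snd (snd q)) = int (snd (snd q'))"
      using mem_cell_iff[of z "fst q" "fst (snd q)" "snd (snd q)" k]
        mem_cell_iff[of z "fst q'" "fst (snd q')" "snd (snd q')" k] by auto
    then show False
      using q(3) by (auto simp: prod_eq_iff)
  qed
qed

lemma cells_cover:
  assumes "z \<in> hyp_plane"
  obtains e a b where "(e, a, b) \<in> level k" "z \<in> cell e a b"
proof -
  define e where "e = \<lfloor>log 2 (Im z)\<rfloor> - int k"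
  define b where "b = nat \<lfloor>Im z / 2 powr e\<rfloor>"
  have y: "0 < Im z" using assms by (simp add: hyp_plane_def)
  have "2 powr \<lfloor>log 2 (Im z)\<rfloor> \<le> Im z" "Im z < 2 powr (\<lfloor>log 2 (Im z)\<rfloor> + 1)"
    using floor_log_eq_powr_iff[OF y, of 2 "\<lfloor>log 2 (Im z)\<rfloor>"] by auto
  moreover have "2 powr \<lfloor>log 2 (Im z)\<rfloor> = 2 ^ k * 2 powr e" "2 powr (\<lfloor>log 2 (Im z)\<rfloor> + 1) = 2 ^ Suc k * 2 powr e"
    by (simp_all add: e_def powr_diff powr_add powr_realpow)
  ultimately have "2 ^ k \<le> Im z / 2 powr e" "Im z / 2 powr e < 2 ^ Suc k"
    by (simp_all add: field_simps)
  then have fl: "2 ^ k \<le> \<lfloor>Im z / 2 powr e\<rfloor>" "\<lfloor>Im z / 2 powr e\<rfloor> < 2 ^ Suc k"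
    by (simp_all add: le_floor_iff floor_less_iff)
  have "(0::int) \<le> 2 ^ k" by simp
  with fl(1) have "0 \<le> \<lfloor>Im z / 2 powr e\<rfloor>" by linarith
  then have b: "int b = \<lfloor>Im z / 2 powr e\<rfloor>"
    by (simp add: b_def)
  then have "int (2 ^ k) \<le> int b" "int b < int (2 ^ Suc k)"
    using fl by simp_all
  then have "(e, \<lfloor>Re z / 2 powr e\<rfloor>, b) \<in> level k"
    unfolding level_def of_nat_le_iff of_nat_less_iff by simp
  with b show ?thesis
    by (intro that[of e _ b]) (simp_all add: mem_cell_floor)
qed

text \<open>A compact exhaustion of the half-plane.\<close>

definition hbox :: "nat \<Rightarrow> complex set" where
  "hbox r = {z. \<bar>Re z\<bar> \<le> Suc r \<and> 1 / Suc r \<le> Im z \<and> Im z \<le> Suc r}"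

lemma hbox_subset_hyp_plane: "hbox r \<subseteq> hyp_plane"
proof
  fix z assume "z \<in> hbox r"
  then have "1 / Suc r \<le> Im z" by (simp add: hbox_def)
  moreover have "0 < 1 / real (Suc r)" by simp
  ultimately show "z \<in> hyp_plane"
    unfolding hyp_plane_def mem_Collect_eq by linarith
qed

lemma compact_hbox: "compact (hbox r)"
proof -
  have "hbox r = cbox (Complex (- Suc r) (1 / Suc r)) (Complex (Suc r) (Suc r))"
    by (auto simp: hbox_def in_cbox_complex_iff)
  then show ?thesis by simp
qed

lemma hbox_borel [measurable, simp]: "hbox r \<in> sets borel"
  by (intro borel_compact compact_hbox)

lemma emeasure_hbox: "emeasure hypvol (hbox r) < \<infinity>"
  by (rule emeasure_hypvol_compact[OF compact_hbox hbox_subset_hyp_plane])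

lemma hbox_mono: "r \<le> s \<Longrightarrow> hbox r \<subseteq> hbox s"
proof
  fix z assume r: "r \<le> s" "z \<in> hbox r"
  have "1 / real (Suc s) \<le> 1 / real (Suc r)"
    using r(1) by (intro divide_left_mono) auto
  with r show "z \<in> hbox s"
    unfolding hbox_def by auto
qed

lemma compact_subset_hbox:
  assumes "compact K" "K \<subseteq> hyp_plane"
  obtains r where "K \<subseteq> hbox r"
proof (cases "K = {}")
  case False
  obtain p where p: "p \<in> K" "\<And>q. q \<in> K \<Longrightarrow> Im p \<le> Im q"
    using continuous_attains_inf[OF assms(1) False continuous_on_Im[OF continuous_on_id]] by auto
  obtain B where B: "\<And>q. q \<in> K \<Longrightarrow> norm q \<le> B"
    using compact_imp_bounded[OF assms(1)] by (auto simp: bounded_iff)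
  have y: "0 < Im p" using p assms by (auto simp: hyp_plane_def)
  obtain r :: nat where r: "max B (1 / Im p) \<le> real r"
    using real_arch_simple by blast
  have "z \<in> hbox r" if z: "z \<in> K" for z
  proof -
    have "1 / Im p \<le> Suc r" using r by simp
    then have "1 / Suc r \<le> Im p"
      using y by (simp add: field_simps)
    moreover have "\<bar>Re z\<bar> \<le> Suc r" "Im z \<le> Suc r"
      using B[OF z] abs_Re_le_cmod[of z] abs_Im_le_cmod[of z] r by auto
    ultimately show ?thesis
      using p(2)[OF z] by (auto simp: hbox_def)
  qed
  then show ?thesis using that by blast
qed (use that in blast)

lemma finite_cells_hbox: "finite {q \<in> level k. cell' q \<inter> hbox r \<noteq> {}}"
proof (rule finite_subset)
  let ?R = "real (Suc r)"
  let ?S = "SIGMA e : {\<lfloor>log 2 (1 / ?R)\<rfloor> - int k..\<lfloor>log 2 ?R\<rfloor> - int k}.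
    {\<lfloor>- ?R / 2 powr e\<rfloor>..\<lfloor>?R / 2 powr e\<rfloor>} \<times> {..<(2::nat) ^ Suc k}"
  show "{q \<in> level k. cell' q \<inter> hbox r \<noteq> {}} \<subseteq> ?S"
  proof (rule subsetI)
    fix q assume "q \<in> {q \<in> level k. cell' q \<inter> hbox r \<noteq> {}}"
    moreover obtain e a b where qe: "q = (e, a, b)" by (cases q) auto
    ultimately have q: "(e, a, b) \<in> level k" "cell' (e, a, b) \<inter> hbox r \<noteq> {}" by auto
    then obtain z where z: "z \<in> cell e a b" "z \<in> hbox r" by auto
    have zh: "z \<in> hyp_plane" using z hbox_subset_hyp_plane by blast
    then have y: "0 < Im z" by (simp add: hyp_plane_def)
    have b: "\<bar>Re z\<bar> \<le> ?R" "1 / ?R \<le> Im z" "Im z \<le> ?R"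
      using z(2) by (auto simp: hbox_def)
    have e: "e = \<lfloor>log 2 (Im z)\<rfloor> - int k" "a = \<lfloor>Re z / 2 powr e\<rfloor>"
      using mem_cell_iff[OF zh q(1)] z(1) by auto
    have "\<lfloor>log 2 (1 / ?R)\<rfloor> \<le> \<lfloor>log 2 (Im z)\<rfloor>" "\<lfloor>log 2 (Im z)\<rfloor> \<le> \<lfloor>log 2 ?R\<rfloor>"
      using b y by (intro floor_mono; subst log_le_cancel_iff; simp)+
    moreover have "- ?R / 2 powr e \<le> Re z / 2 powr e" "Re z / 2 powr e \<le> ?R / 2 powr e"
      using b(1) by (intro divide_right_mono; simp add: abs_le_iff)+
    ultimately show "q \<in> ?S"
      using e(1) q(1) unfolding qe e(2) by (auto simp: level_def intro!: floor_mono)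
  qed
  show "finite ?S" by (intro finite_SigmaI finite_cartesian_product) auto
qed

subsection \<open>Oscillation in the cells\<close>

abbreviation scale :: "nat \<Rightarrow> real" where
  "scale k \<equiv> 1 / 2 ^ k"

lemma cell_isoperimetric:
  assumes E: "E \<in> sets borel" and q: "(e, a, b) \<in> level k"
  shows "emeasure lborel (E \<inter> cell e a b) * emeasure lborel (cell e a b - E) \<le>
    ennreal (16 * 2 powr e * (2 powr e * b)^3) * (\<integral>\<^sup>+z. osc E (scale k) z * indicator (cell e a b) z \<partial>hypvol)"
  unfolding cell_def
proof (rule square_isoperimetric[OF E])
  have "2 ^ k \<le> b" using q by (simp add: level_def)
  then have b: "(2::real) ^ k \<le> real b" by (metis of_nat_le_iff of_nat_numeral of_nat_power)
  show "2 powr e \<le> scale k * (2 powr e * b)"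
    using b by (simp add: field_simps)
  have "0 < real b" using b by (rule order.strict_trans2[rotated]) simp
  then show "0 < 2 powr e * real b" by simp
qed simp_all

definition osc_measure :: "complex set \<Rightarrow> nat \<Rightarrow> complex measure" where
  "osc_measure E k = density hypvol (osc E (scale k))"

lemma sets_osc_measure [simp, measurable_cong]: "sets (osc_measure E k) = sets borel"
  and space_osc_measure [simp]: "space (osc_measure E k) = UNIV"
  by (simp_all add: osc_measure_def)

lemma emeasure_osc_measure:
  assumes [measurable]: "E \<in> sets borel" "A \<in> sets borel"
  shows "emeasure (osc_measure E k) A = (\<integral>\<^sup>+z. osc E (scale k) z * indicator A z \<partial>hypvol)"
  unfolding osc_measure_def by (rule emeasure_density) auto

lemma emeasure_osc_measure_le:
  assumes E: "E \<in> sets hyp_measure" "perimeter E \<le> ennreal C" "0 \<le> C"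
  shows "emeasure (osc_measure E k) UNIV \<le> ennreal (2 * scale k * scale k * C)"
  using nn_integral_osc_le[OF E, of "scale k"] emeasure_osc_measure[of E UNIV k] E
  by (simp add: sets_hyp_measure)

lemma cell_isoperimetric_real:
  assumes E: "E \<in> sets hyp_measure" "perimeter E \<le> ennreal C" "0 \<le> C" and q: "(e, a, b) \<in> level k"
  shows "measure lborel (E \<inter> cell e a b) * measure lborel (cell e a b - E) / measure lborel (cell e a b) \<le>
    32 * 2 ^ k * (2 powr e * b)\<^sup>2 * measure (osc_measure E k) (cell e a b)"
proof -
  have Eb [measurable]: "E \<in> sets borel" using E by (simp add: sets_hyp_measure)
  have fin: "emeasure lborel A \<noteq> \<infinity>" if "A \<subseteq> cell e a b" "A \<in> sets borel" for A
    using emeasure_mono[OF that(1), of lborel] that(2)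
    by (auto simp: cell_def emeasure_square top_unique)
  have l: "emeasure lborel A = ennreal (measure lborel A)" if "A \<subseteq> cell e a b" "A \<in> sets borel" for A
    using fin[OF that] by (simp add: emeasure_eq_ennreal_measure)
  have "emeasure (osc_measure E k) (cell e a b) \<le> emeasure (osc_measure E k) UNIV"
    by (rule emeasure_mono) auto
  then have "emeasure (osc_measure E k) (cell e a b) \<noteq> \<infinity>"
    using emeasure_osc_measure_le[OF E, of k] by (auto simp: top_unique)
  then have o: "(\<integral>\<^sup>+z. osc E (scale k) z * indicator (cell e a b) z \<partial>hypvol) = ennreal (measure (osc_measure E k) (cell e a b))"
    by (simp add: emeasure_eq_ennreal_measure flip: emeasure_osc_measure)
  have "measure lborel (E \<inter> cell e a b) * measure lborel (cell e a b - E) \<le>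
      16 * 2 powr e * (2 powr e * b)^3 * measure (osc_measure E k) (cell e a b)"
    using cell_isoperimetric[OF Eb q]
    by (simp add: l o flip: ennreal_mult)
  also have "\<dots> \<le> 32 * 2 ^ k * (2 powr e * b)\<^sup>2 * measure (osc_measure E k) (cell e a b) * (2 powr e * 2 powr e)"
  proof -
    have "b \<le> 2 * 2 ^ k" using q by (simp add: level_def)
    then have "real b \<le> real (2 * 2 ^ k)" by (rule of_nat_mono)
    then have "(16 * 2 powr e * 2 powr e * (2 powr e * b)\<^sup>2 * measure (osc_measure E k) (cell e a b)) * real b \<le>
       (16 * 2 powr e * 2 powr e * (2 powr e * b)\<^sup>2 * measure (osc_measure E k) (cell e a b)) * real (2 * 2 ^ k)"
      by (rule mult_left_mono) simp
    then show ?thesis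
      by (simp add: power3_eq_cube power2_eq_square mult_ac)
  qed
  finally have "measure lborel (E \<inter> cell e a b) * measure lborel (cell e a b - E) \<le>
    32 * 2 ^ k * (2 powr e * b)\<^sup>2 * measure (osc_measure E k) (cell e a b) * (2 powr e * 2 powr e)" .
  moreover have "measure lborel (cell e a b) = 2 powr e * 2 powr e"
    by (simp add: measure_def cell_def emeasure_square)
  ultimately show ?thesis
    by (simp add: pos_divide_le_eq)
qed

text \<open>When at least half of the cell lies outside \<open>E\<close>, the isoperimetric inequality is a linear bound for
  the area of \<open>E\<close> in the cell.\<close>

lemma light_cell:
  assumes E: "E \<in> sets hyp_measure" "perimeter E \<le> ennreal C" "0 \<le> C" and q: "(e, a, b) \<in> level k"
    and light: "measure lborel (E \<inter> cell e a b) \<le> measure lborel (cell e a b) / 2"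
  shows "emeasure hypvol (E \<inter> cell e a b) \<le> ennreal (64 * 2 ^ k) * emeasure (osc_measure E k) (cell e a b)"
proof -
  have Eb [measurable]: "E \<in> sets borel" using E by (simp add: sets_hyp_measure)
  have fin: "emeasure lborel A \<noteq> \<infinity>" if "A \<subseteq> cell e a b" "A \<in> sets borel" for A
    using emeasure_mono[OF that(1), of lborel] that(2)
    by (auto simp: cell_def emeasure_square top_unique)
  define s where "s = measure lborel (cell e a b)"
  have s: "s > 0"
    by (simp add: s_def measure_def cell_def emeasure_square)
  have split: "measure lborel (E \<inter> cell e a b) + measure lborel (cell e a b - E) = s"
    unfolding s_def using fin
    by (subst measure_Union[symmetric]) (auto intro!: arg_cong[where f = "measure lborel"])
  have y: "0 < 2 powr e * b"
  proof -
    have "(0::nat) < 2 ^ k" "2 ^ k \<le> b" using q by (auto simp: level_def)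
    then have "0 < b" by linarith
    then show ?thesis by simp
  qed
  have "emeasure (osc_measure E k) (cell e a b) \<le> emeasure (osc_measure E k) UNIV"
    by (rule emeasure_mono) auto
  then have o: "emeasure (osc_measure E k) (cell e a b) = ennreal (measure (osc_measure E k) (cell e a b))"
    using emeasure_osc_measure_le[OF E, of k] by (intro emeasure_eq_ennreal_measure) (auto simp: top_unique)
  have "measure lborel (E \<inter> cell e a b) * (s / 2) \<le> measure lborel (E \<inter> cell e a b) * measure lborel (cell e a b - E)"
    using light split by (intro mult_left_mono) (auto simp: s_def)
  then have "measure lborel (E \<inter> cell e a b) / 2 \<le> measure lborel (E \<inter> cell e a b) * measure lborel (cell e a b - E) / s"
    using s by (simp add: field_simps)
  also have "\<dots> \<le> 32 * 2 ^ k * (2 powr e * b)\<^sup>2 * measure (osc_measure E k) (cell e a b)"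
    unfolding s_def by (rule cell_isoperimetric_real[OF E q])
  finally have *: "measure lborel (E \<inter> cell e a b) \<le> 64 * 2 ^ k * (2 powr e * b)\<^sup>2 * measure (osc_measure E k) (cell e a b)"
    by simp
  have "emeasure hypvol (E \<inter> cell e a b) \<le> ennreal (1 / (2 powr e * b)\<^sup>2) * emeasure lborel (E \<inter> cell e a b)"
    using y by (intro emeasure_hypvol_le) (auto simp: cell_def square_def)
  also have "\<dots> = ennreal (1 / (2 powr e * b)\<^sup>2 * measure lborel (E \<inter> cell e a b))"
  proof -
    have "emeasure lborel (E \<inter> cell e a b) = ennreal (measure lborel (E \<inter> cell e a b))"
      using fin[of "E \<inter> cell e a b"] by (intro emeasure_eq_ennreal_measure) auto
    then show ?thesis
      by (subst ennreal_mult) simp_all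
  qed
  also have "\<dots> \<le> ennreal (1 / (2 powr e * b)\<^sup>2 * (64 * 2 ^ k * (2 powr e * b)\<^sup>2 * measure (osc_measure E k) (cell e a b)))"
    by (intro ennreal_leI mult_left_mono *) simp
  also have "\<dots> = ennreal (64 * 2 ^ k * measure (osc_measure E k) (cell e a b))"
  proof -
    have "b \<noteq> 0"
    proof
      assume "b = 0"
      with y show False by simp
    qed
    then show ?thesis by simp
  qed
  also have "\<dots> = ennreal (64 * 2 ^ k) * emeasure (osc_measure E k) (cell e a b)"
    unfolding o by (rule ennreal_mult) auto
  finally show ?thesis .
qed

text \<open>This excludes vanishing: mass that nowhere fills half a cell of level \<open>k\<close> is small.\<close>

lemma light_cells:
  assumes E: "E \<in> sets hyp_measure" "perimeter E \<le> ennreal C" "0 \<le> C" and S: "S \<subseteq> level k"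
    and light: "\<And>q. q \<in> S \<Longrightarrow> measure lborel (E \<inter> cell' q) \<le> measure lborel (cell' q) / 2"
  shows "emeasure hypvol (E \<inter> (\<Union>q\<in>S. cell' q)) \<le> ennreal (128 * scale k * C)"
proof -
  have Eb [measurable]: "E \<in> sets borel" using E by (simp add: sets_hyp_measure)
  have disj: "disjoint_family_on (\<lambda>q. cell' q) S"
    using disjoint_cells S by (rule disjoint_family_on_mono[rotated])
  then have disj': "disjoint_family_on (\<lambda>q. E \<inter> cell' q) S"
    unfolding disjoint_family_on_def by blast
  have "emeasure hypvol (E \<inter> (\<Union>q\<in>S. cell' q)) = emeasure hypvol (\<Union>q\<in>S. E \<inter> cell' q)"
    by simp
  also have "\<dots> = (\<integral>\<^sup>+q. emeasure hypvol (E \<inter> cell' q) \<partial>count_space S)"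
    by (rule emeasure_UN_countable[OF _ _ disj']) auto
  also have "\<dots> \<le> (\<integral>\<^sup>+q. ennreal (64 * 2 ^ k) * emeasure (osc_measure E k) (cell' q) \<partial>count_space S)"
  proof (intro nn_integral_mono)
    fix q assume "q \<in> space (count_space S)"
    then have "q \<in> S" by simp
    then show "emeasure hypvol (E \<inter> cell' q) \<le> ennreal (64 * 2 ^ k) * emeasure (osc_measure E k) (cell' q)"
      using S by (intro light_cell[OF E] light) auto
  qed
  also have "\<dots> = ennreal (64 * 2 ^ k) * (\<integral>\<^sup>+q. emeasure (osc_measure E k) (cell' q) \<partial>count_space S)"
    by (rule nn_integral_cmult) simp
  also have "(\<integral>\<^sup>+q. emeasure (osc_measure E k) (cell' q) \<partial>count_space S) = emeasure (osc_measure E k) (\<Union>q\<in>S. cell' q)"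
    by (rule emeasure_UN_countable[OF _ _ disj, symmetric]) auto
  also have "\<dots> \<le> emeasure (osc_measure E k) UNIV"
    by (rule emeasure_mono) auto
  also have "\<dots> \<le> ennreal (2 * scale k * scale k * C)"
    by (rule emeasure_osc_measure_le[OF E])
  finally have "emeasure hypvol (E \<inter> (\<Union>q\<in>S. cell' q)) \<le> ennreal (64 * 2 ^ k) * ennreal (2 * scale k * scale k * C)"
    by (simp add: mult_left_mono)
  also have "\<dots> = ennreal (128 * scale k * C)"
    using E(3) by (subst ennreal_mult[symmetric]) auto
  finally show ?thesis .
qed

section \<open>Compactness of sets of bounded perimeter\<close>

text \<open>Convergence of the indicator functions in \<open>L\<^sup>1\<^sub>l\<^sub>o\<^sub>c\<close>.\<close>

definition loc_conv :: "(nat \<Rightarrow> complex set) \<Rightarrow> complex set \<Rightarrow> bool" where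
  "loc_conv A B \<longleftrightarrow> (\<forall>r. (\<lambda>n. measure hypvol (sym_diff (A n) B \<inter> hbox r)) \<longlonglongrightarrow> 0)"

lemma fmeasurable_inter_hbox [simp]:
  assumes "A \<in> sets borel"
  shows "A \<inter> hbox r \<in> fmeasurable hypvol"
proof (rule fmeasurableI2[of "hbox r"])
  show "hbox r \<in> fmeasurable hypvol"
    by (rule fmeasurableI) (simp_all add: emeasure_hbox[simplified])
qed (use assms in auto)

lemma measure_inter_hbox_mono:
  "A \<subseteq> B \<Longrightarrow> A \<in> sets borel \<Longrightarrow> B \<in> sets borel \<Longrightarrow> r \<le> s \<Longrightarrow> measure hypvol (A \<inter> hbox r) \<le> measure hypvol (B \<inter> hbox s)"
  using hbox_mono[of r s] by (intro measure_mono_fmeasurable) auto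

lemma measure_sym_diff_triangle:
  assumes "A \<in> sets borel" "B \<in> sets borel" "C \<in> sets borel"
  shows "measure hypvol (sym_diff A C \<inter> hbox r) \<le> measure hypvol (sym_diff A B \<inter> hbox r) + measure hypvol (sym_diff B C \<inter> hbox r)"
proof -
  have "measure hypvol (sym_diff A C \<inter> hbox r) \<le> measure hypvol ((sym_diff A B \<inter> hbox r) \<union> (sym_diff B C \<inter> hbox r))"
    using assms by (intro measure_mono_fmeasurable) (auto intro!: fmeasurable.Un)
  also have "\<dots> \<le> measure hypvol (sym_diff A B \<inter> hbox r) + measure hypvol (sym_diff B C \<inter> hbox r)"
    using assms by (intro measure_Un_le) auto
  finally show ?thesis .
qed

text \<open>A subsequence whose consecutive differences have summable areas on the boxes converges almost
  everywhere, by Borel--Cantelli; its pointwise limit is the limit of the whole sequence.\<close>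

lemma loc_conv_complete:
  assumes A: "\<And>n. A n \<in> sets hyp_measure"
    and cauchy: "\<And>r \<epsilon>. 0 < \<epsilon> \<Longrightarrow> \<exists>N. \<forall>m\<ge>N. \<forall>n\<ge>N. measure hypvol (sym_diff (A m) (A n) \<inter> hbox r) < \<epsilon>"
  shows "\<exists>B\<in>sets hyp_measure. loc_conv A B"
proof -
  have Ab [measurable]: "A n \<in> sets borel" and Ah: "A n \<subseteq> hyp_plane" for n
    using A by (auto simp: sets_hyp_measure)
  have "\<exists>N. \<forall>m\<ge>N. \<forall>n\<ge>N. measure hypvol (sym_diff (A m) (A n) \<inter> hbox k) < (1 / 2) ^ k" for k
    by (rule cauchy) simp
  then obtain N where N: "\<And>k m n. N k \<le> m \<Longrightarrow> N k \<le> n \<Longrightarrow> measure hypvol (sym_diff (A m) (A n) \<inter> hbox k) < (1 / 2) ^ k"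
    by metis
  \<comment> \<open>A strictly increasing sequence with \<open>N k \<le> \<rho> k\<close>.\<close>
  define \<rho> where "\<rho> k = (\<Sum>j\<le>k. Suc (N j))" for k
  have \<rho>N: "N k \<le> \<rho> k" for k
    unfolding \<rho>_def by (rule order_trans[OF _ member_le_sum[of k]]) auto
  have \<rho>mono: "strict_mono \<rho>"
    by (rule strict_monoI_Suc) (simp add: \<rho>_def)
  define B where "B = {z \<in> space borel. \<exists>K. \<forall>k\<ge>K. z \<in> A (\<rho> k)}"
  have Bb [measurable]: "B \<in> sets borel"
    unfolding B_def by measurable
  have "B \<subseteq> hyp_plane"
    using Ah by (auto simp: B_def)
  have sub: "(\<lambda>k. measure hypvol (sym_diff (A (\<rho> k)) B \<inter> hbox r)) \<longlonglongrightarrow> 0" for r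
  proof -
    define S where "S k = sym_diff (A (\<rho> (k + r))) (A (\<rho> (Suc (k + r)))) \<inter> hbox r" for k
    have Sm: "measure hypvol (S k) \<le> (1 / 2) ^ k" for k
    proof -
      have "measure hypvol (S k) \<le> measure hypvol (sym_diff (A (\<rho> (k + r))) (A (\<rho> (Suc (k + r)))) \<inter> hbox (k + r))"
        unfolding S_def by (rule measure_inter_hbox_mono) auto
      also have "\<dots> < (1 / 2) ^ (k + r)"
        using \<rho>N[of "k + r"] strict_monoD[OF \<rho>mono, of "k + r" "Suc (k + r)"] by (intro N) auto
      also have "\<dots> \<le> (1 / 2) ^ k"
        by (rule power_decreasing) auto
      finally show ?thesis by simp
    qed
    have "AE z in hypvol. eventually (\<lambda>k. z \<in> space hypvol - S k) sequentially"
    proof (rule borel_cantelli_AE1)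
      show "S k \<in> sets hypvol" for k unfolding S_def by measurable
      show "emeasure hypvol (S k) < \<infinity>" for k
      proof -
        have "S k \<in> fmeasurable hypvol" unfolding S_def by (intro fmeasurable_inter_hbox) measurable
        then show ?thesis by (simp add: fmeasurable_def)
      qed
      show "summable (\<lambda>k. measure hypvol (S k))"
        by (rule summable_comparison_test'[of "\<lambda>k. (1 / 2) ^ k" 0]) (use Sm in \<open>auto simp: summable_geometric\<close>)
    qed
    then have ev: "AE z in hypvol. z \<in> hbox r \<longrightarrow> eventually (\<lambda>k. z \<in> A (\<rho> k) \<longleftrightarrow> z \<in> B) sequentially"
    proof eventually_elim
      case (elim z)
      show ?case
      proof
        assume z: "z \<in> hbox r"
        obtain K where K: "\<And>k. K \<le> k \<Longrightarrow> z \<notin> S k"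
          using elim by (auto simp: eventually_sequentially)
        have step: "z \<in> A (\<rho> (Suc k)) \<longleftrightarrow> z \<in> A (\<rho> k)" if "K + r \<le> k" for k
          using K[of "k - r"] that z by (auto simp: S_def)
        have const: "z \<in> A (\<rho> k) \<longleftrightarrow> z \<in> A (\<rho> (K + r))" if "K + r \<le> k" for k
          using that by (induction k rule: dec_induct) (auto simp: step)
        have "z \<in> B \<longleftrightarrow> z \<in> A (\<rho> (K + r))"
        proof
          assume "z \<in> B"
          then obtain K' where "\<And>k. K' \<le> k \<Longrightarrow> z \<in> A (\<rho> k)" by (auto simp: B_def)
          from this[of "max K' (K + r)"] show "z \<in> A (\<rho> (K + r))"
            using const[of "max K' (K + r)"] by simp
        next
          assume "z \<in> A (\<rho> (K + r))"
          then have "\<forall>k\<ge>K + r. z \<in> A (\<rho> k)"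
            using const by blast
          then show "z \<in> B"
            by (auto simp: B_def)
        qed
        then show "eventually (\<lambda>k. z \<in> A (\<rho> k) \<longleftrightarrow> z \<in> B) sequentially"
          unfolding eventually_sequentially using const by blast
      qed
    qed
    have "(\<lambda>k. \<integral>z. indicator (sym_diff (A (\<rho> k)) B \<inter> hbox r) z \<partial>hypvol) \<longlonglongrightarrow> (\<integral>z. 0 \<partial>hypvol :: real)"
    proof (rule integral_dominated_convergence[where w = "indicator (hbox r)"])
      show "integrable hypvol (indicator (hbox r) :: complex \<Rightarrow> real)"
        using emeasure_hbox[of r] by (intro integrable_real_indicator) auto
      show "AE z in hypvol. (\<lambda>k. indicator (sym_diff (A (\<rho> k)) B \<inter> hbox r) z :: real) \<longlonglongrightarrow> 0"
        using ev
      proof eventually_elim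
        case (elim z)
        show ?case
        proof (cases "z \<in> hbox r")
          case True
          with elim have "eventually (\<lambda>k. z \<in> A (\<rho> k) \<longleftrightarrow> z \<in> B) sequentially" by blast
          then have "eventually (\<lambda>k. indicator (sym_diff (A (\<rho> k)) B \<inter> hbox r) z = (0::real)) sequentially"
            by eventually_elim (auto simp: indicator_def)
          then show ?thesis by (rule tendsto_eventually)
        qed simp
      qed
      show "AE z in hypvol. norm (indicator (sym_diff (A (\<rho> k)) B \<inter> hbox r) z :: real) \<le> indicator (hbox r) z" for k
        by (intro AE_I2) (auto simp: indicator_def)
    qed measurable
    then show ?thesis by simp
  qed
  have "loc_conv A B"
    unfolding loc_conv_def
  proof (intro allI LIMSEQ_I)
    fix r and \<epsilon> :: real assume \<epsilon>: "0 < \<epsilon>"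
    obtain M where M: "\<And>m n. M \<le> m \<Longrightarrow> M \<le> n \<Longrightarrow> measure hypvol (sym_diff (A m) (A n) \<inter> hbox r) < \<epsilon> / 2"
      using cauchy[of "\<epsilon> / 2" r] \<epsilon> by (meson half_gt_zero)
    obtain K where K: "\<And>k. K \<le> k \<Longrightarrow> measure hypvol (sym_diff (A (\<rho> k)) B \<inter> hbox r) < \<epsilon> / 2"
      using LIMSEQ_D[OF sub[of r], of "\<epsilon> / 2"] \<epsilon> by (auto simp: abs_less_iff)
    define k where "k = max K M"
    have "M \<le> \<rho> k"
      using seq_suble[OF \<rho>mono, of k] by (simp add: k_def)
    show "\<exists>n0. \<forall>n\<ge>n0. norm (measure hypvol (sym_diff (A n) B \<inter> hbox r) - 0) < \<epsilon>"
    proof (intro exI allI impI)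
      fix n assume "M \<le> n"
      have "measure hypvol (sym_diff (A n) B \<inter> hbox r) \<le>
          measure hypvol (sym_diff (A n) (A (\<rho> k)) \<inter> hbox r) + measure hypvol (sym_diff (A (\<rho> k)) B \<inter> hbox r)"
        by (rule measure_sym_diff_triangle) measurable
      also have "\<dots> < \<epsilon> / 2 + \<epsilon> / 2"
        using \<open>M \<le> n\<close> \<open>M \<le> \<rho> k\<close> by (intro add_strict_mono M K) (auto simp: k_def)
      finally show "norm (measure hypvol (sym_diff (A n) B \<inter> hbox r) - 0) < \<epsilon>"
        by simp
    qed
  qed
  moreover have "B \<in> sets hyp_measure"
    using Bb \<open>B \<subseteq> hyp_plane\<close> by (simp add: sets_hyp_measure)
  ultimately show ?thesis by blast
qed

lemma sym_diff_cell_le: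
  fixes x y z w s :: real
  assumes "0 \<le> x" "0 \<le> y" "0 \<le> z" "0 \<le> w" and s: "s = x + y + z + w" "0 < s"
  shows "y + z \<le> 2 * ((x + y) * (z + w) / s) + 2 * ((x + z) * (y + w) / s) + \<bar>y - z\<bar>"
proof -
  have "(y - z) * (y - z) \<le> \<bar>y - z\<bar> * s"
  proof -
    have "(y - z) * (y - z) = \<bar>y - z\<bar> * \<bar>y - z\<bar>" by simp
    also have "\<dots> \<le> \<bar>y - z\<bar> * s" using assms by (intro mult_left_mono) auto
    finally show ?thesis .
  qed
  moreover have "0 \<le> x * y" "0 \<le> x * z" "0 \<le> x * w" "0 \<le> y * z" "0 \<le> y * w" "0 \<le> z * w"
    using assms by auto
  ultimately have "(y + z) * s \<le> 2 * ((x + y) * (z + w)) + 2 * ((x + z) * (y + w)) + \<bar>y - z\<bar> * s"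
    unfolding s(1) by (simp add: algebra_simps)
  then have "(y + z) * s / s \<le> (2 * ((x + y) * (z + w)) + 2 * ((x + z) * (y + w)) + \<bar>y - z\<bar> * s) / s"
    using s(2) by (intro divide_right_mono) auto
  then show ?thesis
    using s(2) by (simp add: add_divide_distrib)
qed

lemma fmeasurable_cell: "cell e a b \<in> fmeasurable lborel"
  by (rule fmeasurableI) (simp_all add: cell_def emeasure_square)

text \<open>In one cell, two sets differ little if each of them nearly fills or nearly misses the cell and
  their areas there are close.\<close>

lemma sym_diff_cell:
  assumes A: "A \<in> sets hyp_measure" "perimeter A \<le> ennreal C" and B: "B \<in> sets hyp_measure" "perimeter B \<le> ennreal C"
    and C: "0 \<le> C" and q: "(e, a, b) \<in> level k" and R: "2 powr e * b \<le> R"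
  shows "measure lborel (sym_diff A B \<inter> cell e a b) \<le>
    64 * 2 ^ k * R\<^sup>2 * (measure (osc_measure A k) (cell e a b) + measure (osc_measure B k) (cell e a b)) +
    \<bar>measure lborel (A \<inter> cell e a b) - measure lborel (B \<inter> cell e a b)\<bar>"
proof -
  have Ab [measurable]: "A \<in> sets borel" "B \<in> sets borel" using A B by (auto simp: sets_hyp_measure)
  let ?Q = "cell e a b"
  have fm: "X \<in> fmeasurable lborel" if "X \<subseteq> ?Q" "X \<in> sets borel" for X
    by (rule fmeasurableI2[OF fmeasurable_cell that(1)]) (use that in simp)
  have add: "measure lborel (X \<union> Y) = measure lborel X + measure lborel Y"
    if "X \<inter> Y = {}" "X \<subseteq> ?Q" "Y \<subseteq> ?Q" "X \<in> sets borel" "Y \<in> sets borel" for X Y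
    using fm[of X] fm[of Y] that by (intro measure_Union) (auto simp: fmeasurable_def)
  define x where "x = measure lborel (A \<inter> B \<inter> ?Q)"
  define y where "y = measure lborel ((A - B) \<inter> ?Q)"
  define z where "z = measure lborel ((B - A) \<inter> ?Q)"
  define w where "w = measure lborel (?Q - (A \<union> B))"
  have 1: "measure lborel (A \<inter> ?Q) = x + y"
    unfolding x_def y_def by (subst add[symmetric]) (auto intro: arg_cong[where f = "measure lborel"])
  have 2: "measure lborel (B \<inter> ?Q) = x + z"
    unfolding x_def z_def by (subst add[symmetric]) (auto intro: arg_cong[where f = "measure lborel"])
  have 3: "measure lborel (?Q - A) = z + w"
    unfolding z_def w_def by (subst add[symmetric]) (auto intro: arg_cong[where f = "measure lborel"])
  have 4: "measure lborel (?Q - B) = y + w"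
    unfolding y_def w_def by (subst add[symmetric]) (auto intro: arg_cong[where f = "measure lborel"])
  have 5: "measure lborel (sym_diff A B \<inter> ?Q) = y + z"
    unfolding y_def z_def by (subst add[symmetric]) (auto intro: arg_cong[where f = "measure lborel"])
  have 6: "measure lborel ?Q = x + y + z + w"
  proof -
    have "measure lborel ?Q = measure lborel (A \<inter> ?Q) + measure lborel (?Q - A)"
      by (subst add[symmetric]) (auto intro: arg_cong[where f = "measure lborel"])
    then show ?thesis by (simp add: 1 3)
  qed
  have pos: "0 < measure lborel ?Q"
    by (simp add: measure_def cell_def emeasure_square)
  have isoq: "measure lborel (E \<inter> ?Q) * measure lborel (?Q - E) / measure lborel ?Q \<le>
      32 * 2 ^ k * R\<^sup>2 * measure (osc_measure E k) ?Q" if E: "E \<in> sets hyp_measure" "perimeter E \<le> ennreal C" for E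
  proof (rule order_trans[OF cell_isoperimetric_real[OF E C q]])
    show "32 * 2 ^ k * (2 powr e * b)\<^sup>2 * measure (osc_measure E k) ?Q \<le> 32 * 2 ^ k * R\<^sup>2 * measure (osc_measure E k) ?Q"
      using R by (intro mult_right_mono mult_left_mono power_mono) auto
  qed
  have "y + z \<le> 2 * ((x + y) * (z + w) / measure lborel ?Q) + 2 * ((x + z) * (y + w) / measure lborel ?Q) + \<bar>y - z\<bar>"
    by (rule sym_diff_cell_le) (use pos 6 in \<open>auto simp: x_def y_def z_def w_def\<close>)
  moreover have "\<bar>x + y - (x + z)\<bar> = \<bar>y - z\<bar>" by simp
  ultimately show ?thesis
    using isoq[OF A] isoq[OF B] unfolding 5 1 2 3 4 distrib_left[of "64 * 2 ^ k * R\<^sup>2"] by linarith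
qed

text \<open>On the cells of level \<open>k\<close> all the sets differ from constants by \<open>O(2\<^sup>-\<^sup>k)\<close>, uniformly in
  \<open>n\<close>, and the constants converge.\<close>

lemma loc_conv_compact:
  assumes A: "\<And>n. A n \<in> sets hyp_measure" "\<And>n. perimeter (A n) \<le> ennreal C" and C: "0 \<le> C"
    and conv: "\<And>e a b. convergent (\<lambda>n. measure lborel (A n \<inter> cell e a b))"
  shows "\<exists>B\<in>sets hyp_measure. loc_conv A B"
proof (rule loc_conv_complete[OF A(1)])
  fix r and \<epsilon> :: real assume \<epsilon>: "0 < \<epsilon>"
  have Ab [measurable]: "A n \<in> sets borel" for n using A by (auto simp: sets_hyp_measure)
  define R where "R = real (Suc r)"
  have Rpos: "0 < R" by (simp add: R_def)
  obtain k where k: "R\<^sup>2 * (256 * R\<^sup>2 * scale k * C) < \<epsilon> / 2"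
  proof -
    have "(\<lambda>k. R\<^sup>2 * (256 * R\<^sup>2 * (1 / 2) ^ k * C)) \<longlonglongrightarrow> R\<^sup>2 * (256 * R\<^sup>2 * 0 * C)"
      by (intro tendsto_intros LIMSEQ_power_zero) simp
    from order_tendstoD(2)[OF this, of "\<epsilon> / 2"] \<epsilon> obtain k where "R\<^sup>2 * (256 * R\<^sup>2 * (1 / 2) ^ k * C) < \<epsilon> / 2"
      by (auto simp: eventually_sequentially)
    then show ?thesis
      by (intro that[of k]) (simp add: power_one_over)
  qed
  define F where "F = {q \<in> level k. cell' q \<inter> hbox r \<noteq> {}}"
  have finF: "finite F"
    unfolding F_def by (rule finite_cells_hbox)
  have disj: "disjoint_family_on (\<lambda>q. cell' q) F"
    using disjoint_cells[of k] by (rule disjoint_family_on_mono[rotated]) (auto simp: F_def)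
  have osc: "(\<Sum>q\<in>F. measure (osc_measure (A n) k) (cell' q)) \<le> 2 * scale k * scale k * C" for n
  proof -
    have le: "emeasure (osc_measure (A n) k) UNIV \<le> ennreal (2 * scale k * scale k * C)"
      by (rule emeasure_osc_measure_le[OF A C])
    then interpret finite_measure "osc_measure (A n) k"
      by (intro finite_measureI) (auto simp: top_unique)
    have "(\<Sum>q\<in>F. measure (osc_measure (A n) k) (cell' q)) = measure (osc_measure (A n) k) (\<Union>q\<in>F. cell' q)"
      by (rule finite_measure_finite_Union[symmetric]) (use finF disj in auto)
    also have "\<dots> \<le> measure (osc_measure (A n) k) UNIV"
      by (rule finite_measure_mono) auto
    also have "\<dots> \<le> 2 * scale k * scale k * C"
      using le C by (simp add: emeasure_eq_measure)
    finally show ?thesis .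
  qed
  have main: "measure hypvol (sym_diff (A m) (A n) \<inter> hbox r) \<le>
      R\<^sup>2 * (256 * R\<^sup>2 * scale k * C) + R\<^sup>2 * (\<Sum>q\<in>F. \<bar>measure lborel (A m \<inter> cell' q) - measure lborel (A n \<inter> cell' q)\<bar>)" for m n
  proof -
    have fml: "hbox r \<in> fmeasurable lborel"
      using emeasure_compact_finite[OF compact_hbox, of r] by (auto simp: fmeasurable_def)
    have "emeasure hypvol (sym_diff (A m) (A n) \<inter> hbox r) \<le> ennreal (1 / (1 / R)\<^sup>2) * emeasure lborel (sym_diff (A m) (A n) \<inter> hbox r)"
      using Rpos by (intro emeasure_hypvol_le) (auto simp: hbox_def R_def)
    also have "emeasure lborel (sym_diff (A m) (A n) \<inter> hbox r) = ennreal (measure lborel (sym_diff (A m) (A n) \<inter> hbox r))"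
      using fmeasurableI2[OF fml, of "sym_diff (A m) (A n) \<inter> hbox r"] by (intro emeasure_eq_measure2) auto
    also have "ennreal (1 / (1 / R)\<^sup>2) * \<dots> = ennreal (R\<^sup>2 * measure lborel (sym_diff (A m) (A n) \<inter> hbox r))"
      by (subst ennreal_mult[symmetric]) (auto simp: power_one_over)
    finally have "measure hypvol (sym_diff (A m) (A n) \<inter> hbox r) \<le> R\<^sup>2 * measure lborel (sym_diff (A m) (A n) \<inter> hbox r)"
      unfolding measure_def[of hypvol] by (intro enn2real_leI) auto
    also have "measure lborel (sym_diff (A m) (A n) \<inter> hbox r) \<le> measure lborel (\<Union>q\<in>F. sym_diff (A m) (A n) \<inter> cell' q)"
    proof (rule measure_mono_fmeasurable)
      show "sym_diff (A m) (A n) \<inter> hbox r \<subseteq> (\<Union>q\<in>F. sym_diff (A m) (A n) \<inter> cell' q)"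
      proof
        fix z assume z: "z \<in> sym_diff (A m) (A n) \<inter> hbox r"
        then have "z \<in> hyp_plane" using hbox_subset_hyp_plane by blast
        from cells_cover[OF this, of k] obtain e a b where "(e, a, b) \<in> level k" "z \<in> cell e a b" .
        with z show "z \<in> (\<Union>q\<in>F. sym_diff (A m) (A n) \<inter> cell' q)"
          by (intro UN_I[of "(e, a, b)"]) (auto simp: F_def)
      qed
      show "(\<Union>q\<in>F. sym_diff (A m) (A n) \<inter> cell' q) \<in> fmeasurable lborel"
        using finF fmeasurableI2[OF fmeasurable_cell Int_lower2] by (intro fmeasurable.finite_UN) auto
    qed measurable
    also have "\<dots> \<le> (\<Sum>q\<in>F. measure lborel (sym_diff (A m) (A n) \<inter> cell' q))"
      by (rule measure_UNION_le[OF finF]) measurable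
    also have "\<dots> \<le> (\<Sum>q\<in>F. 64 * 2 ^ k * R\<^sup>2 * (measure (osc_measure (A m) k) (cell' q) + measure (osc_measure (A n) k) (cell' q)) +
        \<bar>measure lborel (A m \<inter> cell' q) - measure lborel (A n \<inter> cell' q)\<bar>)"
    proof (rule sum_mono)
      fix q assume q: "q \<in> F"
      obtain e a b where qe: "q = (e, a, b)" by (cases q) auto
      obtain z where "z \<in> cell e a b" "z \<in> hbox r" using q by (auto simp: F_def qe)
      then have "2 powr e * b \<le> R"
        by (auto simp: cell_def square_def hbox_def R_def)
      with q show "measure lborel (sym_diff (A m) (A n) \<inter> cell' q) \<le> 64 * 2 ^ k * R\<^sup>2 * (measure (osc_measure (A m) k) (cell' q) + measure (osc_measure (A n) k) (cell' q)) +
        \<bar>measure lborel (A m \<inter> cell' q) - measure lborel (A n \<inter> cell' q)\<bar>"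
        unfolding qe fst_conv snd_conv by (intro sym_diff_cell[OF A A C]) (auto simp: F_def)
    qed
    also have "\<dots> = 64 * 2 ^ k * R\<^sup>2 * ((\<Sum>q\<in>F. measure (osc_measure (A m) k) (cell' q)) + (\<Sum>q\<in>F. measure (osc_measure (A n) k) (cell' q))) +
        (\<Sum>q\<in>F. \<bar>measure lborel (A m \<inter> cell' q) - measure lborel (A n \<inter> cell' q)\<bar>)"
      by (simp only: sum.distrib sum_distrib_left distrib_left)
    also have "\<dots> \<le> 64 * 2 ^ k * R\<^sup>2 * (2 * scale k * scale k * C + 2 * scale k * scale k * C) +
        (\<Sum>q\<in>F. \<bar>measure lborel (A m \<inter> cell' q) - measure lborel (A n \<inter> cell' q)\<bar>)"
      by (intro add_mono mult_left_mono osc) auto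
    also have "64 * 2 ^ k * R\<^sup>2 * (2 * scale k * scale k * C + 2 * scale k * scale k * C) = 256 * R\<^sup>2 * scale k * C"
      by simp
    finally show ?thesis
      by (simp add: distrib_left mult_left_mono)
  qed
  define \<delta> where "\<delta> = \<epsilon> / (2 * R\<^sup>2 * (real (card F) + 1))"
  have \<delta>: "0 < \<delta>" using \<epsilon> Rpos by (simp add: \<delta>_def)
  have "\<exists>N. \<forall>m\<ge>N. \<forall>n\<ge>N. \<bar>measure lborel (A m \<inter> cell' q) - measure lborel (A n \<inter> cell' q)\<bar> < \<delta>" for q
    using convergent_Cauchy[OF conv] \<delta> by (simp add: Cauchy_def dist_real_def)
  then obtain N where N: "\<And>q m n. N q \<le> m \<Longrightarrow> N q \<le> n \<Longrightarrow> \<bar>measure lborel (A m \<inter> cell' q) - measure lborel (A n \<inter> cell' q)\<bar> < \<delta>"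
    by metis
  show "\<exists>N. \<forall>m\<ge>N. \<forall>n\<ge>N. measure hypvol (sym_diff (A m) (A n) \<inter> hbox r) < \<epsilon>"
  proof (intro exI allI impI)
    fix m n assume mn: "(\<Sum>q\<in>F. N q) \<le> m" "(\<Sum>q\<in>F. N q) \<le> n"
    have Nq: "N q \<le> (\<Sum>q\<in>F. N q)" if "q \<in> F" for q
      by (rule member_le_sum[OF that _ finF]) auto
    have "(\<Sum>q\<in>F. \<bar>measure lborel (A m \<inter> cell' q) - measure lborel (A n \<inter> cell' q)\<bar>) \<le> (\<Sum>q\<in>F. \<delta>)"
    proof (rule sum_mono)
      fix q assume "q \<in> F"
      from Nq[OF this] mn have "N q \<le> m" "N q \<le> n" by linarith+
      from N[OF this] show "\<bar>measure lborel (A m \<inter> cell' q) - measure lborel (A n \<inter> cell' q)\<bar> \<le> \<delta>"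
        by simp
    qed
    also have "\<dots> \<le> (real (card F) + 1) * \<delta>"
      using \<delta> by simp
    also have "\<dots> = \<epsilon> / (2 * R\<^sup>2)"
    proof -
      have "c * (\<epsilon> / (2 * R\<^sup>2 * c)) = \<epsilon> / (2 * R\<^sup>2)" if "0 < c" for c :: real
        using that by simp
      from this[of "real (card F) + 1"] show ?thesis
        by (simp add: \<delta>_def)
    qed
    finally have "R\<^sup>2 * (\<Sum>q\<in>F. \<bar>measure lborel (A m \<inter> cell' q) - measure lborel (A n \<inter> cell' q)\<bar>) \<le> R\<^sup>2 * (\<epsilon> / (2 * R\<^sup>2))"
      by (intro mult_left_mono) auto
    also have "\<dots> = \<epsilon> / 2" using Rpos by simp
    finally show "measure hypvol (sym_diff (A m) (A n) \<inter> hbox r) < \<epsilon>"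
      using main[of m n] k by linarith
  qed
qed

section \<open>Consequences of local convergence\<close>

lemma measure_inter_diff_le:
  assumes "A \<in> sets borel" "B \<in> sets borel" "S \<in> sets borel" "S \<subseteq> hbox r"
  shows "\<bar>measure hypvol (A \<inter> S) - measure hypvol (B \<inter> S)\<bar> \<le> measure hypvol (sym_diff A B \<inter> hbox r)"
proof -
  have *: "measure hypvol (A \<inter> S) \<le> measure hypvol (B \<inter> S) + measure hypvol (sym_diff A B \<inter> hbox r)"
    if [simp]: "A \<in> sets borel" "B \<in> sets borel" for A B
  proof -
    have [simp]: "sym_diff A B \<in> sets borel"
      by (intro sets.Un sets.Diff that)
    have "(B \<inter> S) \<inter> hbox r \<in> fmeasurable hypvol"
      using assms that by (intro fmeasurable_inter_hbox) auto
    moreover have "(B \<inter> S) \<inter> hbox r = B \<inter> S"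
      using assms(4) by auto
    ultimately have BS: "B \<inter> S \<in> fmeasurable hypvol"
      by (simp only:)
    have "measure hypvol (A \<inter> S) \<le> measure hypvol ((B \<inter> S) \<union> (sym_diff A B \<inter> hbox r))"
      using assms BS by (intro measure_mono_fmeasurable fmeasurable.Un fmeasurable_inter_hbox) auto
    also have "\<dots> \<le> measure hypvol (B \<inter> S) + measure hypvol (sym_diff A B \<inter> hbox r)"
      using assms by (intro measure_Un_le) auto
    finally show ?thesis .
  qed
  have "sym_diff B A = sym_diff A B" by auto
  with *[of A B] *[of B A] assms show ?thesis by auto
qed

lemma loc_conv_measure:
  assumes "\<And>n. A n \<in> sets hyp_measure" "B \<in> sets hyp_measure" "loc_conv A B" "S \<in> sets borel" "S \<subseteq> hbox r"
  shows "(\<lambda>n. measure hypvol (A n \<inter> S)) \<longlonglongrightarrow> measure hypvol (B \<inter> S)"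
proof (rule LIM_zero_cancel, rule Lim_null_comparison)
  show "\<forall>\<^sub>F n in sequentially. norm (measure hypvol (A n \<inter> S) - measure hypvol (B \<inter> S)) \<le> measure hypvol (sym_diff (A n) B \<inter> hbox r)"
    using assms by (intro always_eventually allI) (auto simp: sets_hyp_measure intro!: measure_inter_diff_le)
  show "(\<lambda>n. measure hypvol (sym_diff (A n) B \<inter> hbox r)) \<longlonglongrightarrow> 0"
    using assms(3) by (simp add: loc_conv_def)
qed

lemma loc_conv_flux:
  assumes A: "\<And>n. A n \<in> sets hyp_measure" and B: "B \<in> sets hyp_measure" and AB: "loc_conv A B" and v: "v \<in> test_fields"
  shows "(\<lambda>n. flux (A n) v) \<longlonglongrightarrow> flux B v"
proof -
  obtain K M where K: "compact K" "K \<subseteq> hyp_plane" "M \<ge> 0" "\<And>p. p \<in> hyp_plane \<Longrightarrow> \<bar>hyp_div v p\<bar> \<le> M * indicator K p"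
    using hyp_div_bounded_support[OF v] by metis
  obtain r where r: "K \<subseteq> hbox r" using compact_subset_hbox[OF K(1,2)] .
  have 1: "\<forall>\<^sub>F n in sequentially. norm (flux (A n) v - flux B v) \<le> M * measure hypvol (sym_diff (A n) B \<inter> hbox r)"
  proof (intro always_eventually allI)
    fix n
    have [measurable]: "A n \<in> sets borel" "B \<in> sets borel" and h: "A n \<subseteq> hyp_plane" "B \<subseteq> hyp_plane"
      using A B by (auto simp: sets_hyp_measure)
    have int: "integrable hypvol (\<lambda>p. M * indicator (sym_diff (A n) B \<inter> hbox r) p)"
      using fmeasurable_inter_hbox[of "sym_diff (A n) B" r]
      by (intro integrable_mult_right integrable_real_indicator) (auto simp: fmeasurable_def)
    have "flux (A n) v - flux B v = (\<integral>p. indicator (A n) p * hyp_div v p - indicator B p * hyp_div v p \<partial>hypvol)"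
      unfolding flux_def by (rule Bochner_Integration.integral_diff[symmetric]) (intro integrable_hyp_div v A B)+
    also have "norm \<dots> \<le> (\<integral>p. M * indicator (sym_diff (A n) B \<inter> hbox r) p \<partial>hypvol)"
    proof (rule Bochner_Integration.integral_norm_bound_integral[OF _ int])
      show "integrable hypvol (\<lambda>p. indicator (A n) p * hyp_div v p - indicator B p * hyp_div v p)"
        by (intro Bochner_Integration.integrable_diff integrable_hyp_div v A B)
      fix p
      show "norm (indicator (A n) p * hyp_div v p - indicator B p * hyp_div v p) \<le> M * indicator (sym_diff (A n) B \<inter> hbox r) p"
      proof (cases "p \<in> hyp_plane")
        case True
        have "\<bar>hyp_div v p\<bar> \<le> M * indicator (hbox r) p"
          using K(4)[OF True] r K(3) by (cases "p \<in> K") (auto simp: indicator_def)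
        then show ?thesis by (auto simp: indicator_def)
      next
        case False
        with h have "p \<notin> A n" "p \<notin> B" by auto
        then show ?thesis using K(3) by simp
      qed
    qed
    finally show "norm (flux (A n) v - flux B v) \<le> M * measure hypvol (sym_diff (A n) B \<inter> hbox r)"
      by simp
  qed
  have "(\<lambda>n. M * measure hypvol (sym_diff (A n) B \<inter> hbox r)) \<longlonglongrightarrow> M * 0"
    using AB by (intro tendsto_intros) (simp add: loc_conv_def)
  then have 2: "(\<lambda>n. M * measure hypvol (sym_diff (A n) B \<inter> hbox r)) \<longlonglongrightarrow> 0" by simp
  show ?thesis
    by (rule LIM_zero_cancel, rule Lim_null_comparison[OF 1 2])
qed

lemma UN_hbox: "(\<Union>r. hbox r) = hyp_plane"
proof -
  have "z \<in> (\<Union>r. hbox r)" if "z \<in> hyp_plane" for z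
    using compact_subset_hbox[of "{z}"] that by auto
  then show ?thesis using hbox_subset_hyp_plane by blast
qed

lemma hbox_exhausts:
  assumes "A \<in> sets hyp_measure"
  shows "(\<lambda>r. emeasure hypvol (A \<inter> hbox r)) \<longlonglongrightarrow> emeasure hypvol A"
proof -
  have [measurable]: "A \<in> sets borel" and h: "A \<subseteq> hyp_plane" using assms by (auto simp: sets_hyp_measure)
  have "(\<lambda>r. emeasure hypvol (A \<inter> hbox r)) \<longlonglongrightarrow> emeasure hypvol (\<Union>r. A \<inter> hbox r)"
    using hbox_mono by (intro Lim_emeasure_incseq) (auto simp: incseq_def)
  also have "(\<Union>r. A \<inter> hbox r) = A"
    using h UN_hbox by auto
  finally show ?thesis .
qed

lemma emeasure_zero_hbox:
  assumes "A \<in> sets hyp_measure" "\<And>r. measure hypvol (A \<inter> hbox r) = 0"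
  shows "emeasure hypvol A = 0"
proof -
  have "emeasure hypvol (A \<inter> hbox r) = 0" for r
    using assms emeasure_eq_measure2[OF fmeasurable_inter_hbox[of A r]] by (simp add: sets_hyp_measure)
  with hbox_exhausts[OF assms(1)] show ?thesis
    by (simp add: LIMSEQ_const_iff)
qed

lemma loc_conv_null_inter:
  assumes A: "\<And>n. A n \<in> sets hyp_measure" "\<And>n. A' n \<in> sets hyp_measure" and B: "B \<in> sets hyp_measure" "B' \<in> sets hyp_measure"
    and conv: "loc_conv A B" "loc_conv A' B'" and null: "\<And>n. emeasure hypvol (A n \<inter> A' n) = 0"
  shows "emeasure hypvol (B \<inter> B') = 0"
proof (rule emeasure_zero_hbox)
  show "B \<inter> B' \<in> sets hyp_measure" using B by blast
  fix r
  have le: "measure hypvol (B \<inter> B' \<inter> hbox r) \<le>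
      measure hypvol (sym_diff (A n) B \<inter> hbox r) + measure hypvol (sym_diff (A' n) B' \<inter> hbox r)" for n
  proof -
    have [measurable]: "A n \<in> sets borel" "A' n \<in> sets borel" "B \<in> sets borel" "B' \<in> sets borel"
      using A B by (auto simp: sets_hyp_measure)
    have nz: "measure hypvol (A n \<inter> A' n) = 0" "A n \<inter> A' n \<in> fmeasurable hypvol"
      using null[of n] by (auto simp: measure_def intro!: fmeasurableI)
    have "measure hypvol (B \<inter> B' \<inter> hbox r) \<le> measure hypvol ((A n \<inter> A' n) \<union> (sym_diff (A n) B \<inter> hbox r \<union> sym_diff (A' n) B' \<inter> hbox r))"
      by (intro measure_mono_fmeasurable fmeasurable.Un nz fmeasurable_inter_hbox) auto
    also have "\<dots> \<le> measure hypvol (A n \<inter> A' n) + measure hypvol (sym_diff (A n) B \<inter> hbox r \<union> sym_diff (A' n) B' \<inter> hbox r)"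
      by (intro measure_Un_le) auto
    also have "\<dots> \<le> 0 + (measure hypvol (sym_diff (A n) B \<inter> hbox r) + measure hypvol (sym_diff (A' n) B' \<inter> hbox r))"
      unfolding nz by (intro add_left_mono measure_Un_le) auto
    finally show ?thesis by simp
  qed
  have "(\<lambda>n. measure hypvol (sym_diff (A n) B \<inter> hbox r) + measure hypvol (sym_diff (A' n) B' \<inter> hbox r)) \<longlonglongrightarrow> 0 + 0"
    using conv by (intro tendsto_add) (auto simp: loc_conv_def)
  from LIMSEQ_le_const[OF this, of "measure hypvol (B \<inter> B' \<inter> hbox r)"] le
  show "measure hypvol (B \<inter> B' \<inter> hbox r) = 0"
    using measure_nonneg[of hypvol "B \<inter> B' \<inter> hbox r"] by force
qed

text \<open>Local convergence does not pass to infinite unions in general; the summable bound on the areas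
  makes the tails of the union uniformly small.\<close>

lemma loc_conv_UN:
  fixes A :: "nat \<Rightarrow> nat \<Rightarrow> complex set"
  assumes A: "\<And>n i. i \<in> I \<Longrightarrow> A n i \<in> sets hyp_measure" and B: "\<And>i. i \<in> I \<Longrightarrow> B i \<in> sets hyp_measure"
    and conv: "\<And>i. i \<in> I \<Longrightarrow> loc_conv (\<lambda>n. A n i) (B i)"
    and mass: "\<And>n i. i \<in> I \<Longrightarrow> emeasure hypvol (A n i) \<le> ennreal (m i)" "\<And>i. i \<in> I \<Longrightarrow> emeasure hypvol (B i) \<le> ennreal (m i)"
    and m: "\<And>i. 0 \<le> m i" "summable m"
  shows "loc_conv (\<lambda>n. \<Union>i\<in>I. A n i) (\<Union>i\<in>I. B i)"
  unfolding loc_conv_def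
proof (intro allI LIMSEQ_I)
  fix r and \<epsilon> :: real assume \<epsilon>: "0 < \<epsilon>"
  have "0 < \<epsilon> / 4" using \<epsilon> by simp
  from suminf_exist_split[OF this m(2)] obtain K where "norm (\<Sum>i. m (i + K)) < \<epsilon> / 4"
    by blast
  then have K: "(\<Sum>i. m (i + K)) < \<epsilon> / 4" by simp
  define tail where "tail n = (\<Union>i. if i + K \<in> I then A n (i + K) \<union> B (i + K) else {})" for n
  have sb [measurable]: "A n i \<in> sets borel" "B i \<in> sets borel" if "i \<in> I" for n i
    using A B that by (auto simp: sets_hyp_measure)
  have tail_b [measurable]: "tail n \<in> sets borel" for n
    unfolding tail_def by (intro sets.countable_UN) (auto simp: sb)
  have "emeasure hypvol (tail n) \<le> ennreal (\<epsilon> / 2)" for n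
  proof -
    have "emeasure hypvol (tail n) \<le> (\<Sum>i. emeasure hypvol (if i + K \<in> I then A n (i + K) \<union> B (i + K) else {}))"
      unfolding tail_def by (intro emeasure_subadditive_countably) (auto simp: sb)
    also have "\<dots> \<le> (\<Sum>i. ennreal (2 * m (i + K)))"
    proof (intro suminf_le summableI)
      fix i
      show "emeasure hypvol (if i + K \<in> I then A n (i + K) \<union> B (i + K) else {}) \<le> ennreal (2 * m (i + K))"
      proof (cases "i + K \<in> I")
        case True
        then have "emeasure hypvol (A n (i + K) \<union> B (i + K)) \<le> emeasure hypvol (A n (i + K)) + emeasure hypvol (B (i + K))"
          by (intro emeasure_subadditive) (auto simp: sb)
        also have "\<dots> \<le> ennreal (m (i + K)) + ennreal (m (i + K))"
          by (intro add_mono mass True)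
        finally show ?thesis
          using True m(1)[of "i + K"] by (simp flip: ennreal_plus)
      qed simp
    qed
    also have "\<dots> = ennreal (\<Sum>i. 2 * m (i + K))"
      using m by (intro suminf_ennreal2) (auto intro!: summable_mult summable_ignore_initial_segment)
    also have "(\<Sum>i. 2 * m (i + K)) = 2 * (\<Sum>i. m (i + K))"
      using m by (intro suminf_mult) (auto intro!: summable_ignore_initial_segment)
    also have "ennreal \<dots> \<le> ennreal (\<epsilon> / 2)"
      using K by (intro ennreal_leI) simp
    finally show ?thesis .
  qed
  then have tail: "measure hypvol (tail n \<inter> hbox r) \<le> \<epsilon> / 2" for n
    unfolding measure_def using \<epsilon>
    by (intro enn2real_leI order_trans[OF emeasure_mono, of "tail n \<inter> hbox r" "tail n"]) auto
  let ?F = "I \<inter> {..<K}"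
  have le: "measure hypvol (sym_diff (\<Union>i\<in>I. A n i) (\<Union>i\<in>I. B i) \<inter> hbox r) \<le>
      (\<Sum>i\<in>?F. measure hypvol (sym_diff (A n i) (B i) \<inter> hbox r)) + \<epsilon> / 2" for n
  proof -
    have "measure hypvol (sym_diff (\<Union>i\<in>I. A n i) (\<Union>i\<in>I. B i) \<inter> hbox r) \<le>
        measure hypvol ((\<Union>i\<in>?F. sym_diff (A n i) (B i) \<inter> hbox r) \<union> (tail n \<inter> hbox r))"
    proof (intro measure_mono_fmeasurable fmeasurable.Un fmeasurable.finite_UN fmeasurable_inter_hbox)
      show "sym_diff (\<Union>i\<in>I. A n i) (\<Union>i\<in>I. B i) \<inter> hbox r \<subseteq> (\<Union>i\<in>?F. sym_diff (A n i) (B i) \<inter> hbox r) \<union> (tail n \<inter> hbox r)"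
      proof
        fix z assume z: "z \<in> sym_diff (\<Union>i\<in>I. A n i) (\<Union>i\<in>I. B i) \<inter> hbox r"
        then obtain i where i: "i \<in> I" "z \<in> sym_diff (A n i) (B i)" by auto
        show "z \<in> (\<Union>i\<in>?F. sym_diff (A n i) (B i) \<inter> hbox r) \<union> (tail n \<inter> hbox r)"
        proof (cases "i < K")
          case True
          with i z show ?thesis by auto
        next
          case False
          with i have "z \<in> tail n"
            unfolding tail_def by (intro UN_I[of "i - K"]) auto
          with z show ?thesis by auto
        qed
      qed
      show "sym_diff (\<Union>i\<in>I. A n i) (\<Union>i\<in>I. B i) \<inter> hbox r \<in> sets hypvol"
        using sb by (intro sets.Int sets.Un sets.Diff sets.countable_UN' ) auto
    qed (auto simp: sb)
    also have "\<dots> \<le> measure hypvol (\<Union>i\<in>?F. sym_diff (A n i) (B i) \<inter> hbox r) + measure hypvol (tail n \<inter> hbox r)"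
      by (intro measure_Un_le) (auto simp: sb)
    also have "\<dots> \<le> (\<Sum>i\<in>?F. measure hypvol (sym_diff (A n i) (B i) \<inter> hbox r)) + \<epsilon> / 2"
      by (intro add_mono tail measure_UNION_le) (auto simp: sb)
    finally show ?thesis .
  qed
  have "(\<lambda>n. \<Sum>i\<in>?F. measure hypvol (sym_diff (A n i) (B i) \<inter> hbox r)) \<longlonglongrightarrow> (\<Sum>i\<in>?F. 0)"
    using conv by (intro tendsto_sum) (auto simp: loc_conv_def)
  from order_tendstoD(2)[OF this, of "\<epsilon> / 2"] \<epsilon>
  obtain n0 where n0: "\<And>n. n0 \<le> n \<Longrightarrow> (\<Sum>i\<in>?F. measure hypvol (sym_diff (A n i) (B i) \<inter> hbox r)) < \<epsilon> / 2"
    by (auto simp: eventually_sequentially)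
  show "\<exists>n0. \<forall>n\<ge>n0. norm (measure hypvol (sym_diff (\<Union>i\<in>I. A n i) (\<Union>i\<in>I. B i) \<inter> hbox r) - 0) < \<epsilon>"
  proof (intro exI allI impI)
    fix n assume "n0 \<le> n"
    from le[of n] n0[OF this] show "norm (measure hypvol (sym_diff (\<Union>i\<in>I. A n i) (\<Union>i\<in>I. B i) \<inter> hbox r) - 0) < \<epsilon>"
      by simp
  qed
qed

section \<open>Perimeters of finitely many sets\<close>

lemma zero_unit_field: "(\<lambda>_. 0) \<in> unit_fields"
  by (simp add: unit_fields_def zero_test_field hyp_plane_def)

lemma sum_pos_flux_le_perimeter:
  assumes "finite R" "\<And>r. r \<in> R \<Longrightarrow> v r \<in> unit_fields" "E \<in> sets hyp_measure"
    and "\<And>r p. r \<in> R \<Longrightarrow> p \<in> hyp_plane \<Longrightarrow> v r p \<noteq> 0 \<Longrightarrow> p \<in> K r" "disjoint_family_on K R"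
  shows "(\<Sum>r\<in>R. ennreal (flux E (v r))) \<le> perimeter E"
proof -
  define w where "w r = (if 0 \<le> flux E (v r) then v r else (\<lambda>_. 0))" for r
  have w0: "0 \<le> flux E (w r)" for r
    by (simp add: w_def flux_zero[OF assms(3)])
  have "ennreal (flux E (v r)) = ennreal (flux E (w r))" for r
    by (auto simp: w_def flux_zero[OF assms(3)] ennreal_neg)
  then have "(\<Sum>r\<in>R. ennreal (flux E (v r))) = ennreal (\<Sum>r\<in>R. flux E (w r))"
    using w0 by (simp add: sum_ennreal)
  also have "\<dots> \<le> perimeter E"
    using assms(2,4) by (intro sum_flux_le_perimeter[OF assms(1) _ assms(3) _ assms(5)])
      (auto simp: w_def zero_unit_field split: if_splits)
  finally show ?thesis .
qed

text \<open>A sum of suprema is the supremum of the sums over independent choices of fields.\<close>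

lemma sum_perimeter_le:
  assumes "finite X" "\<And>x. x \<in> X \<Longrightarrow> A x \<in> sets hyp_measure"
    and "\<And>v. (\<And>x. x \<in> X \<Longrightarrow> v x \<in> unit_fields) \<Longrightarrow> (\<Sum>x\<in>X. ennreal (flux (A x) (v x))) \<le> c"
  shows "(\<Sum>x\<in>X. perimeter (A x)) \<le> c"
  using assms
proof (induction X arbitrary: c)
  case empty
  then show ?case by simp
next
  case (insert x X)
  have "perimeter (A x) + (\<Sum>x\<in>X. perimeter (A x)) = (SUP w\<in>unit_fields. ennreal (flux (A x) w) + (\<Sum>x\<in>X. perimeter (A x)))"
    using insert.prems(1)[of x] zero_unit_field
    by (subst perimeter_eq) (auto intro!: ennreal_SUP_add_left[symmetric])
  also have "\<dots> \<le> c"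
  proof (rule SUP_least)
    fix w assume w: "w \<in> unit_fields"
    have *: "ennreal (flux (A x) w) + (\<Sum>y\<in>X. ennreal (flux (A y) (v y))) \<le> c" if "\<And>y. y \<in> X \<Longrightarrow> v y \<in> unit_fields" for v
    proof -
      have "(\<Sum>y\<in>X. ennreal (flux (A y) ((v(x := w)) y))) = (\<Sum>y\<in>X. ennreal (flux (A y) (v y)))"
        using insert.hyps(2) by (intro sum.cong) auto
      moreover have "(\<Sum>y\<in>insert x X. ennreal (flux (A y) ((v(x := w)) y))) \<le> c"
        by (rule insert.prems(2)) (use w that in auto)
      ultimately show ?thesis
        using insert.hyps by simp
    qed
    have "(\<Sum>y\<in>X. perimeter (A y)) \<le> c - ennreal (flux (A x) w)"
    proof (rule insert.IH)
      fix v assume "\<And>y. y \<in> X \<Longrightarrow> v y \<in> unit_fields"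
      from *[OF this] show "(\<Sum>y\<in>X. ennreal (flux (A y) (v y))) \<le> c - ennreal (flux (A x) w)"
        by (subst ennreal_le_minus_iff) (auto simp: add.commute)
    qed (use insert.prems in auto)
    moreover have "ennreal (flux (A x) w) \<le> c"
      using *[of "\<lambda>_ _. 0"] zero_unit_field by (auto intro: order_trans[rotated])
    ultimately show "ennreal (flux (A x) w) + (\<Sum>x\<in>X. perimeter (A x)) \<le> c"
      by (subst (asm) ennreal_le_minus_iff) (auto simp: add.commute)
  qed
  finally show ?case
    using insert.hyps by simp
qed

section \<open>Moving frames\<close>

definition place :: "int \<Rightarrow> int \<Rightarrow> complex \<Rightarrow> complex" where
  "place e a = hiso (2 powr e) (2 powr e * a)"

lemma place_sel [simp]:
  "Re (place e a z) = 2 powr e * (Re z + a)" "Im (place e a z) = 2 powr e * Im z"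
  by (simp_all add: place_def distrib_left)

lemma inj_place: "inj (place e a)"
  by (rule injI) (auto simp: complex_eq_iff)

lemma measurable_place [measurable]: "place e a \<in> borel_measurable borel"
  unfolding place_def by measurable

lemma place_image_borel:
  assumes "S \<in> sets borel"
  shows "place e a ` S \<in> sets borel"
proof -
  let ?f = "hiso (1 / 2 powr e) (- (2 powr e * a) / 2 powr e)"
  have inv: "place e a (?f z) = z" "?f (place e a z) = z" for z
    unfolding place_def using hiso_inverse[of "2 powr e" "2 powr e * a" z] by simp_all
  have "place e a ` S = ?f -` S"
    using inv by (auto intro!: image_eqI[where x = "?f _"]) 
  then show ?thesis
    using measurable_sets[OF measurable_plane_map assms] by simp
qed

lemma place_vimage_sets: "U \<in> sets hyp_measure \<Longrightarrow> place e a -` U \<in> sets hyp_measure"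
  unfolding place_def by (rule hiso_vimage_sets) auto

lemma perimeter_place_le: "U \<in> sets hyp_measure \<Longrightarrow> perimeter (place e a -` U) \<le> perimeter U"
  unfolding place_def by (rule perimeter_iso_vimage_le) auto

lemma emeasure_place_vimage:
  "A \<in> sets borel \<Longrightarrow> emeasure hypvol (place e a -` A) = emeasure hypvol A"
  unfolding place_def by (rule emeasure_iso_vimage) auto

lemma emeasure_place_inter:
  assumes "U \<in> sets borel" "S \<in> sets borel"
  shows "emeasure hypvol (place e a -` U \<inter> S) = emeasure hypvol (U \<inter> place e a ` S)"
proof -
  have "place e a -` U \<inter> S = place e a -` (U \<inter> place e a ` S)"
    using inj_place[of e a] by (auto dest: injD)
  moreover have "U \<inter> place e a ` S \<in> sets borel"
    using assms place_image_borel by blast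
  ultimately show ?thesis
    by (simp only: emeasure_place_vimage)
qed

text \<open>The union of the cells with indices \<open>(0, 0, b)\<close> of level \<open>k\<close>.\<close>

definition strip :: "nat \<Rightarrow> complex set" where
  "strip k = {z. 0 \<le> Re z \<and> Re z < 1 \<and> 2 ^ k \<le> Im z \<and> Im z < 2 ^ Suc k}"

lemma strip_subset_hbox: "strip k \<subseteq> hbox (2 ^ Suc k)"
proof
  fix z assume z: "z \<in> strip k"
  have "(1::real) \<le> 2 ^ k" by simp
  moreover have "2 ^ k \<le> Im z" using z by (simp add: strip_def)
  ultimately have "1 \<le> Im z" by linarith
  moreover have "1 / real (Suc n) \<le> 1" for n by simp
  note this[of "2 ^ Suc k"]
  ultimately have "1 / real (Suc (2 ^ Suc k)) \<le> Im z" by linarith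
  with z show "z \<in> hbox (2 ^ Suc k)"
    by (auto simp: hbox_def strip_def)
qed

lemma cell_subset_strip:
  assumes "(e, a, b) \<in> level k"
  shows "cell e a b \<subseteq> place e a ` strip k"
proof
  fix z assume z: "z \<in> cell e a b"
  define w where "w = Complex (Re z / 2 powr e - a) (Im z / 2 powr e)"
  have b: "2 ^ k \<le> real b" "real b + 1 \<le> 2 ^ Suc k"
  proof -
    have "2 ^ k \<le> b" "b + 1 \<le> 2 ^ Suc k" using assms by (auto simp: level_def)
    then have "real (2 ^ k) \<le> real b" "real (b + 1) \<le> real (2 ^ Suc k)"
      by (simp_all only: of_nat_le_iff)
    then show "2 ^ k \<le> real b" "real b + 1 \<le> 2 ^ Suc k" by simp_all
  qed
  have "2 powr e * a \<le> Re z" "Re z < 2 powr e * a + 2 powr e" "2 powr e * b \<le> Im z" "Im z < 2 powr e * b + 2 powr e"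
    using z by (auto simp: cell_def square_def)
  then have "0 \<le> Re w" "Re w < 1" "b \<le> Im w" "Im w < real b + 1"
    by (auto simp: w_def field_simps)
  then have "w \<in> strip k"
    using b unfolding strip_def mem_Collect_eq by (intro conjI; linarith)
  moreover have "z = place e a w"
    by (simp add: complex_eq_iff w_def)
  ultimately show "z \<in> place e a ` strip k" by blast
qed

text \<open>As the images of the box are disjoint, no part of a sheet is seen from two frames.\<close>

lemma sum_view_measure_le:
  fixes sh ce ca :: "nat \<Rightarrow> int"
  assumes R: "finite R" and disj: "\<And>p q. p \<in> R \<Longrightarrow> q \<in> R \<Longrightarrow> p \<noteq> q \<Longrightarrow> sh p = sh q \<Longrightarrow>
      place (ce p) (ca p) ` hbox r \<inter> place (ce q) (ca q) ` hbox r = {}"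
    and U: "\<And>s. U s \<in> sets hyp_measure"
  shows "(\<Sum>p\<in>R. emeasure hypvol (place (ce p) (ca p) -` U (sh p) \<inter> hbox r)) \<le> (\<Sum>s\<in>sh ` R. emeasure hypvol (U s))"
proof -
  have [simp]: "U s \<in> sets borel" for s using U by (auto simp: sets_hyp_measure)
  have "(\<Sum>p\<in>R. emeasure hypvol (place (ce p) (ca p) -` U (sh p) \<inter> hbox r)) =
      (\<Sum>s\<in>sh ` R. \<Sum>p\<in>{p \<in> R. sh p = s}. emeasure hypvol (U s \<inter> place (ce p) (ca p) ` hbox r))"
    by (subst sum.image_gen[OF R, of _ sh]) (auto intro!: sum.cong simp: emeasure_place_inter)
  also have "\<dots> \<le> (\<Sum>s\<in>sh ` R. emeasure hypvol (U s))"
  proof (rule sum_mono)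
    fix s
    have "(\<Sum>p\<in>{p \<in> R. sh p = s}. emeasure hypvol (U s \<inter> place (ce p) (ca p) ` hbox r)) =
        emeasure hypvol (\<Union>p\<in>{p \<in> R. sh p = s}. U s \<inter> place (ce p) (ca p) ` hbox r)"
    proof (rule sum_emeasure)
      show "(\<lambda>p. U s \<inter> place (ce p) (ca p) ` hbox r) ` {p \<in> R. sh p = s} \<subseteq> sets hypvol"
        by (auto intro!: sets.Int place_image_borel)
      show "disjoint_family_on (\<lambda>p. U s \<inter> place (ce p) (ca p) ` hbox r) {p \<in> R. sh p = s}"
        using disj by (fastforce simp: disjoint_family_on_def)
    qed (use R in auto)
    also have "\<dots> \<le> emeasure hypvol (U s)"
      by (rule emeasure_mono) auto
    finally show "(\<Sum>p\<in>{p \<in> R. sh p = s}. emeasure hypvol (U s \<inter> place (ce p) (ca p) ` hbox r)) \<le> emeasure hypvol (U s)" .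
  qed
  finally show ?thesis .
qed

text \<open>The transported fields have disjoint supports, so those that belong to the same sheet can be added.\<close>

lemma sum_view_flux_le:
  fixes sh ce ca :: "nat \<Rightarrow> int"
  assumes R: "finite R" and disj: "\<And>p q. p \<in> R \<Longrightarrow> q \<in> R \<Longrightarrow> p \<noteq> q \<Longrightarrow> sh p = sh q \<Longrightarrow>
      place (ce p) (ca p) ` hbox r \<inter> place (ce q) (ca q) ` hbox r = {}"
    and U: "\<And>s. U s \<in> sets hyp_measure"
    and v: "\<And>p. p \<in> R \<Longrightarrow> v p \<in> unit_fields" "\<And>p z. p \<in> R \<Longrightarrow> z \<in> hyp_plane \<Longrightarrow> v p z \<noteq> 0 \<Longrightarrow> z \<in> hbox r"
  shows "(\<Sum>p\<in>R. ennreal (flux (place (ce p) (ca p) -` U (sh p)) (v p))) \<le> (\<Sum>s\<in>sh ` R. perimeter (U s))"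
proof -
  define w where "w p = push (2 powr ce p) (2 powr ce p * ca p) (v p)" for p
  have vw: "flux (place (ce p) (ca p) -` U s) (v p) = flux (U s) (w p)" if "p \<in> R" for p s
    unfolding w_def place_def using v(1)[OF that] U by (subst flux_push) (auto simp: unit_fields_def)
  have "(\<Sum>p\<in>R. ennreal (flux (place (ce p) (ca p) -` U (sh p)) (v p))) =
      (\<Sum>s\<in>sh ` R. \<Sum>p\<in>{p \<in> R. sh p = s}. ennreal (flux (U s) (w p)))"
    by (subst sum.image_gen[OF R, of _ sh]) (auto intro!: sum.cong simp: vw)
  also have "\<dots> \<le> (\<Sum>s\<in>sh ` R. perimeter (U s))"
  proof (rule sum_mono)
    fix s
    show "(\<Sum>p\<in>{p \<in> R. sh p = s}. ennreal (flux (U s) (w p))) \<le> perimeter (U s)"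
    proof (rule sum_pos_flux_le_perimeter[OF _ _ U, where K = "\<lambda>p. place (ce p) (ca p) ` hbox r"])
      show "w p \<in> unit_fields" if "p \<in> {p \<in> R. sh p = s}" for p
        unfolding w_def using v that by (intro push_unit_field) auto
      show "z \<in> place (ce p) (ca p) ` hbox r" if p: "p \<in> {p \<in> R. sh p = s}" and z: "z \<in> hyp_plane" "w p z \<noteq> 0" for p z
      proof (rule image_eqI)
        let ?y = "hiso (1 / 2 powr ce p) (- (2 powr ce p * ca p) / 2 powr ce p) z"
        show "z = place (ce p) (ca p) ?y"
          unfolding place_def by (rule hiso_inverse(1)[symmetric]) simp
        have "?y \<in> hyp_plane"
          using z(1) by (subst hiso_hyp_plane) auto
        moreover have "v p ?y \<noteq> 0"
          using z(2) unfolding w_def push_def by auto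
        ultimately show "?y \<in> hbox r"
          using v(2) p by blast
      qed
      show "disjoint_family_on (\<lambda>p. place (ce p) (ca p) ` hbox r) {p \<in> R. sh p = s}"
        using disj by (fastforce simp: disjoint_family_on_def)
    qed (use R in auto)
  qed
  finally show ?thesis .
qed

text \<open>The position of frame \<open>q\<close> relative to frame \<open>p\<close>: by \<open>near_place\<close>, the isometry between them is
  \<^term>\<open>hiso (2 powr d) t\<close>.\<close>

definition near :: "(nat \<Rightarrow> int) \<Rightarrow> (nat \<Rightarrow> int) \<Rightarrow> (nat \<Rightarrow> int) \<Rightarrow> nat \<Rightarrow> nat \<Rightarrow> int \<Rightarrow> real \<Rightarrow> bool" where
  "near sh ce ca p q d t \<longleftrightarrow> sh p = sh q \<and> ce q - ce p = d \<and> 2 powr d * ca q - ca p = t"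

lemma near_place:
  assumes "near sh ce ca p q d t"
  shows "place (ce q) (ca q) z = place (ce p) (ca p) (hiso (2 powr d) t z)"
proof -
  have "ce q = ce p + d" using assms by (auto simp: near_def)
  then have "2 powr (ce q) = 2 powr (ce p) * 2 powr d"
    by (simp add: powr_add)
  moreover have "2 powr d * (Re z + ca q) = 2 powr d * Re z + t + ca p"
    using assms by (auto simp: near_def distrib_left)
  ultimately show ?thesis
    by (simp add: complex_eq_iff mult.assoc)
qed

lemma near_refl: "near sh ce ca p p 0 0"
  by (simp add: near_def)

lemma near_trans:
  assumes "near sh ce ca p q d t" "near sh ce ca q r d' t'"
  shows "near sh ce ca p r (d + d') (2 powr d * t' + t)"
proof -
  have "2 powr (d + d') * ca r = 2 powr d * (2 powr d' * ca r)"
    by (simp add: powr_add)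
  also have "2 powr d' * ca r = t' + ca q"
    using assms(2) by (auto simp: near_def)
  finally have "2 powr (d + d') * ca r - ca p = 2 powr d * t' + t"
    using assms(1) by (auto simp: near_def distrib_left)
  then show ?thesis
    using assms by (auto simp: near_def)
qed

text \<open>Scales are powers of 2 and translations are dyadic with bounded denominators, so a bound on the
  relative position leaves finitely many values.\<close>

lemma finite_near:
  obtains X where "finite X" "\<And>sh ce ca p q. sh p = sh q \<Longrightarrow> place (ce p) (ca p) ` hbox r \<inter> place (ce q) (ca q) ` hbox r \<noteq> {} \<Longrightarrow>
    \<exists>(d, t)\<in>X. near sh ce ca p q d t"
proof -
  define R where "R = real (Suc r)"
  have R: "0 < R" by (simp add: R_def)
  obtain D :: nat where D: "R * R \<le> 2 ^ D"
    using real_arch_pow[of 2 "R * R"] by (auto intro: less_imp_le)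
  define T where "T = \<lceil>2 ^ D * (R + 2 ^ D * R)\<rceil>"
  define X where "X = {- int D..int D} \<times> (\<lambda>c. real_of_int c / 2 ^ D) ` {- T..T}"
  have "finite X" by (simp add: X_def)
  have near: "\<exists>(d, t)\<in>X. near sh ce ca p q d t"
    if s: "sh p = sh q" and ne: "place (ce p) (ca p) ` hbox r \<inter> place (ce q) (ca q) ` hbox r \<noteq> {}" for sh ce ca :: "nat \<Rightarrow> int" and p q
  proof -
    obtain z w where zw: "z \<in> hbox r" "w \<in> hbox r" "place (ce p) (ca p) z = place (ce q) (ca q) w"
      using ne by auto
    define d where "d = ce q - ce p"
    define t where "t = 2 powr d * ca q - ca p"
    have q: "2 powr (ce q) = 2 powr (ce p) * 2 powr d"
      by (simp add: d_def flip: powr_add)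
    have b: "\<bar>Re z\<bar> \<le> R" "\<bar>Re w\<bar> \<le> R" "1 / R \<le> Im z" "1 / R \<le> Im w" "Im z \<le> R" "Im w \<le> R"
      using zw by (auto simp: hbox_def R_def)
    have pos: "0 < Im z" "0 < Im w"
      using b R by (auto intro: less_le_trans[of _ "1 / R"])
    have im: "Im z = 2 powr d * Im w" and re: "Re z + ca p = 2 powr d * (Re w + ca q)"
      using arg_cong[OF zw(3), of Im] arg_cong[OF zw(3), of Re] unfolding place_sel q by (simp_all add: mult.assoc)
    have "2 powr d \<le> R * R"
    proof -
      have "2 powr d * (1 / R) \<le> 2 powr d * Im w" using b by (intro mult_left_mono) auto
      also have "\<dots> \<le> R" using b im by simp
      finally show ?thesis using R by (simp add: field_simps)
    qed
    then have d1: "2 powr d \<le> 2 ^ D" using D by linarith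
    then have "2 powr d \<le> 2 powr (real D)" by (simp add: powr_realpow)
    then have dD: "d \<le> int D" by simp
    have "1 \<le> 2 powr d * (R * R)"
    proof -
      have "1 / R \<le> 2 powr d * R" using b(3,6) im by (intro order_trans[OF b(3)]) (auto intro: mult_left_mono)
      then show ?thesis using R by (simp add: field_simps)
    qed
    also have "\<dots> \<le> 2 powr d * 2 ^ D" using D by (intro mult_left_mono) auto
    also have "\<dots> = 2 powr (d + int D)" by (simp add: powr_add powr_realpow)
    finally have "0 \<le> d + int D"
      using powr_le_cancel_iff[of 2 0 "d + int D"] by simp
    have "t = Re z - 2 powr d * Re w"
      using re by (simp add: t_def algebra_simps)
    also have "\<bar>\<dots>\<bar> \<le> \<bar>Re z\<bar> + \<bar>2 powr d * Re w\<bar>" by (rule abs_triangle_ineq4)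
    also have "\<dots> \<le> R + 2 ^ D * R"
      using b d1 by (intro add_mono) (auto simp: abs_mult intro!: mult_mono)
    finally have tb: "\<bar>t\<bar> \<le> R + 2 ^ D * R" .
    define c :: int where "c = 2 ^ nat (d + int D) * ca q - 2 ^ D * ca p"
    have "2 powr d * 2 ^ D = 2 powr (d + int D)" by (simp add: powr_add powr_realpow)
    also have "\<dots> = 2 powr (nat (d + int D))" using \<open>0 \<le> d + int D\<close> by simp
    also have "\<dots> = 2 ^ nat (d + int D)" by (simp only: powr_realpow)
    finally have P: "2 powr d * 2 ^ D = (2::real) ^ nat (d + int D)" .
    have "2 ^ D * t = (2 powr d * 2 ^ D) * ca q - 2 ^ D * ca p"
      by (simp add: t_def right_diff_distrib mult_ac)
    then have c: "of_int c = 2 ^ D * t"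
      unfolding P by (simp add: c_def)
    have "\<bar>of_int c\<bar> \<le> 2 ^ D * (R + 2 ^ D * R)"
      unfolding c abs_mult using tb by simp
    then have "\<bar>c\<bar> \<le> T"
      unfolding T_def by linarith
    then have "c \<in> {- T..T}" by auto
    moreover have "t = of_int c / 2 ^ D" using c by simp
    ultimately have "t \<in> (\<lambda>c. real_of_int c / 2 ^ D) ` {- T..T}" by blast
    moreover have "d \<in> {- int D..int D}" using dD \<open>0 \<le> d + int D\<close> by auto
    ultimately have "(d, t) \<in> X" unfolding X_def by blast
    moreover have "near sh ce ca p q d t"
      using s by (simp add: near_def d_def t_def)
    ultimately show ?thesis by blast
  qed
  show ?thesis
    by (rule that[OF \<open>finite X\<close> near])
qed

text \<open>At time \<open>n\<close>, frame \<open>p\<close> lies in the sheet \<^term>\<open>sh n p\<close> and is placed there by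
  \<^term>\<open>place (ce n p) (ca n p)\<close>.  Each relative position is eventually kept or eventually avoided.\<close>

locale frames =
  fixes sh ce ca :: "nat \<Rightarrow> nat \<Rightarrow> int"
  assumes stable: "(\<forall>\<^sub>F n in sequentially. near (sh n) (ce n) (ca n) p q d t) \<or>
    (\<forall>\<^sub>F n in sequentially. \<not> near (sh n) (ce n) (ca n) p q d t)"
begin

definition linked :: "nat \<Rightarrow> nat \<Rightarrow> bool" where
  "linked p q \<longleftrightarrow> (\<exists>d t. \<forall>\<^sub>F n in sequentially. near (sh n) (ce n) (ca n) p q d t)"

definition rep :: "nat \<Rightarrow> bool" where
  "rep p \<longleftrightarrow> (\<forall>q<p. \<not> linked q p)"

lemma linked_refl: "linked p p"
  unfolding linked_def using near_refl by (auto intro!: exI always_eventually)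

lemma linked_trans: "linked p q \<Longrightarrow> linked q r \<Longrightarrow> linked p r"
  unfolding linked_def
proof clarify
  fix d t d' t'
  assume "\<forall>\<^sub>F n in sequentially. near (sh n) (ce n) (ca n) p q d t" "\<forall>\<^sub>F n in sequentially. near (sh n) (ce n) (ca n) q r d' t'"
  then have "\<forall>\<^sub>F n in sequentially. near (sh n) (ce n) (ca n) p r (d + d') (2 powr d * t' + t)"
    by eventually_elim (rule near_trans)
  then show "\<exists>d t. \<forall>\<^sub>F n in sequentially. near (sh n) (ce n) (ca n) p r d t" by blast
qed

lemma ex_rep: "\<exists>q\<le>p. rep q \<and> linked q p"
proof (induction p rule: less_induct)
  case (less p)
  show ?case
  proof (cases "rep p")
    case True
    then show ?thesis using linked_refl by blast
  next
    case False
    then obtain q where q: "q < p" "linked q p" by (auto simp: rep_def)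
    from less.IH[OF q(1)] obtain q' where "q' \<le> q" "rep q'" "linked q' q" by blast
    with q show ?thesis
      by (intro exI[of _ q']) (auto intro: linked_trans)
  qed
qed

text \<open>Frames whose boxes meet again and again take one of finitely many relative positions again and
  again.  This position is then eventually kept, so the frames are linked.\<close>

lemma rep_separated:
  assumes "rep q" "p < q"
  shows "\<forall>\<^sub>F n in sequentially. sh n p = sh n q \<longrightarrow>
    place (ce n p) (ca n p) ` hbox r \<inter> place (ce n q) (ca n q) ` hbox r = {}"
proof -
  obtain X where X: "finite X" "\<And>sh ce ca p q. sh p = sh q \<Longrightarrow> place (ce p) (ca p) ` hbox r \<inter> place (ce q) (ca q) ` hbox r \<noteq> {} \<Longrightarrow>
    \<exists>(d, t)\<in>X. near sh ce ca p q d t"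
    using finite_near by metis
  have "\<forall>\<^sub>F n in sequentially. \<not> near (sh n) (ce n) (ca n) p q (fst x) (snd x)" for x
    using stable[of p q "fst x" "snd x"] assms by (auto simp: rep_def linked_def)
  then have "\<forall>\<^sub>F n in sequentially. \<forall>x\<in>X. \<not> near (sh n) (ce n) (ca n) p q (fst x) (snd x)"
    using X(1) by (intro eventually_ball_finite) auto
  then show ?thesis
  proof eventually_elim
    case (elim n)
    then show ?case
      using X(2)[of "sh n" p q "ce n" "ca n"] by fastforce
  qed
qed

lemma reps_separated:
  assumes "finite R" "\<forall>p\<in>R. rep p"
  shows "\<forall>\<^sub>F n in sequentially. \<forall>p\<in>R. \<forall>q\<in>R. p \<noteq> q \<longrightarrow> sh n p = sh n q \<longrightarrow>
    place (ce n p) (ca n p) ` hbox r \<inter> place (ce n q) (ca n q) ` hbox r = {}"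
proof (intro eventually_ball_finite[OF assms(1)] ballI)
  fix p q assume pq: "p \<in> R" "q \<in> R"
  consider "p < q" | "p = q" | "q < p" by linarith
  then show "\<forall>\<^sub>F n in sequentially. p \<noteq> q \<longrightarrow> sh n p = sh n q \<longrightarrow>
    place (ce n p) (ca n p) ` hbox r \<inter> place (ce n q) (ca n q) ` hbox r = {}"
  proof cases
    case 1
    from rep_separated[OF bspec[OF assms(2) pq(2)] 1, of r] show ?thesis by eventually_elim auto
  next
    case 3
    from rep_separated[OF bspec[OF assms(2) pq(1)] 3, of r] show ?thesis by eventually_elim (auto simp: Int_commute)
  qed simp
qed

text \<open>The relative position of a frame and its representative is eventually constant, so the compact
  region around the frame lies in a fixed box around the representative.\<close>

lemma strip_near_rep:
  obtains q r where "q \<le> p" "rep q" "\<forall>\<^sub>F n in sequentially. sh n q = sh n p \<and> place (ce n p) (ca n p) ` strip k \<subseteq> place (ce n q) (ca n q) ` hbox r"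
proof -
  obtain q d t where q: "q \<le> p" "rep q" "\<forall>\<^sub>F n in sequentially. near (sh n) (ce n) (ca n) q p d t"
    using ex_rep[of p] by (auto simp: linked_def)
  have "compact (hiso (2 powr d) t ` hbox (2 ^ Suc k))"
    by (intro compact_continuous_image continuous_intros compact_hbox)
  moreover have "hiso (2 powr d) t ` hbox (2 ^ Suc k) \<subseteq> hyp_plane"
    using hiso_hyp_plane[of "2 powr d" t] hbox_subset_hyp_plane by auto
  ultimately obtain r where "hiso (2 powr d) t ` hbox (2 ^ Suc k) \<subseteq> hbox r"
    by (rule compact_subset_hbox)
  then have r: "hiso (2 powr d) t ` strip k \<subseteq> hbox r"
    using strip_subset_hbox[of k] by blast
  from q(3) have "\<forall>\<^sub>F n in sequentially. sh n q = sh n p \<and> place (ce n p) (ca n p) ` strip k \<subseteq> place (ce n q) (ca n q) ` hbox r"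
  proof eventually_elim
    case (elim n)
    from near_place[OF elim] r show ?case
      using elim by (auto simp: near_def)
  qed
  with q show ?thesis using that by blast
qed

end

section \<open>Infinite sums and subsequences\<close>

lemma sum_le_infsum_ennreal:
  fixes f :: "'a \<Rightarrow> ennreal"
  shows "finite F \<Longrightarrow> F \<subseteq> A \<Longrightarrow> sum f F \<le> infsum f A"
  by (subst nonneg_infsum_complete) (auto intro: SUP_upper)

lemma infsum_ennreal_upper:
  fixes f :: "'a \<Rightarrow> ennreal"
  shows "f x \<le> infsum f UNIV"
  using sum_le_infsum_ennreal[of "{x}" UNIV f] by simp

lemma infsum_ennreal_leI:
  fixes f :: "'a \<Rightarrow> ennreal"
  shows "(\<And>F. finite F \<Longrightarrow> F \<subseteq> A \<Longrightarrow> sum f F \<le> c) \<Longrightarrow> infsum f A \<le> c"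
  by (subst nonneg_infsum_complete) (auto intro: SUP_least)

lemma summable_on_ennreal: "(f :: 'a \<Rightarrow> ennreal) summable_on A"
  by (rule nonneg_summable_on_complete) simp

lemma sum_infsum_ennreal:
  fixes f :: "'a \<Rightarrow> 'b \<Rightarrow> ennreal"
  assumes "finite S"
  shows "(\<Sum>s\<in>S. infsum (f s) A) = infsum (\<lambda>x. \<Sum>s\<in>S. f s x) A"
  using assms
proof induction
  case (insert s S)
  then show ?case
    by (simp add: infsum_add summable_on_ennreal)
qed simp

text \<open>Cantor's diagonal argument for countably many bounded real sequences.\<close>

lemma common_convergent_subsequence:
  fixes x :: "'i::countable \<Rightarrow> nat \<Rightarrow> real"
  assumes "\<And>i n. \<bar>x i n\<bar> \<le> B i"
  obtains r where "strict_mono r" "\<And>i. convergent (\<lambda>n. x i (r n))"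
proof -
  let ?P = "\<lambda>k s. convergent (\<lambda>n. x (from_nat k) (s n))"
  interpret subseqs ?P
  proof
    fix k and s :: "nat \<Rightarrow> nat"
    have bd: "\<forall>n. x (from_nat k) (s n) \<in> {- B (from_nat k)..B (from_nat k)}"
      using assms[of "from_nat k"] by (auto simp: abs_le_iff minus_le_iff)
    have "\<exists>l\<in>{- B (from_nat k)..B (from_nat k)}. \<exists>r. strict_mono r \<and> ((\<lambda>n. x (from_nat k) (s n)) \<circ> r) \<longlonglongrightarrow> l"
      by (rule compact_Icc[unfolded compact_def, THEN spec, THEN mp, OF bd])
    then obtain l r where "strict_mono r" "((\<lambda>n. x (from_nat k) (s n)) \<circ> r) \<longlonglongrightarrow> l"
      by blast
    then show "\<exists>r. strict_mono r \<and> ?P k (s \<circ> r)"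
      by (auto simp: o_def convergent_def)
  qed
  have "convergent (\<lambda>n. x i (diagseq n))" for i
  proof -
    have "?P (to_nat i) (diagseq \<circ> ((+) (Suc (to_nat i))))"
    proof (rule diagseq_holds)
      fix r s :: "nat \<Rightarrow> nat" and n assume "strict_mono r" "?P n s"
      then show "?P n (s \<circ> r)"
        using convergent_subseq_convergent[of "\<lambda>k. x (from_nat n) (s k)" r] by (simp add: o_def)
    qed
    then have "convergent (\<lambda>n. x i (diagseq (n + Suc (to_nat i))))"
      by (simp add: o_def add.commute)
    then show ?thesis
      by (rule convergent_ignore_initial_segment[THEN iffD1])
  qed
  with subseq_diagseq show ?thesis using that by blast
qed

section \<open>Concentration\<close>

lemma emeasure_hypvol_ge:
  assumes "A \<in> sets borel" "A \<subseteq> hyp_plane" "\<And>p. p \<in> A \<Longrightarrow> Im p \<le> c" "0 < c"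
  shows "ennreal (1 / c\<^sup>2) * emeasure lborel A \<le> emeasure hypvol A"
proof -
  have "ennreal (1 / c\<^sup>2) * emeasure lborel A = (\<integral>\<^sup>+z. ennreal (1 / c\<^sup>2) * indicator A z \<partial>lborel)"
    using assms by (subst nn_integral_cmult_indicator) auto
  also have "\<dots> \<le> (\<integral>\<^sup>+z. indicator hyp_plane z * ennreal (1 / (Im z)\<^sup>2) * indicator A z \<partial>lborel)"
  proof (rule nn_integral_mono)
    fix z
    show "ennreal (1 / c\<^sup>2) * indicator A z \<le> indicator hyp_plane z * ennreal (1 / (Im z)\<^sup>2) * indicator A z"
    proof (cases "z \<in> A")
      case True
      then have "0 < Im z" "Im z \<le> c" "z \<in> hyp_plane" using assms by (auto simp: hyp_plane_def)
      then have "1 / c\<^sup>2 \<le> 1 / (Im z)\<^sup>2"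
        using assms(4) by (intro divide_left_mono power_mono) auto
      then show ?thesis using True \<open>z \<in> hyp_plane\<close> by (auto intro: ennreal_leI)
    qed simp
  qed
  also have "\<dots> = emeasure hypvol A"
    unfolding hypvol_def using assms by (subst emeasure_density) auto
  finally show ?thesis .
qed

text \<open>The sheets and frames \<open>(s, e, a)\<close> such that one of the cells \<open>(e, a, b)\<close> of level \<open>k\<close> in sheet \<open>s\<close> is
  more than half filled.\<close>

definition heavy :: "(int \<Rightarrow> complex set) \<Rightarrow> nat \<Rightarrow> (int \<times> int \<times> int) set" where
  "heavy U k = {(s, e, a). \<exists>b. (e, a, b) \<in> level k \<and> measure lborel (cell e a b) / 2 < measure lborel (U s \<inter> cell e a b)}"

text \<open>Each heavy index accounts for a fixed amount of mass, in disjoint cells.\<close>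

lemma card_heavy:
  assumes U: "\<And>s. U s \<in> sets hyp_measure" and m: "(\<Sum>\<^sub>\<infinity>s\<in>UNIV. emeasure hypvol (U s)) \<le> ennreal m" "0 \<le> m"
  shows "finite (heavy U k) \<and> card (heavy U k) \<le> nat \<lfloor>2 * 4 ^ Suc k * m\<rfloor>"
proof (rule finite_if_finite_subsets_card_bdd)
  fix X assume X: "X \<subseteq> heavy U k" "finite X"
  have Ub [measurable, simp]: "U s \<in> sets borel" for s using U by (auto simp: sets_hyp_measure)
  have "\<forall>x\<in>X. \<exists>b. (fst (snd x), snd (snd x), b) \<in> level k \<and>
      measure lborel (cell (fst (snd x)) (snd (snd x)) b) / 2 < measure lborel (U (fst x) \<inter> cell (fst (snd x)) (snd (snd x)) b)"
    using X by (auto simp: heavy_def)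
  then obtain b where b: "\<And>x. x \<in> X \<Longrightarrow> (fst (snd x), snd (snd x), b x) \<in> level k"
      "\<And>x. x \<in> X \<Longrightarrow> measure lborel (cell (fst (snd x)) (snd (snd x)) (b x)) / 2 < measure lborel (U (fst x) \<inter> cell (fst (snd x)) (snd (snd x)) (b x))"
    by metis
  define Q where "Q x = cell (fst (snd x)) (snd (snd x)) (b x)" for x
  have [measurable, simp]: "Q x \<in> sets borel" for x by (simp add: Q_def)
  have disj: "Q x \<inter> Q y = {}" if "x \<in> X" "y \<in> X" "x \<noteq> y" "fst x = fst y" for x y
  proof -
    have "(fst (snd x), snd (snd x), b x) \<noteq> (fst (snd y), snd (snd y), b y)"
      using that by (auto simp: prod_eq_iff)
    then show ?thesis
      using disjoint_cells[of k] b(1)[OF that(1)] b(1)[OF that(2)] unfolding Q_def disjoint_family_on_def by fastforce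
  qed
  \<comment> \<open>At least half of a square of side \<open>h\<close> is filled, below the height \<open>2 ^ (k + 1) h\<close>.\<close>
  have lower: "ennreal (1 / (2 * 4 ^ Suc k)) \<le> emeasure hypvol (U (fst x) \<inter> Q x)" if x: "x \<in> X" for x
  proof -
    define h where "h = 2 powr (fst (snd x))"
    have h: "0 < h" by (simp add: h_def)
    have "b x + 1 \<le> 2 ^ Suc k" using b(1)[OF x] by (simp add: level_def)
    then have bk: "real (b x + 1) \<le> real (2 ^ Suc k)" by (simp only: of_nat_le_iff)
    have "measure lborel (Q x) = h * h"
      by (simp add: Q_def cell_def measure_def emeasure_square h_def)
    then have half: "h * h / 2 \<le> measure lborel (U (fst x) \<inter> Q x)"
      using b(2)[OF x] by (simp add: Q_def)
    have fin: "emeasure lborel (U (fst x) \<inter> Q x) = ennreal (measure lborel (U (fst x) \<inter> Q x))"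
      using fmeasurableI2[OF fmeasurable_cell, of "U (fst x) \<inter> Q x"] by (intro emeasure_eq_measure2) (auto simp: Q_def)
    have eq: "1 / (2 * 4 ^ Suc k) = 1 / (h * 2 ^ Suc k)\<^sup>2 * (h * h / 2)"
    proof -
      have "(4::real) ^ Suc k = (2 ^ Suc k)\<^sup>2"
        by (simp add: power2_eq_square flip: power_mult_distrib)
      then show ?thesis using h by (simp add: power2_eq_square)
    qed
    have "ennreal (1 / (2 * 4 ^ Suc k)) = ennreal (1 / (h * 2 ^ Suc k)\<^sup>2) * ennreal (h * h / 2)"
      unfolding eq using h by (intro ennreal_mult) auto
    also have "\<dots> \<le> ennreal (1 / (h * 2 ^ Suc k)\<^sup>2) * emeasure lborel (U (fst x) \<inter> Q x)"
      unfolding fin by (intro mult_left_mono ennreal_leI half) simp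
    also have "\<dots> \<le> emeasure hypvol (U (fst x) \<inter> Q x)"
    proof (rule emeasure_hypvol_ge)
      show "U (fst x) \<inter> Q x \<subseteq> hyp_plane" using U[of "fst x"] by (auto simp: sets_hyp_measure)
      show "Im z \<le> h * 2 ^ Suc k" if "z \<in> U (fst x) \<inter> Q x" for z
      proof -
        have "Im z < h * b x + h" using that by (auto simp: Q_def cell_def square_def h_def)
        also have "\<dots> = h * real (b x + 1)" by (simp add: distrib_left)
        also have "\<dots> \<le> h * real (2 ^ Suc k)" using h bk by (intro mult_left_mono) auto
        finally show ?thesis by simp
      qed
      show "0 < h * 2 ^ Suc k" using h by simp
    qed simp
    finally show ?thesis .
  qed
  have "of_nat (card X) * ennreal (1 / (2 * 4 ^ Suc k)) = (\<Sum>x\<in>X. ennreal (1 / (2 * 4 ^ Suc k)))"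
    by simp
  also have "\<dots> \<le> (\<Sum>x\<in>X. emeasure hypvol (U (fst x) \<inter> Q x))"
    by (rule sum_mono) (rule lower)
  also have "\<dots> = (\<Sum>s\<in>fst ` X. \<Sum>x\<in>{x \<in> X. fst x = s}. emeasure hypvol (U s \<inter> Q x))"
    by (subst sum.image_gen[OF X(2), of _ fst]) (auto intro!: sum.cong)
  also have "\<dots> \<le> (\<Sum>s\<in>fst ` X. emeasure hypvol (U s))"
  proof (rule sum_mono)
    fix s
    have "(\<Sum>x\<in>{x \<in> X. fst x = s}. emeasure hypvol (U s \<inter> Q x)) = emeasure hypvol (\<Union>x\<in>{x \<in> X. fst x = s}. U s \<inter> Q x)"
    proof (rule sum_emeasure)
      show "disjoint_family_on (\<lambda>x. U s \<inter> Q x) {x \<in> X. fst x = s}"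
        unfolding disjoint_family_on_def using disj by blast
    qed (use X in auto)
    also have "\<dots> \<le> emeasure hypvol (U s)"
      by (rule emeasure_mono) auto
    finally show "(\<Sum>x\<in>{x \<in> X. fst x = s}. emeasure hypvol (U s \<inter> Q x)) \<le> emeasure hypvol (U s)" .
  qed
  also have "\<dots> \<le> ennreal m"
    using sum_le_infsum_ennreal[of "fst ` X" UNIV "\<lambda>s. emeasure hypvol (U s)"] X m by (auto intro: order_trans)
  finally have "of_nat (card X) * ennreal (1 / (2 * 4 ^ Suc k)) \<le> ennreal m" .
  moreover have "ennreal (real (card X) * (1 / (2 * 4 ^ Suc k))) = of_nat (card X) * ennreal (1 / (2 * 4 ^ Suc k))"
    unfolding ennreal_of_nat_eq_real_of_nat by (rule ennreal_mult) auto
  ultimately have "ennreal (real (card X) * (1 / (2 * 4 ^ Suc k))) \<le> ennreal m"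
    by (simp only:)
  then have "real (card X) * (1 / (2 * 4 ^ Suc k)) \<le> m"
    using m(2) by (subst (asm) ennreal_le_iff) auto
  then have "real (card X) \<le> 2 * 4 ^ Suc k * m"
    by (simp add: field_simps)
  then show "card X \<le> nat \<lfloor>2 * 4 ^ Suc k * m\<rfloor>"
    by (simp add: le_nat_floor)
qed

lemma mass_outside_heavy:
  fixes sh ce ca :: "nat \<Rightarrow> int"
  assumes U: "\<And>s. U s \<in> sets hyp_measure" and C: "(\<Sum>\<^sub>\<infinity>s\<in>UNIV. perimeter (U s)) \<le> ennreal C" "0 \<le> C"
    and hv: "heavy U k \<subseteq> (\<lambda>p. (sh p, ce p, ca p)) ` {..<K}" and S: "finite S"
  shows "(\<Sum>s\<in>S. emeasure hypvol (U s - (\<Union>p\<in>{p. p < K \<and> sh p = s}. place (ce p) (ca p) ` strip k))) \<le> ennreal (128 * scale k * C)"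
proof -
  have Ub [measurable, simp]: "U s \<in> sets borel" for s using U by (auto simp: sets_hyp_measure)
  have each: "emeasure hypvol (U s - (\<Union>p\<in>{p. p < K \<and> sh p = s}. place (ce p) (ca p) ` strip k)) \<le> ennreal (128 * scale k) * perimeter (U s)"
    if fin: "perimeter (U s) < \<infinity>" for s
  proof -
    obtain c where c: "perimeter (U s) = ennreal c" "0 \<le> c"
      using fin by (cases "perimeter (U s)") auto
    define L where "L = {q \<in> level k. measure lborel (U s \<inter> cell' q) \<le> measure lborel (cell' q) / 2}"
    have "U s - (\<Union>p\<in>{p. p < K \<and> sh p = s}. place (ce p) (ca p) ` strip k) \<subseteq> U s \<inter> (\<Union>q\<in>L. cell' q)"
    proof
      fix z assume z: "z \<in> U s - (\<Union>p\<in>{p. p < K \<and> sh p = s}. place (ce p) (ca p) ` strip k)"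
      then have "z \<in> hyp_plane" using U[of s] by (auto simp: sets_hyp_measure)
      from cells_cover[OF this, of k] obtain e a b where q: "(e, a, b) \<in> level k" "z \<in> cell e a b" .
      have "(e, a, b) \<in> L"
      proof (rule ccontr)
        assume "(e, a, b) \<notin> L"
        then have "(s, e, a) \<in> heavy U k"
          using q by (auto simp: L_def heavy_def not_le)
        then obtain p where "p < K" "sh p = s" "ce p = e" "ca p = a"
          using hv by auto
        with z q cell_subset_strip[OF q(1)] show False by blast
      qed
      with q z show "z \<in> U s \<inter> (\<Union>q\<in>L. cell' q)"
        by (auto intro!: bexI[of _ "(e, a, b)"])
    qed
    then have "emeasure hypvol (U s - (\<Union>p\<in>{p. p < K \<and> sh p = s}. place (ce p) (ca p) ` strip k)) \<le> emeasure hypvol (U s \<inter> (\<Union>q\<in>L. cell' q))"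
      by (rule emeasure_mono) (auto intro!: sets.Int sets.countable_UN')
    also have "\<dots> \<le> ennreal (128 * scale k * c)"
      by (rule light_cells[OF U _ c(2)]) (auto simp: c L_def)
    also have "\<dots> = ennreal (128 * scale k) * perimeter (U s)"
      unfolding c by (rule ennreal_mult) (use c in auto)
    finally show ?thesis .
  qed
  have fin: "perimeter (U s) < \<infinity>" for s
  proof -
    have "(\<Sum>s\<in>{s}. perimeter (U s)) \<le> (\<Sum>\<^sub>\<infinity>s\<in>UNIV. perimeter (U s))"
      by (rule sum_le_infsum_ennreal) auto
    then have "perimeter (U s) \<le> ennreal C" using C by auto
    then show ?thesis by (rule order_le_less_trans) simp
  qed
  have "(\<Sum>s\<in>S. emeasure hypvol (U s - (\<Union>p\<in>{p. p < K \<and> sh p = s}. place (ce p) (ca p) ` strip k))) \<le>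
      (\<Sum>s\<in>S. ennreal (128 * scale k) * perimeter (U s))"
    by (intro sum_mono each fin)
  also have "\<dots> = ennreal (128 * scale k) * (\<Sum>s\<in>S. perimeter (U s))"
    by (simp add: sum_distrib_left)
  also have "\<dots> \<le> ennreal (128 * scale k) * ennreal C"
    using sum_le_infsum_ennreal[OF S, of UNIV "\<lambda>s. perimeter (U s)"] C by (intro mult_left_mono) auto
  also have "\<dots> = ennreal (128 * scale k * C)"
    using C by (intro ennreal_mult[symmetric]) auto
  finally show ?thesis .
qed

text \<open>Outside the strips of the heavy indices there are only light cells, and each of these strips lies in
  the region seen from some frame in \<open>R\<close>.\<close>

lemma mass_le_views:
  fixes sh ce ca :: "nat \<Rightarrow> int"
  assumes U: "\<And>s. U s \<in> sets hyp_measure" and C: "(\<Sum>\<^sub>\<infinity>s\<in>UNIV. perimeter (U s)) \<le> ennreal C" "0 \<le> C"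
    and hv: "heavy U k \<subseteq> (\<lambda>p. (sh p, ce p, ca p)) ` {..<K}"
    and R: "finite R" "\<And>p. p < K \<Longrightarrow> \<exists>q\<in>R. sh q = sh p \<and> place (ce p) (ca p) ` strip k \<subseteq> place (ce q) (ca q) ` hbox r"
  shows "(\<Sum>\<^sub>\<infinity>s\<in>UNIV. emeasure hypvol (U s)) \<le> ennreal (128 * scale k * C) +
    (\<Sum>q\<in>R. emeasure hypvol (place (ce q) (ca q) -` U (sh q) \<inter> hbox r))"
proof (rule infsum_ennreal_leI)
  fix S :: "int set" assume S: "finite S"
  have Ub [measurable, simp]: "U s \<in> sets borel" for s using U by (auto simp: sets_hyp_measure)
  have pb [simp]: "place e a ` hbox r \<in> sets borel" for e a by (rule place_image_borel) simp
  define g where "g q = emeasure hypvol (place (ce q) (ca q) -` U (sh q) \<inter> hbox r)" for q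
  define Out where "Out s = U s - (\<Union>p\<in>{p. p < K \<and> sh p = s}. place (ce p) (ca p) ` strip k)" for s
  have "strip k \<in> sets borel"
  proof -
    have "strip k = {z \<in> space borel. 0 \<le> Re z \<and> Re z < 1 \<and> 2 ^ k \<le> Im z \<and> Im z < 2 ^ Suc k}"
      by (simp add: strip_def)
    also have "\<dots> \<in> sets borel" by measurable
    finally show ?thesis .
  qed
  then have Outb [simp]: "Out s \<in> sets borel" for s
    unfolding Out_def by (intro sets.Diff sets.countable_UN') (auto simp: place_image_borel)
  have each: "emeasure hypvol (U s) \<le> emeasure hypvol (Out s) + (\<Sum>q\<in>R. if sh q = s then g q else 0)" for s
  proof -
    have "emeasure hypvol (U s) \<le> emeasure hypvol (Out s \<union> (\<Union>q\<in>{q \<in> R. sh q = s}. U s \<inter> place (ce q) (ca q) ` hbox r))"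
    proof (rule emeasure_mono)
      show "U s \<subseteq> Out s \<union> (\<Union>q\<in>{q \<in> R. sh q = s}. U s \<inter> place (ce q) (ca q) ` hbox r)"
      proof
        fix z assume z: "z \<in> U s"
        show "z \<in> Out s \<union> (\<Union>q\<in>{q \<in> R. sh q = s}. U s \<inter> place (ce q) (ca q) ` hbox r)"
        proof (cases "z \<in> Out s")
          case False
          with z obtain p where p: "p < K" "sh p = s" "z \<in> place (ce p) (ca p) ` strip k"
            by (auto simp: Out_def)
          with R(2)[OF p(1)] z show ?thesis by blast
        qed simp
      qed
    qed (use R in \<open>auto intro!: sets.Un sets.finite_UN\<close>)
    also have "\<dots> \<le> emeasure hypvol (Out s) + emeasure hypvol (\<Union>q\<in>{q \<in> R. sh q = s}. U s \<inter> place (ce q) (ca q) ` hbox r)"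
      using R by (intro emeasure_subadditive) (auto intro!: sets.finite_UN)
    also have "\<dots> \<le> emeasure hypvol (Out s) + (\<Sum>q\<in>{q \<in> R. sh q = s}. emeasure hypvol (U s \<inter> place (ce q) (ca q) ` hbox r))"
      using R by (intro add_left_mono emeasure_subadditive_finite) auto
    also have "(\<Sum>q\<in>{q \<in> R. sh q = s}. emeasure hypvol (U s \<inter> place (ce q) (ca q) ` hbox r)) = (\<Sum>q\<in>{q \<in> R. sh q = s}. g q)"
      by (intro sum.cong) (auto simp: g_def emeasure_place_inter)
    also have "\<dots> = (\<Sum>q\<in>R. if sh q = s then g q else 0)"
      using R(1) by (simp add: sum.inter_filter)
    finally show ?thesis .
  qed
  have "(\<Sum>s\<in>S. emeasure hypvol (U s)) \<le> (\<Sum>s\<in>S. emeasure hypvol (Out s) + (\<Sum>q\<in>R. if sh q = s then g q else 0))"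
    by (intro sum_mono each)
  also have "\<dots> = (\<Sum>s\<in>S. emeasure hypvol (Out s)) + (\<Sum>s\<in>S. \<Sum>q\<in>R. if sh q = s then g q else 0)"
    by (rule sum.distrib)
  also have "(\<Sum>s\<in>S. \<Sum>q\<in>R. if sh q = s then g q else 0) = (\<Sum>q\<in>R. \<Sum>s\<in>S. if sh q = s then g q else 0)"
    by (rule sum.swap)
  also have "\<dots> \<le> (\<Sum>q\<in>R. g q)"
    using S by (intro sum_mono) (auto simp: sum.delta')
  also have "(\<Sum>s\<in>S. emeasure hypvol (Out s)) \<le> ennreal (128 * scale k * C)"
    unfolding Out_def by (rule mass_outside_heavy[OF U C hv S])
  finally show "(\<Sum>s\<in>S. emeasure hypvol (U s)) \<le> ennreal (128 * scale k * C) + (\<Sum>q\<in>R. emeasure hypvol (place (ce q) (ca q) -` U (sh q) \<inter> hbox r))"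
    by (simp add: g_def add_mono)
qed

lemma finite_enumeration:
  assumes "finite X" "card X \<le> K"
  obtains f :: "nat \<Rightarrow> 'a" where "X \<subseteq> f ` {..<K}"
proof -
  obtain f :: "nat \<Rightarrow> 'a" where "bij_betw f {0..<card X} X"
    using ex_bij_betw_nat_finite[OF assms(1)] by blast
  then have "X \<subseteq> f ` {..<K}"
    using assms(2) unfolding bij_betw_def by force
  then show ?thesis by (rule that)
qed

section \<open>Areas of rectangles and of local limits\<close>

lemma perimeter_empty: "perimeter {} = 0"
  by (subst perimeter_eq) (auto simp: flux_def SUP_constant bot_ennreal)

text \<open>Since the integral of \<open>1 / y\<^sup>2\<close> from 1 to 2 is 1/2, a rectangle of length \<open>2c\<close> will do.\<close>

lemma exists_set_of_area:
  assumes "0 \<le> c"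
  obtains B where "B \<in> sets hyp_measure" "emeasure hypvol B = ennreal c"
proof -
  define B where "B = {z. Re z \<in> {0..2 * c} \<and> Im z \<in> {1..2}}"
  have "B = {z \<in> space borel. Re z \<in> {0..2 * c} \<and> Im z \<in> {1..2}}" by (simp add: B_def)
  also have "\<dots> \<in> sets borel" by measurable
  finally have Bb [measurable]: "B \<in> sets borel" .
  have half: "(\<integral>\<^sup>+y. ennreal (1 / y\<^sup>2) * indicator {1..2} y \<partial>lborel) = ennreal (- (1 / 2) - (- (1 / 1)))"
  proof (rule nn_integral_FTC_Icc)
    show "((\<lambda>y. - (1 / y)) has_real_derivative 1 / x\<^sup>2) (at x)" if "x \<in> {1..2}" for x :: real
      using that by (auto intro!: derivative_eq_intros simp: power2_eq_square)
  qed auto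
  have "emeasure hypvol B = (\<integral>\<^sup>+z. indicator B z \<partial>hypvol)" by simp
  also have "\<dots> = (\<integral>\<^sup>+y. indicator {0<..} y * ennreal (1 / y\<^sup>2) * (\<integral>\<^sup>+x. indicator B (Complex x y) \<partial>lborel) \<partial>lborel)"
    by (rule nn_integral_hypvol) simp
  also have "\<dots> = (\<integral>\<^sup>+y. ennreal (2 * c) * (ennreal (1 / y\<^sup>2) * indicator {1..2} y) \<partial>lborel)"
  proof (rule nn_integral_cong)
    fix y :: real
    have "(\<integral>\<^sup>+x. indicator B (Complex x y) \<partial>lborel) = (\<integral>\<^sup>+x. indicator {1..2} y * indicator {0..2 * c} x \<partial>lborel)"
      by (intro nn_integral_cong) (auto simp: B_def indicator_def)
    also have "\<dots> = indicator {1..2} y * ennreal (2 * c)"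
      using assms by (subst nn_integral_cmult) auto
    finally show "indicator {0<..} y * ennreal (1 / y\<^sup>2) * (\<integral>\<^sup>+x. indicator B (Complex x y) \<partial>lborel) =
        ennreal (2 * c) * (ennreal (1 / y\<^sup>2) * indicator {1..2} y)"
      by (auto simp: indicator_def mult.commute)
  qed
  also have "\<dots> = ennreal (2 * c) * ennreal (1 / 2)"
    by (subst nn_integral_cmult) (simp_all add: half)
  also have "\<dots> = ennreal c"
    using assms by (subst ennreal_mult[symmetric]) auto
  finally have "emeasure hypvol B = ennreal c" .
  moreover have "B \<in> sets hyp_measure"
    using Bb by (auto simp: sets_hyp_measure B_def hyp_plane_def)
  ultimately show ?thesis using that by blast
qed

lemma loc_conv_emeasure_hbox:
  assumes "\<And>n. A n \<in> sets hyp_measure" "B \<in> sets hyp_measure" "loc_conv A B"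
  shows "(\<lambda>n. emeasure hypvol (A n \<inter> hbox r)) \<longlonglongrightarrow> emeasure hypvol (B \<inter> hbox r)"
proof -
  have "emeasure hypvol (X \<inter> hbox r) = ennreal (measure hypvol (X \<inter> hbox r))" if "X \<in> sets hyp_measure" for X
    using that by (intro emeasure_eq_measure2 fmeasurable_inter_hbox) (simp add: sets_hyp_measure)
  then show ?thesis
    using assms loc_conv_measure[OF assms, of "hbox r" r] by (simp add: tendsto_ennrealI)
qed

lemma loc_conv_emeasure_le:
  assumes "\<And>n. A n \<in> sets hyp_measure" "B \<in> sets hyp_measure" "loc_conv A B" "\<And>n. emeasure hypvol (A n) \<le> c"
  shows "emeasure hypvol B \<le> c"
proof (rule LIMSEQ_le_const2[OF hbox_exhausts[OF assms(2)]], intro exI allI impI)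
  fix r
  show "emeasure hypvol (B \<inter> hbox r) \<le> c"
  proof (rule LIMSEQ_le_const2[OF loc_conv_emeasure_hbox[OF assms(1-3)]], intro exI allI impI)
    fix n
    have "emeasure hypvol (A n \<inter> hbox r) \<le> emeasure hypvol (A n)"
      using assms(1)[of n] by (intro emeasure_mono) (auto simp: sets_hyp_measure)
    then show "emeasure hypvol (A n \<inter> hbox r) \<le> c" using assms(4)[of n] by simp
  qed
qed

section \<open>Frames following the mass\<close>

text \<open>There is a frame for every heavy index of every chamber \<open>i\<close> and level \<open>k\<close>; the number of a frame
  encodes \<open>i\<close>, \<open>k\<close> and the position in an enumeration of the heavy indices, whose length is
  bounded independently of \<open>n\<close>.  The relative positions of two frames and the areas in the cells are
  countably many bounded sequences, which converge along a common subsequence.\<close>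

lemma exists_frames:
  fixes U :: "nat \<Rightarrow> nat \<Rightarrow> int \<Rightarrow> complex set"
  assumes U: "\<And>n i s. i \<in> I \<Longrightarrow> U n i s \<in> sets hyp_measure"
    and m: "\<And>n i. i \<in> I \<Longrightarrow> (\<Sum>\<^sub>\<infinity>s\<in>UNIV. emeasure hypvol (U n i s)) \<le> ennreal (m i)" "\<And>i. i \<in> I \<Longrightarrow> 0 \<le> m i"
  obtains \<rho> sh ce ca K where "strict_mono \<rho>" "frames sh ce ca"
    "\<And>n i k. i \<in> I \<Longrightarrow> heavy (U (\<rho> n) i) k \<subseteq> (\<lambda>p. (sh n p, ce n p, ca n p)) ` {..<K i k}"
    "\<And>i p e a b. i \<in> I \<Longrightarrow> convergent (\<lambda>n. measure lborel (place (ce n p) (ca n p) -` U (\<rho> n) i (sh n p) \<inter> cell e a b))"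
proof -
  define L where "L i k = nat \<lfloor>2 * 4 ^ Suc k * m i\<rfloor>" for i k
  have "\<forall>n i k. \<exists>g. i \<in> I \<longrightarrow> heavy (U n i) k \<subseteq> g ` {..<L i k}"
  proof (intro allI)
    fix n i k
    show "\<exists>g. i \<in> I \<longrightarrow> heavy (U n i) k \<subseteq> g ` {..<L i k}"
    proof (cases "i \<in> I")
      case True
      have "finite (heavy (U n i) k) \<and> card (heavy (U n i) k) \<le> L i k"
        unfolding L_def by (rule card_heavy[OF U[OF True] m(1)[OF True] m(2)[OF True]])
      then show ?thesis
        using finite_enumeration by metis
    qed simp
  qed
  then obtain g where g: "\<And>n i k. i \<in> I \<Longrightarrow> heavy (U n i) k \<subseteq> g n i k ` {..<L i k}"
    by metis
  define fr where "fr n p = (case prod_decode p of (i, kj) \<Rightarrow> case prod_decode kj of (k, j) \<Rightarrow> g n i k j)" for n p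
  define K where "K i k = Suc (\<Sum>j<L i k. prod_encode (i, prod_encode (k, j)))" for i k
  have hv: "heavy (U n i) k \<subseteq> fr n ` {..<K i k}" if i: "i \<in> I" for n i k
  proof
    fix x assume "x \<in> heavy (U n i) k"
    then obtain j where j: "j < L i k" "x = g n i k j"
      using g[OF i, of n k] by auto
    have "prod_encode (i, prod_encode (k, j)) \<le> (\<Sum>j<L i k. prod_encode (i, prod_encode (k, j)))"
      using j by (intro member_le_sum[of j _ "\<lambda>j. prod_encode (i, prod_encode (k, j))"]) auto
    then show "x \<in> fr n ` {..<K i k}"
      using j by (intro image_eqI[of _ _ "prod_encode (i, prod_encode (k, j))"]) (auto simp: fr_def K_def)
  qed
  define sh0 where "sh0 n p = fst (fr n p)" for n p
  define ce0 where "ce0 n p = fst (snd (fr n p))" for n p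
  define ca0 where "ca0 n p = snd (snd (fr n p))" for n p
  define x :: "(nat \<times> nat \<times> int \<times> int \<times> int) + (nat \<times> nat \<times> int \<times> int \<times> nat) \<Rightarrow> nat \<Rightarrow> real"
    where "x y n = (case y of
        Inl (p, q, d, a', a) \<Rightarrow> of_bool (near (sh0 n) (ce0 n) (ca0 n) p q d (2 powr d * a' - a))
      | Inr (p, i, e, a, b) \<Rightarrow> measure lborel (place (ce0 n p) (ca0 n p) -` U n i (sh0 n p) \<inter> cell e a b))" for y n
  define B :: "(nat \<times> nat \<times> int \<times> int \<times> int) + (nat \<times> nat \<times> int \<times> int \<times> nat) \<Rightarrow> real"
    where "B y = (case y of Inl _ \<Rightarrow> 1 | Inr (p, i, e, a, b) \<Rightarrow> measure lborel (cell e a b))" for y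
  have "\<bar>x y n\<bar> \<le> B y" for y n
  proof (cases y)
    case (Inr z)
    obtain p i e a b where z: "z = (p, i, e, a, b)" by (cases z) auto
    have "measure lborel (A \<inter> cell e a b) \<le> measure lborel (cell e a b)" for A
    proof (cases "A \<inter> cell e a b \<in> sets lborel")
      case True
      then show ?thesis by (intro measure_mono_fmeasurable fmeasurable_cell) auto
    qed (simp add: measure_notin_sets)
    then show ?thesis by (simp add: x_def B_def Inr z)
  qed (auto simp: x_def B_def split: prod.splits)
  then obtain \<rho> where \<rho>: "strict_mono \<rho>" "\<And>y. convergent (\<lambda>n. x y (\<rho> n))"
    using common_convergent_subsequence by blast
  define sh where "sh n = sh0 (\<rho> n)" for n
  define ce where "ce n = ce0 (\<rho> n)" for n
  define ca where "ca n = ca0 (\<rho> n)" for n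
  have frames: "frames sh ce ca"
  proof
    fix p q d t
    show "(\<forall>\<^sub>F n in sequentially. near (sh n) (ce n) (ca n) p q d t) \<or> (\<forall>\<^sub>F n in sequentially. \<not> near (sh n) (ce n) (ca n) p q d t)"
    proof (cases "\<exists>a' a. t = 2 powr d * real_of_int a' - real_of_int a")
      case True
      then obtain a' a where t: "t = 2 powr d * real_of_int a' - real_of_int a" by blast
      have "convergent (\<lambda>n. of_bool (near (sh n) (ce n) (ca n) p q d t) :: real)"
        using \<rho>(2)[of "Inl (p, q, d, a', a)"] by (simp add: x_def t sh_def ce_def ca_def)
      then obtain l :: real where l: "(\<lambda>n. of_bool (near (sh n) (ce n) (ca n) p q d t)) \<longlonglongrightarrow> l"
        by (auto simp: convergent_def)
      show ?thesis
      proof (cases "l > 1 / 2")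
        case True
        from order_tendstoD(1)[OF l this]
        have "\<forall>\<^sub>F n in sequentially. near (sh n) (ce n) (ca n) p q d t"
        proof eventually_elim
          case (elim n)
          then show ?case by (cases "near (sh n) (ce n) (ca n) p q d t") auto
        qed
        then show ?thesis ..
      next
        case False
        then have "l < 1" by simp
        from order_tendstoD(2)[OF l this]
        have "\<forall>\<^sub>F n in sequentially. \<not> near (sh n) (ce n) (ca n) p q d t"
          by eventually_elim auto
        then show ?thesis ..
      qed
    next
      case False
      then have "\<not> near (sh n) (ce n) (ca n) p q d t" for n
        unfolding near_def by blast
      then show ?thesis by simp
    qed
  qed
  have heavy: "heavy (U (\<rho> n) i) k \<subseteq> (\<lambda>p. (sh n p, ce n p, ca n p)) ` {..<K i k}" if "i \<in> I" for n i k
    using hv[OF that, of "\<rho> n" k] by (simp add: sh_def ce_def ca_def sh0_def ce0_def ca0_def)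
  have conv: "convergent (\<lambda>n. measure lborel (place (ce n p) (ca n p) -` U (\<rho> n) i (sh n p) \<inter> cell e a b))" if "i \<in> I" for i p e a b
    using \<rho>(2)[of "Inr (p, i, e, a, b)"] by (simp add: x_def sh_def ce_def ca_def)
  show ?thesis
    by (rule that[OF \<rho>(1) frames heavy conv])
qed

section \<open>Limits seen from the frames\<close>

context frames
begin

definition view :: "(nat \<Rightarrow> int \<Rightarrow> complex set) \<Rightarrow> nat \<Rightarrow> nat \<Rightarrow> complex set" where
  "view U n p = place (ce n p) (ca n p) -` U n (sh n p)"

lemma view_sets: "(\<And>s. U n s \<in> sets hyp_measure) \<Longrightarrow> view U n p \<in> sets hyp_measure"
  unfolding view_def by (intro place_vimage_sets)

lemma sum_views_tendsto:
  assumes "\<And>n s. U n s \<in> sets hyp_measure" "\<And>p. V p \<in> sets hyp_measure" "\<And>p. loc_conv (\<lambda>n. view U n p) (V p)"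
  shows "(\<lambda>n. \<Sum>p\<in>R. emeasure hypvol (view U n p \<inter> hbox r)) \<longlonglongrightarrow> (\<Sum>p\<in>R. emeasure hypvol (V p \<inter> hbox r))"
  by (intro tendsto_sum loc_conv_emeasure_hbox view_sets assms)

text \<open>Eventually the representatives see disjoint parts of the sheets, inside any given box.\<close>

lemma sum_limits_emeasure_le:
  assumes U: "\<And>n s. U n s \<in> sets hyp_measure" and V: "\<And>p. V p \<in> sets hyp_measure" "\<And>p. loc_conv (\<lambda>n. view U n p) (V p)"
    and c: "\<And>n. (\<Sum>\<^sub>\<infinity>s\<in>UNIV. emeasure hypvol (U n s)) \<le> c" and R: "finite R" "\<forall>p\<in>R. rep p"
  shows "(\<Sum>p\<in>R. emeasure hypvol (V p)) \<le> c"
proof (rule LIMSEQ_le_const2)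
  show "(\<lambda>r. \<Sum>p\<in>R. emeasure hypvol (V p \<inter> hbox r)) \<longlonglongrightarrow> (\<Sum>p\<in>R. emeasure hypvol (V p))"
    by (intro tendsto_sum hbox_exhausts V)
  have "(\<Sum>p\<in>R. emeasure hypvol (V p \<inter> hbox r)) \<le> c" for r
  proof (rule tendsto_le[OF _ tendsto_const sum_views_tendsto[OF U V]])
    show "\<forall>\<^sub>F n in sequentially. (\<Sum>p\<in>R. emeasure hypvol (view U n p \<inter> hbox r)) \<le> c"
      using reps_separated[OF R, of r]
    proof eventually_elim
      case (elim n)
      have "(\<Sum>p\<in>R. emeasure hypvol (view U n p \<inter> hbox r)) \<le> (\<Sum>s\<in>sh n ` R. emeasure hypvol (U n s))"
        using elim unfolding view_def by (intro sum_view_measure_le R(1) U) blast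
      also have "\<dots> \<le> (\<Sum>\<^sub>\<infinity>s\<in>UNIV. emeasure hypvol (U n s))"
        using R(1) by (intro sum_le_infsum_ennreal) auto
      finally show ?case using c[of n] by simp
    qed
  qed simp
  then show "\<exists>r0. \<forall>r\<ge>r0. (\<Sum>p\<in>R. emeasure hypvol (V p \<inter> hbox r)) \<le> c" by blast
qed

text \<open>All mass except \<open>128 \<cdot> scale k \<cdot> C\<close> lies in the strips of the heavy indices.  These lie in finitely many
  fixed boxes around representatives, where local convergence preserves the mass; then \<open>k\<close> tends
  to infinity.\<close>

lemma mass_le_sum_limits:
  assumes U: "\<And>n s. U n s \<in> sets hyp_measure" and V: "\<And>p. V p \<in> sets hyp_measure" "\<And>p. loc_conv (\<lambda>n. view U n p) (V p)"
    and mass: "\<And>n. (\<Sum>\<^sub>\<infinity>s\<in>UNIV. emeasure hypvol (U n s)) = c"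
    and C: "\<And>n. (\<Sum>\<^sub>\<infinity>s\<in>UNIV. perimeter (U n s)) \<le> ennreal C" "0 \<le> C"
    and hv: "\<And>n k. heavy (U n) k \<subseteq> (\<lambda>p. (sh n p, ce n p, ca n p)) ` {..<K k}"
  shows "c \<le> (\<Sum>\<^sub>\<infinity>p\<in>Collect rep. emeasure hypvol (V p))"
proof -
  define T where "T = (\<Sum>\<^sub>\<infinity>p\<in>Collect rep. emeasure hypvol (V p))"
  have step: "c \<le> ennreal (128 * scale k * C) + T" for k
  proof -
    define Q where "Q p q r \<longleftrightarrow> rep q \<and> (\<forall>\<^sub>F n in sequentially. sh n q = sh n p \<and>
        place (ce n p) (ca n p) ` strip k \<subseteq> place (ce n q) (ca n q) ` hbox r)" for p q r
    have "\<exists>q r. Q p q r" for p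
      unfolding Q_def by (rule strip_near_rep[of p k]) blast
    then obtain q r where "\<And>p. Q p (q p) (r p)"
      by metis
    then have qr: "\<And>p. rep (q p)"
      "\<And>p. \<forall>\<^sub>F n in sequentially. sh n (q p) = sh n p \<and> place (ce n p) (ca n p) ` strip k \<subseteq> place (ce n (q p)) (ca n (q p)) ` hbox (r p)"
      unfolding Q_def by blast+
    define R where "R = q ` {..<K k}"
    define r0 where "r0 = (\<Sum>p<K k. r p)"
    have R: "finite R" "R \<subseteq> Collect rep" by (auto simp: R_def qr)
    have rr: "hbox (r p) \<subseteq> hbox r0" if "p < K k" for p
      using that unfolding r0_def by (intro hbox_mono member_le_sum) auto
    have "\<forall>\<^sub>F n in sequentially. \<forall>p\<in>{..<K k}. sh n (q p) = sh n p \<and> place (ce n p) (ca n p) ` strip k \<subseteq> place (ce n (q p)) (ca n (q p)) ` hbox (r p)"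
      using qr(2) by (intro eventually_ball_finite) auto
    then have ev: "\<forall>\<^sub>F n in sequentially. c \<le> ennreal (128 * scale k * C) + (\<Sum>p\<in>R. emeasure hypvol (view U n p \<inter> hbox r0))"
    proof eventually_elim
      case (elim n)
      have "\<exists>q\<in>R. sh n q = sh n p \<and> place (ce n p) (ca n p) ` strip k \<subseteq> place (ce n q) (ca n q) ` hbox r0" if "p < K k" for p
        using elim that rr[OF that] unfolding R_def by blast
      from mass_le_views[OF U C hv R(1) this] show ?case
        unfolding mass view_def by blast
    qed
    have "c \<le> ennreal (128 * scale k * C) + (\<Sum>p\<in>R. emeasure hypvol (V p \<inter> hbox r0))"
      by (rule tendsto_le[OF _ tendsto_add[OF tendsto_const sum_views_tendsto[OF U V]] tendsto_const ev]) simp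
    also have "(\<Sum>p\<in>R. emeasure hypvol (V p \<inter> hbox r0)) \<le> (\<Sum>p\<in>R. emeasure hypvol (V p))"
      using V(1) by (intro sum_mono emeasure_mono) (auto simp: sets_hyp_measure)
    also have "\<dots> \<le> T"
      unfolding T_def by (rule sum_le_infsum_ennreal[OF R])
    finally show ?thesis by (simp add: add_left_mono)
  qed
  have "(\<lambda>k. ennreal (128 * scale k * C) + T) \<longlonglongrightarrow> ennreal (128 * 0 * C) + T"
  proof (intro tendsto_add tendsto_const tendsto_ennrealI tendsto_mult)
    show "(\<lambda>k. scale k) \<longlonglongrightarrow> 0"
      using LIMSEQ_power_zero[of "1 / 2 :: real"] by (simp add: power_one_over)
  qed
  then have "c \<le> ennreal (128 * 0 * C) + T"
    by (rule LIMSEQ_le_const) (use step in auto)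
  then show ?thesis by (simp add: T_def)
qed

text \<open>Lower semicontinuity: the fluxes of finitely many fixed fields through the limits are limits of fluxes
  through the views, and these add up to at most the perimeters of the approximating sets.\<close>

lemma sum_limits_perimeter_le:
  fixes U :: "'j \<Rightarrow> nat \<Rightarrow> int \<Rightarrow> complex set"
  assumes U: "\<And>j n s. j \<in> Y \<Longrightarrow> U j n s \<in> sets hyp_measure"
    and V: "\<And>j p. j \<in> Y \<Longrightarrow> V j p \<in> sets hyp_measure" "\<And>j p. j \<in> Y \<Longrightarrow> loc_conv (\<lambda>n. view (U j) n p) (V j p)"
    and b: "\<And>n S. finite S \<Longrightarrow> (\<Sum>j\<in>Y. \<Sum>s\<in>S. perimeter (U j n s)) \<le> b n" "b \<longlonglongrightarrow> b0"
    and Y: "finite Y" and R: "finite R" "\<forall>p\<in>R. rep p"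
  shows "(\<Sum>j\<in>Y. \<Sum>p\<in>R. perimeter (V j p)) \<le> b0"
proof -
  have "(\<Sum>j\<in>Y. \<Sum>p\<in>R. perimeter (V j p)) = (\<Sum>x\<in>Y \<times> R. perimeter (V (fst x) (snd x)))"
    by (simp add: sum.cartesian_product case_prod_unfold)
  also have "\<dots> \<le> b0"
  proof (rule sum_perimeter_le)
    show "finite (Y \<times> R)" using Y R by simp
    show "V (fst x) (snd x) \<in> sets hyp_measure" if "x \<in> Y \<times> R" for x
      using that by (intro V) auto
    fix v assume v: "\<And>x. x \<in> Y \<times> R \<Longrightarrow> v x \<in> unit_fields"
    have "\<exists>r. \<forall>z\<in>hyp_plane. v x z \<noteq> 0 \<longrightarrow> z \<in> hbox r" if x: "x \<in> Y \<times> R" for x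
    proof -
      obtain Q where Q: "compact Q" "Q \<subseteq> hyp_plane" "\<And>z. z \<in> hyp_plane \<Longrightarrow> v x z \<noteq> 0 \<Longrightarrow> z \<in> Q"
        using test_field_support[of "v x"] v[OF x] by (auto simp: unit_fields_def)
      obtain r where "Q \<subseteq> hbox r" using compact_subset_hbox[OF Q(1,2)] .
      with Q(3) show ?thesis by blast
    qed
    then obtain r where r: "\<And>x z. x \<in> Y \<times> R \<Longrightarrow> z \<in> hyp_plane \<Longrightarrow> v x z \<noteq> 0 \<Longrightarrow> z \<in> hbox (r x)"
      by metis
    define r0 where "r0 = (\<Sum>x\<in>Y \<times> R. r x)"
    have r0: "z \<in> hbox r0" if "x \<in> Y \<times> R" "z \<in> hyp_plane" "v x z \<noteq> 0" for x z
      using r[OF that] hbox_mono[of "r x" r0] member_le_sum[of x "Y \<times> R" r] that(1) Y R unfolding r0_def by auto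
    have "(\<lambda>n. \<Sum>x\<in>Y \<times> R. ennreal (flux (view (U (fst x)) n (snd x)) (v x))) \<longlonglongrightarrow> (\<Sum>x\<in>Y \<times> R. ennreal (flux (V (fst x) (snd x)) (v x)))"
      using v by (intro tendsto_sum tendsto_ennrealI loc_conv_flux view_sets U V) (auto simp: unit_fields_def)
    moreover have "\<forall>\<^sub>F n in sequentially. (\<Sum>x\<in>Y \<times> R. ennreal (flux (view (U (fst x)) n (snd x)) (v x))) \<le> b n"
      using reps_separated[OF R, of r0]
    proof eventually_elim
      case (elim n)
      have "(\<Sum>x\<in>Y \<times> R. ennreal (flux (view (U (fst x)) n (snd x)) (v x))) = (\<Sum>j\<in>Y. \<Sum>p\<in>R. ennreal (flux (view (U j) n p) (v (j, p))))"
        by (simp add: sum.cartesian_product case_prod_unfold)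
      also have "\<dots> \<le> (\<Sum>j\<in>Y. \<Sum>s\<in>sh n ` R. perimeter (U j n s))"
      proof (rule sum_mono)
        fix j assume j: "j \<in> Y"
        show "(\<Sum>p\<in>R. ennreal (flux (view (U j) n p) (v (j, p)))) \<le> (\<Sum>s\<in>sh n ` R. perimeter (U j n s))"
          unfolding view_def
        proof (rule sum_view_flux_le[OF R(1), of _ _ _ r0])
          show "v (j, p) \<in> unit_fields" if "p \<in> R" for p using v j that by simp
          show "z \<in> hbox r0" if "p \<in> R" "z \<in> hyp_plane" "v (j, p) z \<noteq> 0" for p z
            using r0[of "(j, p)" z] j that by simp
        qed (use elim U[OF j] in blast)+
      qed
      also have "\<dots> \<le> b n"
        using R(1) by (intro b) auto
      finally show ?case .
    qed
    ultimately show "(\<Sum>x\<in>Y \<times> R. ennreal (flux (V (fst x) (snd x)) (v x))) \<le> b0"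
      by (intro tendsto_le[OF sequentially_bot b(2)])
  qed
  finally show ?thesis .
qed

end

section \<open>Existence of minimal generalized clusters\<close>

lemma zero_not_in_cluster_indices: "0 \<notin> cluster_indices N"
  by (simp add: cluster_indices_def)

text \<open>With the union as one more chamber, of index 0, twice the perimeter of a cluster is a single sum.\<close>

definition chamber :: "enat \<Rightarrow> (nat \<Rightarrow> complex set) \<Rightarrow> nat \<Rightarrow> complex set" where
  "chamber N E j = (if j = 0 then \<Union>i\<in>cluster_indices N. E i else E j)"

lemma chamber_index [simp]: "i \<in> cluster_indices N \<Longrightarrow> chamber N E i = E i"
  using zero_not_in_cluster_indices[of N] by (auto simp: chamber_def)

lemma chamber_0: "chamber N E 0 = (\<Union>i\<in>cluster_indices N. E i)"
  by (simp add: chamber_def)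

lemma double_half_ennreal: "2 * (x / 2) = (x :: ennreal)"
  by (simp add: ennreal_times_divide ennreal_mult_divide_eq mult.commute)

lemma cluster_perimeter_chambers:
  "2 * cluster_perimeter N E = (\<Sum>\<^sub>\<infinity>j\<in>insert 0 (cluster_indices N). perimeter (chamber N E j))"
proof -
  have "(\<Sum>\<^sub>\<infinity>j\<in>{0} \<union> cluster_indices N. perimeter (chamber N E j)) =
      (\<Sum>\<^sub>\<infinity>j\<in>{0}. perimeter (chamber N E j)) + (\<Sum>\<^sub>\<infinity>j\<in>cluster_indices N. perimeter (chamber N E j))"
    using zero_not_in_cluster_indices[of N] by (intro infsum_Un_disjoint summable_on_ennreal) auto
  also have "(\<Sum>\<^sub>\<infinity>j\<in>{0}. perimeter (chamber N E j)) = perimeter (\<Union>i\<in>cluster_indices N. E i)"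
    by (simp add: chamber_def)
  also have "(\<Sum>\<^sub>\<infinity>j\<in>cluster_indices N. perimeter (chamber N E j)) = (\<Sum>\<^sub>\<infinity>j\<in>cluster_indices N. perimeter (E j))"
    by (intro infsum_cong) simp
  finally show ?thesis
    unfolding cluster_perimeter_def by (simp add: distrib_left double_half_ennreal add.commute)
qed

lemma sum_perimeter_le_gen_perimeter:
  assumes "finite S" "finite Y" "Y \<subseteq> insert 0 (cluster_indices N)"
  shows "(\<Sum>j\<in>Y. \<Sum>s\<in>S. perimeter (chamber N (slice F s) j)) \<le> 2 * gen_perimeter N F"
proof -
  have "(\<Sum>j\<in>Y. \<Sum>s\<in>S. perimeter (chamber N (slice F s) j)) = (\<Sum>s\<in>S. \<Sum>j\<in>Y. perimeter (chamber N (slice F s) j))"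
    by (rule sum.swap)
  also have "\<dots> \<le> (\<Sum>s\<in>S. 2 * cluster_perimeter N (slice F s))"
    unfolding cluster_perimeter_chambers by (intro sum_mono sum_le_infsum_ennreal assms)
  also have "\<dots> = 2 * (\<Sum>s\<in>S. cluster_perimeter N (slice F s))"
    by (simp add: sum_distrib_left)
  also have "\<dots> \<le> 2 * gen_perimeter N F"
    unfolding gen_perimeter_def by (intro mult_left_mono sum_le_infsum_ennreal assms) auto
  finally show ?thesis .
qed

lemma infsum_perimeter_le_gen_perimeter:
  assumes "j \<in> insert 0 (cluster_indices N)"
  shows "(\<Sum>\<^sub>\<infinity>s\<in>UNIV. perimeter (chamber N (slice F s) j)) \<le> 2 * gen_perimeter N F"
proof (rule infsum_ennreal_leI)
  fix S :: "int set" assume "finite S"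
  then show "(\<Sum>s\<in>S. perimeter (chamber N (slice F s) j)) \<le> 2 * gen_perimeter N F"
    using sum_perimeter_le_gen_perimeter[of S "{j}" N F] assms by simp
qed

lemma gen_perimeter_leI:
  assumes "\<And>S Y. finite S \<Longrightarrow> finite Y \<Longrightarrow> Y \<subseteq> insert 0 (cluster_indices N) \<Longrightarrow>
    (\<Sum>j\<in>Y. \<Sum>s\<in>S. perimeter (chamber N (slice F s) j)) \<le> 2 * c"
  shows "gen_perimeter N F \<le> c"
  unfolding gen_perimeter_def
proof (rule infsum_ennreal_leI)
  fix S :: "int set" assume S: "finite S"
  have "2 * (\<Sum>s\<in>S. cluster_perimeter N (slice F s)) = (\<Sum>s\<in>S. 2 * cluster_perimeter N (slice F s))"
    by (simp add: sum_distrib_left)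
  also have "\<dots> = (\<Sum>\<^sub>\<infinity>j\<in>insert 0 (cluster_indices N). \<Sum>s\<in>S. perimeter (chamber N (slice F s) j))"
    unfolding cluster_perimeter_chambers by (rule sum_infsum_ennreal[OF S])
  also have "\<dots> \<le> 2 * c"
    by (rule infsum_ennreal_leI) (rule assms[OF S])
  finally show "(\<Sum>s\<in>S. cluster_perimeter N (slice F s)) \<le> c"
    by (subst (asm) ennreal_mult_le_mult_iff) auto
qed

lemma gen_cluster_slice:
  assumes "is_gen_cluster N F" "i \<in> cluster_indices N"
  shows "slice F s i \<in> sets hyp_measure"
  using assms by (auto simp: is_gen_cluster_def is_cluster_def)

lemma gen_cluster_chamber:
  assumes "is_gen_cluster N F" "j \<in> insert 0 (cluster_indices N)"
  shows "chamber N (slice F s) j \<in> sets hyp_measure"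
  using assms gen_cluster_slice[OF assms(1)] by (auto simp: chamber_def intro!: sets.countable_UN')

lemma gen_mass_eq:
  assumes "\<And>s. slice F s i \<in> sets hyp_measure"
  shows "gen_mass F i = (\<Sum>\<^sub>\<infinity>s\<in>UNIV. emeasure hypvol (slice F s i))"
  unfolding gen_mass_def cluster_mass_def using assms by (intro infsum_cong emeasure_hyp_measure)

text \<open>Chamber \<open>i\<close> is a set of area \<open>m i\<close> in the sheet \<open>i\<close>.\<close>

lemma exists_competitor:
  assumes "\<And>i. i \<in> cluster_indices N \<Longrightarrow> 0 \<le> m i"
  obtains E where "is_gen_cluster N E" "\<And>i. i \<in> cluster_indices N \<Longrightarrow> gen_mass E i = ennreal (m i)"
proof -
  have "\<forall>i. \<exists>B. B \<in> sets hyp_measure \<and> emeasure hypvol B = ennreal (max 0 (m i))"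
    using exists_set_of_area[of "max 0 (m _)"] by (metis max.cobounded1)
  then obtain B where B: "\<And>i. B i \<in> sets hyp_measure" "\<And>i. emeasure hypvol (B i) = ennreal (max 0 (m i))"
    by metis
  define E where "E i = {int i} \<times> B i" for i
  have sl: "slice E s i = (if s = int i then B i else {})" for s i
    using B(1)[of i] by (auto simp: slice_def E_def sheet_def sets_hyp_measure)
  have "is_gen_cluster N E"
    unfolding is_gen_cluster_def is_cluster_def
  proof (intro conjI allI ballI impI)
    fix i show "E i \<subseteq> hyp_plane_infty"
      using B(1)[of i] by (auto simp: E_def hyp_plane_infty_def sets_hyp_measure)
  qed (auto simp: sl B)
  moreover have "gen_mass E i = ennreal (m i)" if "i \<in> cluster_indices N" for i
  proof -
    have "gen_mass E i = (\<Sum>\<^sub>\<infinity>s\<in>UNIV. emeasure hypvol (slice E s i))"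
      by (rule gen_mass_eq) (auto simp: sl B)
    also have "\<dots> = (\<Sum>\<^sub>\<infinity>s\<in>{int i}. emeasure hypvol (slice E s i))"
      by (rule infsum_cong_neutral) (auto simp: sl)
    finally show ?thesis
      using assms[OF that] by (simp add: sl B)
  qed
  ultimately show ?thesis using that by blast
qed

text \<open>The area of each chamber in each sheet is at most its perimeter there.\<close>

lemma summable_masses:
  assumes F: "is_gen_cluster N F" and m: "\<And>i. i \<in> cluster_indices N \<Longrightarrow> 0 \<le> m i"
    and mass: "\<And>i. i \<in> cluster_indices N \<Longrightarrow> gen_mass F i = ennreal (m i)"
    and C: "gen_perimeter N F \<le> ennreal C" "0 \<le> C"
  shows "summable (\<lambda>i. if i \<in> cluster_indices N then m i else 0)"
proof (rule bounded_imp_summable[of _ "2 * C"])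
  fix n
  let ?X = "{..n} \<inter> cluster_indices N"
  have area: "emeasure hypvol (slice F s i) \<le> perimeter (chamber N (slice F s) i)" if i: "i \<in> cluster_indices N" for s i
  proof -
    have "emeasure hypvol (slice F s i) \<le> gen_mass F i"
      unfolding gen_mass_eq[OF gen_cluster_slice[OF F i]] by (rule infsum_ennreal_upper)
    then have "emeasure hypvol (slice F s i) < \<infinity>"
      unfolding mass[OF i] by (rule order_le_less_trans) simp
    then show ?thesis
      using i gen_cluster_slice[OF F i] by (simp add: emeasure_le_perimeter)
  qed
  have "ennreal (\<Sum>i\<le>n. if i \<in> cluster_indices N then m i else 0) = (\<Sum>i\<le>n. ennreal (if i \<in> cluster_indices N then m i else 0))"
    using m by (intro sum_ennreal[symmetric]) auto
  also have "\<dots> = (\<Sum>i\<in>?X. \<Sum>\<^sub>\<infinity>s\<in>UNIV. emeasure hypvol (slice F s i))"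
    using mass by (intro sum.mono_neutral_cong_right) (auto simp: gen_mass_eq[OF gen_cluster_slice[OF F], symmetric])
  also have "\<dots> \<le> (\<Sum>i\<in>?X. \<Sum>\<^sub>\<infinity>s\<in>UNIV. perimeter (chamber N (slice F s) i))"
    by (intro sum_mono infsum_mono summable_on_ennreal area) auto
  also have "\<dots> = (\<Sum>\<^sub>\<infinity>s\<in>UNIV. \<Sum>i\<in>?X. perimeter (chamber N (slice F s) i))"
    by (rule sum_infsum_ennreal) simp
  also have "\<dots> \<le> 2 * gen_perimeter N F"
  proof (rule infsum_ennreal_leI)
    fix S :: "int set" assume "finite S"
    then show "(\<Sum>s\<in>S. \<Sum>i\<in>?X. perimeter (chamber N (slice F s) i)) \<le> 2 * gen_perimeter N F"
      using sum_perimeter_le_gen_perimeter[of S ?X N F] by (subst sum.swap) auto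
  qed
  also have "\<dots> \<le> ennreal (2 * C)"
    using mult_left_mono[OF C(1), of 2] C(2) by (simp add: ennreal_mult)
  finally show "(\<Sum>i\<le>n. if i \<in> cluster_indices N then m i else 0) \<le> 2 * C"
    using C(2) by (simp add: ennreal_le_iff)
qed (use m in simp)

text \<open>The sheets of the limit cluster are numbered by the frames, through \<^const>\<open>int_encode\<close>.  The sheet of
  a representative contains the local limit of the clusters seen from this frame; the other
  sheets are empty.\<close>

lemma exists_limit_cluster:
  fixes F :: "nat \<Rightarrow> nat \<Rightarrow> (int \<times> complex) set"
  assumes F: "\<And>n. is_gen_cluster N (F n)" and m: "\<And>i. i \<in> cluster_indices N \<Longrightarrow> 0 \<le> m i"
    and mass: "\<And>n i. i \<in> cluster_indices N \<Longrightarrow> gen_mass (F n) i = ennreal (m i)"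
    and C: "\<And>n. gen_perimeter N (F n) \<le> ennreal C" "0 \<le> C" and lim: "(\<lambda>n. gen_perimeter N (F n)) \<longlonglongrightarrow> P0"
  shows "\<exists>E. is_gen_cluster N E \<and> (\<forall>i\<in>cluster_indices N. gen_mass E i = ennreal (m i)) \<and> gen_perimeter N E \<le> P0"
proof -
  let ?I = "cluster_indices N" and ?J = "insert 0 (cluster_indices N)"
  have C2: "(\<Sum>\<^sub>\<infinity>s\<in>UNIV. perimeter (chamber N (slice (F n) s) j)) \<le> ennreal (2 * C)" if "j \<in> ?J" for n j
  proof -
    have "(\<Sum>\<^sub>\<infinity>s\<in>UNIV. perimeter (chamber N (slice (F n) s) j)) \<le> 2 * gen_perimeter N (F n)"
      using that by (rule infsum_perimeter_le_gen_perimeter)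
    also have "\<dots> \<le> 2 * ennreal C" by (intro mult_left_mono C) simp
    also have "\<dots> = ennreal (2 * C)" using C(2) by (simp add: ennreal_mult)
    finally show ?thesis .
  qed
  have massU: "(\<Sum>\<^sub>\<infinity>s\<in>UNIV. emeasure hypvol (slice (F n) s i)) = ennreal (m i)" if "i \<in> ?I" for n i
    using mass[OF that, of n] gen_cluster_slice[OF F] that by (simp add: gen_mass_eq)
  define m' where "m' i = (if i \<in> ?I then m i else 0)" for i
  have m'0: "0 \<le> m' i" for i using m by (simp add: m'_def)
  have summ: "summable m'"
    using summable_masses[OF F[of 0] _ _ C(1)[of 0] C(2), of m] m mass by (simp add: m'_def[abs_def])
  obtain \<rho> sh ce ca K where \<rho>: "strict_mono \<rho>" and fr: "frames sh ce ca"
    and hv: "\<And>n i k. i \<in> ?I \<Longrightarrow> heavy (\<lambda>s. slice (F (\<rho> n)) s i) k \<subseteq> (\<lambda>p. (sh n p, ce n p, ca n p)) ` {..<K i k}"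
    and cv: "\<And>i p e a b. i \<in> ?I \<Longrightarrow> convergent (\<lambda>n. measure lborel (place (ce n p) (ca n p) -` slice (F (\<rho> n)) (sh n p) i \<inter> cell e a b))"
  proof (rule exists_frames[of ?I "\<lambda>n i s. slice (F n) s i" m])
    show "slice (F n) s i \<in> sets hyp_measure" if "i \<in> ?I" for n i s
      using gen_cluster_slice[OF F] that by simp
    show "(\<Sum>\<^sub>\<infinity>s\<in>UNIV. emeasure hypvol (slice (F n) s i)) \<le> ennreal (m i)" if "i \<in> ?I" for n i
      using massU[OF that] by simp
    fix \<rho> sh ce ca K
    assume "strict_mono \<rho>" "frames sh ce ca"
      "\<And>n i k. i \<in> ?I \<Longrightarrow> heavy (\<lambda>s. slice (F (\<rho> n)) s i) k \<subseteq> (\<lambda>p. (sh n p, ce n p, ca n p)) ` {..<K i k}"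
      "\<And>i p e a b. i \<in> ?I \<Longrightarrow> convergent (\<lambda>n. measure lborel (place (ce n p) (ca n p) -` slice (F (\<rho> n)) (sh n p) i \<inter> cell e a b))"
    then show thesis by (rule that)
  qed (rule m)
  interpret frames sh ce ca by (rule fr)
  define U where "U j n s = chamber N (slice (F (\<rho> n)) s) j" for j n s
  have U_set: "U j n s \<in> sets hyp_measure" if "j \<in> ?J" for j n s
    unfolding U_def by (rule gen_cluster_chamber[OF F]) (use that in simp)
  have U_slice: "U i n s = slice (F (\<rho> n)) s i" if "i \<in> ?I" for i n s
    unfolding U_def by (rule chamber_index) (use that in simp)
  have U_mass: "(\<Sum>\<^sub>\<infinity>s\<in>UNIV. emeasure hypvol (U i n s)) = ennreal (m i)" if "i \<in> ?I" for i n
    using massU[OF that] by (simp add: U_slice[OF that])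
  have view_set: "view (U j) n p \<in> sets hyp_measure" if "j \<in> ?J" for j n p
    by (intro view_sets U_set that)
  have view_mass: "emeasure hypvol (view (U i) n p) \<le> ennreal (m i)" if "i \<in> ?I" for i n p
  proof -
    have "emeasure hypvol (view (U i) n p) = emeasure hypvol (U i n (sh n p))"
      using U_set[of i] that by (simp add: view_def emeasure_place_vimage sets_hyp_measure)
    also have "\<dots> \<le> ennreal (m i)"
      unfolding U_mass[OF that, symmetric, of n] by (rule infsum_ennreal_upper)
    finally show ?thesis .
  qed
  have "\<exists>V\<in>sets hyp_measure. loc_conv (\<lambda>n. view (U i) n p) V" if "i \<in> ?I" for p i
  proof (rule loc_conv_compact[of _ "2 * C"])
    show "view (U i) n p \<in> sets hyp_measure" for n using view_set that by simp
    show "perimeter (view (U i) n p) \<le> ennreal (2 * C)" for n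
    proof -
      have "perimeter (view (U i) n p) \<le> perimeter (U i n (sh n p))"
        unfolding view_def using that by (intro perimeter_place_le U_set) simp
      also have "\<dots> \<le> (\<Sum>\<^sub>\<infinity>s\<in>UNIV. perimeter (U i n s))"
        by (rule infsum_ennreal_upper)
      finally show ?thesis
        using C2[of i "\<rho> n"] that by (simp add: U_def)
    qed
    show "convergent (\<lambda>n. measure lborel (view (U i) n p \<inter> cell e a b))" for e a b
      using cv[OF that, of p e a b] that by (simp add: view_def U_slice)
  qed (use C in simp)
  then obtain V0 where V0: "\<And>p i. i \<in> ?I \<Longrightarrow> V0 p i \<in> sets hyp_measure" "\<And>p i. i \<in> ?I \<Longrightarrow> loc_conv (\<lambda>n. view (U i) n p) (V0 p i)"
    by metis
  \<comment> \<open>The limits of the unions are the unions of the limits, as the masses are summable.\<close>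
  define V where "V j p = chamber N (V0 p) j" for j p
  have V_index: "V i p = V0 p i" if "i \<in> ?I" for i p
    unfolding V_def by (rule chamber_index) (use that in simp)
  have V_set: "V j p \<in> sets hyp_measure" if "j \<in> ?J" for p j
    using that V0(1) unfolding V_def by (auto simp: chamber_def intro!: sets.countable_UN')
  have V_conv: "loc_conv (\<lambda>n. view (U j) n p) (V j p)" if j: "j \<in> ?J" for p j
  proof (cases "j = 0")
    case True
    have "loc_conv (\<lambda>n. \<Union>i\<in>?I. view (U i) n p) (\<Union>i\<in>?I. V0 p i)"
    proof (rule loc_conv_UN[of _ _ _ m'])
      show "emeasure hypvol (V0 p i) \<le> ennreal (m' i)" if "i \<in> ?I" for i
      proof (rule loc_conv_emeasure_le[OF _ V0(1)[OF that] V0(2)[OF that]])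
        show "view (U i) n p \<in> sets hyp_measure" for n
          by (rule view_set) (use that in simp)
        show "emeasure hypvol (view (U i) n p) \<le> ennreal (m' i)" for n
          using view_mass[OF that] that by (simp add: m'_def)
      qed
    qed (use V0 view_set view_mass m'0 summ in \<open>auto simp: m'_def\<close>)
    moreover have "(\<Union>i\<in>?I. view (U i) n p) = view (U j) n p" for n
      using True by (simp add: view_def U_def chamber_0 vimage_UN)
    ultimately show ?thesis
      using True by (simp add: V_def chamber_def)
  next
    case False
    with j V0(2) show ?thesis by (simp add: V_index)
  qed
  define W where "W p i = (if rep p then V i p else {})" for p i
  have W_chamber: "chamber N (W p) j = W p j" if "j \<in> ?J" for p j
  proof (cases "j = 0")
    case True
    then show ?thesis
      by (cases "rep p") (simp_all add: chamber_0 W_def V_def)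
  next
    case False
    then show ?thesis by (simp add: chamber_def)
  qed
  define E where "E i = {(s, z). z \<in> W (int_encode s) i}" for i
  have W_set: "W p j \<in> sets hyp_measure" if "j \<in> ?J" for p j
    using V_set[OF that] by (simp add: W_def)
  have sl: "slice E s i = W (int_encode s) i" if "i \<in> ?I" for s i
    using W_set[of i "int_encode s"] that by (auto simp: slice_def E_def sheet_def sets_hyp_measure)
  have sl_ch: "chamber N (slice E s) j = W (int_encode s) j" if "j \<in> ?J" for s j
  proof -
    have "chamber N (slice E s) j = chamber N (W (int_encode s)) j"
      using that sl by (auto simp: chamber_def)
    then show ?thesis using W_chamber[OF that] by simp
  qed
  have cluster: "is_gen_cluster N E"
    unfolding is_gen_cluster_def is_cluster_def
  proof (intro conjI allI ballI impI)
    fix i assume i: "i \<in> cluster_indices N"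
    have "W p i \<subseteq> hyp_plane" for p
      using W_set[of i p] i by (simp add: sets_hyp_measure)
    then show "E i \<subseteq> hyp_plane_infty"
      by (auto simp: E_def hyp_plane_infty_def)
  next
    fix s i assume "i \<in> cluster_indices N"
    then show "slice E s i \<in> sets hyp_measure" using W_set[of i] by (simp add: sl)
  next
    fix s i j assume ij: "i \<in> cluster_indices N" "j \<in> cluster_indices N" "i \<noteq> j"
    let ?p = "int_encode s"
    have "emeasure hypvol (V i ?p \<inter> V j ?p) = 0"
    proof (rule loc_conv_null_inter[of "\<lambda>n. view (U i) n ?p" "\<lambda>n. view (U j) n ?p"])
      fix n
      have sets: "slice (F (\<rho> n)) (sh n ?p) i \<in> sets hyp_measure" "slice (F (\<rho> n)) (sh n ?p) j \<in> sets hyp_measure"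
        using gen_cluster_slice[OF F] ij by auto
      have "emeasure hyp_measure (slice (F (\<rho> n)) (sh n ?p) i \<inter> slice (F (\<rho> n)) (sh n ?p) j) = 0"
        using F[of "\<rho> n"] ij by (auto simp: is_gen_cluster_def is_cluster_def)
      then have "emeasure hypvol (slice (F (\<rho> n)) (sh n ?p) i \<inter> slice (F (\<rho> n)) (sh n ?p) j) = 0"
        using sets emeasure_hyp_measure[of "slice (F (\<rho> n)) (sh n ?p) i \<inter> slice (F (\<rho> n)) (sh n ?p) j"] by auto
      moreover have "view (U i) n ?p \<inter> view (U j) n ?p = place (ce n ?p) (ca n ?p) -` (slice (F (\<rho> n)) (sh n ?p) i \<inter> slice (F (\<rho> n)) (sh n ?p) j)"
        using ij by (simp add: view_def U_def)
      moreover have "slice (F (\<rho> n)) (sh n ?p) i \<inter> slice (F (\<rho> n)) (sh n ?p) j \<in> sets borel"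
        using sets by (auto simp: sets_hyp_measure)
      ultimately show "emeasure hypvol (view (U i) n ?p \<inter> view (U j) n ?p) = 0"
        by (simp only: emeasure_place_vimage)
    qed (use ij view_set V_set V_conv in auto)
    then have "emeasure hypvol (slice E s i \<inter> slice E s j) = 0"
      using ij by (simp add: sl W_def)
    moreover have "slice E s i \<inter> slice E s j \<in> sets hyp_measure"
      using ij W_set[of i] W_set[of j] by (simp add: sl sets.Int)
    ultimately show "emeasure hyp_measure (slice E s i \<inter> slice E s j) = 0"
      by (simp add: emeasure_hyp_measure)
  qed
  have massE: "gen_mass E i = ennreal (m i)" if i: "i \<in> ?I" for i
  proof -
    have iJ: "i \<in> ?J" using i by simp
    have "gen_mass E i = (\<Sum>\<^sub>\<infinity>s\<in>UNIV. emeasure hypvol (W (int_encode s) i))"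
      using i gen_cluster_slice[OF cluster] by (subst gen_mass_eq) (auto simp: sl)
    also have "\<dots> = (\<Sum>\<^sub>\<infinity>p\<in>UNIV. emeasure hypvol (W p i))"
      by (rule infsum_reindex_bij_betw[OF bij_int_encode])
    also have "\<dots> = (\<Sum>\<^sub>\<infinity>p\<in>Collect rep. emeasure hypvol (V i p))"
      by (rule infsum_cong_neutral) (auto simp: W_def)
    also have "\<dots> = ennreal (m i)"
    proof (rule antisym)
      show "(\<Sum>\<^sub>\<infinity>p\<in>Collect rep. emeasure hypvol (V i p)) \<le> ennreal (m i)"
        by (rule infsum_ennreal_leI, rule sum_limits_emeasure_le[OF U_set[OF iJ] V_set[OF iJ] V_conv[OF iJ]])
           (use U_mass[OF i] in auto)
      show "ennreal (m i) \<le> (\<Sum>\<^sub>\<infinity>p\<in>Collect rep. emeasure hypvol (V i p))"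
      proof (rule mass_le_sum_limits[OF U_set[OF iJ] V_set[OF iJ] V_conv[OF iJ] U_mass[OF i]])
        show "(\<Sum>\<^sub>\<infinity>s\<in>UNIV. perimeter (U i n s)) \<le> ennreal (2 * C)" for n
          using C2[OF iJ] by (simp add: U_def)
        show "heavy (U i n) k \<subseteq> (\<lambda>p. (sh n p, ce n p, ca n p)) ` {..<K i k}" for n k
          using hv[OF i, of n k] by (simp add: U_slice[OF i, abs_def])
      qed (use C in simp)
    qed
    finally show ?thesis .
  qed
  have perE: "gen_perimeter N E \<le> P0"
  proof (rule gen_perimeter_leI)
    fix S :: "int set" and Y assume S: "finite S" and Y: "finite Y" "Y \<subseteq> insert 0 (cluster_indices N)"
    define R where "R = {p \<in> int_encode ` S. rep p}"
    have YJ: "j \<in> ?J" if "j \<in> Y" for j using Y that by auto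
    have "(\<Sum>s\<in>S. perimeter (chamber N (slice E s) j)) = (\<Sum>p\<in>R. perimeter (V j p))" if "j \<in> Y" for j
    proof -
      have "(\<Sum>s\<in>S. perimeter (chamber N (slice E s) j)) = (\<Sum>s\<in>S. perimeter (W (int_encode s) j))"
        by (simp add: sl_ch[OF YJ[OF that]])
      also have "\<dots> = (\<Sum>p\<in>int_encode ` S. perimeter (W p j))"
        by (subst sum.reindex) (auto intro: inj_on_subset[OF inj_int_encode])
      also have "\<dots> = (\<Sum>p\<in>R. perimeter (V j p))"
        unfolding R_def using S by (intro sum.mono_neutral_cong_right) (auto simp: W_def perimeter_empty)
      finally show ?thesis .
    qed
    then have "(\<Sum>j\<in>Y. \<Sum>s\<in>S. perimeter (chamber N (slice E s) j)) = (\<Sum>j\<in>Y. \<Sum>p\<in>R. perimeter (V j p))"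
      by simp
    also have "\<dots> \<le> 2 * P0"
    proof (rule sum_limits_perimeter_le[where U = U and b = "\<lambda>n. 2 * gen_perimeter N (F (\<rho> n))"])
      show "(\<Sum>j\<in>Y. \<Sum>s\<in>S'. perimeter (U j n s)) \<le> 2 * gen_perimeter N (F (\<rho> n))" if "finite S'" for n S'
        unfolding U_def by (rule sum_perimeter_le_gen_perimeter[OF that Y])
      show "(\<lambda>n. 2 * gen_perimeter N (F (\<rho> n))) \<longlonglongrightarrow> 2 * P0"
        using ennreal_tendsto_cmult[OF _ LIMSEQ_subseq_LIMSEQ[OF lim \<rho>], of 2] by (simp add: o_def)
      show "U j n s \<in> sets hyp_measure" if "j \<in> Y" for j n s by (rule U_set[OF YJ[OF that]])
      show "V j p \<in> sets hyp_measure" if "j \<in> Y" for j p by (rule V_set[OF YJ[OF that]])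
      show "loc_conv (\<lambda>n. view (U j) n p) (V j p)" if "j \<in> Y" for j p by (rule V_conv[OF YJ[OF that]])
    qed (use S Y in \<open>auto simp: R_def\<close>)
    finally show "(\<Sum>j\<in>Y. \<Sum>s\<in>S. perimeter (chamber N (slice E s) j)) \<le> 2 * P0" .
  qed
  show ?thesis
    using cluster massE perE by blast
qed

theorem corollary6p2:
  fixes N :: enat and m :: "nat \<Rightarrow> real"
  assumes "\<forall>i\<in>cluster_indices N. 0 \<le> m i"
  shows "\<exists>E. minimal_gen_cluster N E \<and>
           (\<forall>i\<in>cluster_indices N. gen_mass E i = ennreal (m i))"
proof -
  define M where "M = {gen_perimeter N F | F. is_gen_cluster N F \<and> (\<forall>i\<in>cluster_indices N. gen_mass F i = ennreal (m i))}"
  have minimalI: "minimal_gen_cluster N E"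
    if "is_gen_cluster N E" "\<forall>i\<in>cluster_indices N. gen_mass E i = ennreal (m i)" "gen_perimeter N E \<le> Inf M" for E
  proof -
    have "gen_perimeter N E \<in> M" using that by (auto simp: M_def)
    then have "gen_perimeter N E = Inf M"
      using that(3) by (intro antisym Inf_lower) auto
    moreover have "{gen_perimeter N F | F. is_gen_cluster N F \<and> (\<forall>i\<in>cluster_indices N. gen_mass F i = gen_mass E i)} = M"
      using that(2) by (auto simp: M_def)
    ultimately show ?thesis
      using that(1) by (simp add: minimal_gen_cluster_def)
  qed
  obtain E0 where E0: "is_gen_cluster N E0" "\<forall>i\<in>cluster_indices N. gen_mass E0 i = ennreal (m i)"
    using exists_competitor[of N m] assms by metis
  then have "M \<noteq> {}" by (auto simp: M_def)
  show ?thesis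
  proof (cases "Inf M")
    case top
    then have "gen_perimeter N E0 \<le> Inf M" by (simp only: top top_greatest)
    with minimalI[OF E0] E0(2) show ?thesis by blast
  next
    case (real c)
    obtain u where u: "\<And>n. u n \<in> M" "u \<longlonglongrightarrow> Inf M"
      using Inf_as_limit[OF \<open>M \<noteq> {}\<close>] by blast
    have "\<forall>n. \<exists>F. u n = gen_perimeter N F \<and> is_gen_cluster N F \<and> (\<forall>i\<in>cluster_indices N. gen_mass F i = ennreal (m i))"
      using u(1) by (auto simp: M_def)
    then obtain F where F: "\<And>n. u n = gen_perimeter N (F n)" "\<And>n. is_gen_cluster N (F n)"
        "\<And>n i. i \<in> cluster_indices N \<Longrightarrow> gen_mass (F n) i = ennreal (m i)"
      by metis
    have "Inf M < ennreal (c + 1)"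
      using real by (simp add: ennreal_less_iff)
    from order_tendstoD(2)[OF u(2) this] obtain n0 where n0: "\<And>n. n0 \<le> n \<Longrightarrow> u n < ennreal (c + 1)"
      by (auto simp: eventually_sequentially)
    have "\<exists>E. is_gen_cluster N E \<and> (\<forall>i\<in>cluster_indices N. gen_mass E i = ennreal (m i)) \<and> gen_perimeter N E \<le> Inf M"
    proof (rule exists_limit_cluster[of N "\<lambda>n. F (n + n0)"])
      show "gen_perimeter N (F (n + n0)) \<le> ennreal (c + 1)" for n
        using n0[of "n + n0"] F(1)[of "n + n0"] by simp
      show "(\<lambda>n. gen_perimeter N (F (n + n0))) \<longlonglongrightarrow> Inf M"
        using LIMSEQ_ignore_initial_segment[OF u(2), of n0] by (simp add: F(1))
    qed (use F assms real in auto)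
    with minimalI show ?thesis by blast
  qed
qed

end
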